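(* Assume that $1<p<\infty$ and that $X$ is a proper connected metric space equipped with a locally doubling measure $\mu$ supporting a local $p$-Poincaré inequality. Let $\Omega\subset X$ be an open set (bounded or unbounded). Then the following properties hold: (a) If $E_1\subset E_2\subset\cdots\subset\Omega$, then $$\mathrm{cap}_p\biggl(\bigcup_{i=1}^\infty E_i,\Omega\biggr)=\lim_{i\to\infty}\mathrm{cap}_p(E_i,\Omega).$$ (b) (Countable subadditivity) If $E_1,E_2,\dots\subset\Omega$, then $$\mathrm{cap}_p\biggl(\bigcup_{i=1}^\infty E_i,\Omega\biggr)\le\sum_{i=1}^\infty\mathrm{cap}_p(E_i,\Omega).$$
   Context: $X=(X,d,\mu)$ is a metric space equipped with a positive complete Borel measure $\mu$ with $0<\mu(B)<\infty$ for every ball $B$. Balls are open and come with a fixed centre and radius; $\lambda B(x,r):=B(x,\lambda r)$. $\overline{\mathbf{R}}=[-\infty,\infty]$ and $\chi_A$ is the characteristic function of $A$. The sets $E_i$ are arbitrary (not necessarily bounded or measurable). Upper gradients. A curve is a nonconstant compact rectifiable curve, parameterized by arc length $ds$. A property holds for $p$-almost every curve if there is a nonnegative $\rho\in L^p(X)$ with $\int_\gamma\rho\,ds=\infty$ for every curve $\gamma$ for which it fails. A measurable $g:X\to[0,\infty]$ is a $p$-weak upper gradient of $f:X\to\overline{\mathbf{R}}$ if for $p$-almost all curves $\gamma:[0,l_\gamma]\to X$, $|f(\gamma(0))-f(\gamma(l_\gamma))|\le\int_\gamma g\,ds$, where the left-hand side is $\infty$ if at least one of the terms is infinite. If $f$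 has a $p$-weak upper gradient in $L^p_{\rm loc}(X)$, then $g_f$ denotes its minimal $p$-weak upper gradient ($g_f\le g$ a.e. for every $p$-weak upper gradient $g\in L^p_{\rm loc}(X)$ of $f$). $N^{1,p}(X)$ is the space of measurable $f$, defined everywhere with values in $\overline{\mathbf{R}}$, with $\|f\|_{N^{1,p}(X)}^p=\int_X|f|^p\,d\mu+\inf_g\int_X g^p\,d\mu<\infty$, infimum over all $p$-weak upper gradients $g$ of $f$. For measurable $E\subset X$ these notions are defined by regarding $(E,d|_E,\mu|_E)$ as a metric space. Doubling and Poincaré. $\mu$ is doubling within an open set $U$ if there is $C>0$ with $\mu(2B)\le C\mu(B)$ for all balls $B\subset U$. The $p$-Poincaré inequality holds within $U$ if there are $C>0$, $\lambda\ge1$ such that for all balls $B\subset U$ with radius $r_B$, all integrable $u$ on $\lambda B$ and all $p$-weak upper gradients $g$ of $u$ in $\lambda B$, $\frac1{\mu(B)}\int_B|u-u_B|\,d\mu\le Cr_B\bigl(\frac1{\mu(\lambda B)}\int_{\lambda B}g^p\,d\mu\bigr)^{1/p}$, where $u_B=\frac1{\mu(B)}\int_B u\,d\mu$. Each property is local if for every $x\in X$ there is $r>0$ such that it holds within $B(x,r)$. $X$ is proper if all closed bounded sets are compact. Condenser capacity. For open $\Omega$ and bounded $E\subset\Omega$, $\mathrm{cap}_p(E,\Omega)=\inf_u\int_\Omega g_u^p\,d\mu$ over $u\in N^{1,p}(X)$ with $\chi_E\le u\le\chi_\Omega$ ($=\infty$ if there is no such $u$); for unbounded $E\subset\Omega$,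 $\mathrm{cap}_p(E,\Omega)=\lim_{j\to\infty}\mathrm{cap}_p(E\cap B(x_0,j),\Omega)$, where $x_0\in X$ is any fixed point (the limit does not depend on it). Also $\mathrm{cap}_p(\emptyset,\emptyset)=0$. *)

theory Defs
  imports "HOL-Analysis.Analysis"
begin

section \<open>Metric measure spaces\<close>

text \<open>
  The space \<open>X\<close> is the whole type \<open>'a\<close>. The measurable sets of a complete Borel measure are those
  of the completion of the Borel \<open>\<sigma>\<close>-algebra.
\<close>

definition complete_borel_measure :: "'a::metric_space measure \<Rightarrow> bool" where
  "complete_borel_measure M \<longleftrightarrow> (\<exists>N. sets N = sets borel \<and> M = completion N)"

definition metric_measure_space :: "'a::metric_space measure \<Rightarrow> bool" where
  "metric_measure_space M \<longleftrightarrow>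
     complete_borel_measure M \<and>
     (\<forall>x r. 0 < r \<longrightarrow> 0 < emeasure M (ball x r) \<and> emeasure M (ball x r) < \<infinity>)"

definition proper_space :: "'a::metric_space itself \<Rightarrow> bool" where
  "proper_space _ \<longleftrightarrow> (\<forall>S::'a set. closed S \<and> bounded S \<longrightarrow> compact S)"

text \<open>The power \<open>x\<^sup>p\<close> on \<open>[0,\<infinity>]\<close>, used only for \<open>p > 0\<close>.\<close>

definition epow :: "ennreal \<Rightarrow> real \<Rightarrow> ennreal" where
  "epow x p = (if x = \<infinity> then \<infinity> else ennreal (enn2real x powr p))"

section \<open>Curves\<close>

definition curve_length :: "(real \<Rightarrow> 'a::metric_space) \<Rightarrow> real \<Rightarrow> real \<Rightarrow> ennreal" where
  "curve_length \<gamma> a b =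
     (SUP (n, t) \<in> {(n::nat, t::nat \<Rightarrow> real). mono t \<and> range t \<subseteq> {a..b}}.
        ennreal (\<Sum>i<n. dist (\<gamma> (t i)) (\<gamma> (t (Suc i)))))"

text \<open>
  A nonconstant compact rectifiable curve in \<open>A\<close> is given by its arc length parameterization on
  \<open>[0,l]\<close>, where \<open>0 < l < \<infinity>\<close> is its length; the values of \<open>\<gamma>\<close> outside \<open>[0,l]\<close> are irrelevant.
\<close>

definition arc_curve :: "'a::metric_space set \<Rightarrow> (real \<Rightarrow> 'a) \<Rightarrow> real \<Rightarrow> bool" where
  "arc_curve A \<gamma> l \<longleftrightarrow>
     0 < l \<and> continuous_on {0..l} \<gamma> \<and> \<gamma> ` {0..l} \<subseteq> A \<and>
     (\<forall>s t. 0 \<le> s \<and> s \<le> t \<and> t \<le> l \<longrightarrow> curve_length \<gamma> s t = ennreal (t - s))"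

text \<open>
  For a measurable \<open>\<rho>\<close> the composition \<open>\<rho> \<circ> \<gamma>\<close> can fail to be measurable, but only for an
  exceptional family of curves (see \<open>ae_curve\<close>), on which the value given to the integral by
  \<open>nn_integral\<close> does not matter.
\<close>

definition curve_integral :: "('a \<Rightarrow> ennreal) \<Rightarrow> (real \<Rightarrow> 'a) \<Rightarrow> real \<Rightarrow> ennreal" where
  "curve_integral \<rho> \<gamma> l = (\<integral>\<^sup>+ t\<in>{0..l}. \<rho> (\<gamma> t) \<partial>lebesgue)"

section \<open>Weak upper gradients and Newtonian spaces\<close>

text \<open>
  The argument \<open>A\<close> is a measurable subset of \<open>X\<close>, regarded as the metric measure space
  \<open>(A, d|\<^sub>A, \<mu>|\<^sub>A)\<close>. Functions on \<open>A\<close> are represented by functions on \<open>X\<close> whose values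
  outside \<open>A\<close> are irrelevant.
\<close>

text \<open>Membership in \<open>L\<^sup>p(A)\<close> and \<open>L\<^sup>p\<^sub>l\<^sub>o\<^sub>c(A)\<close> of \<open>[0,\<infinity>]\<close>-valued functions.\<close>

definition Lp_fun :: "'a::metric_space measure \<Rightarrow> real \<Rightarrow> 'a set \<Rightarrow> ('a \<Rightarrow> ennreal) \<Rightarrow> bool" where
  "Lp_fun M p A \<rho> \<longleftrightarrow>
     \<rho> \<in> borel_measurable (restrict_space M A) \<and> (\<integral>\<^sup>+ x\<in>A. epow (\<rho> x) p \<partial>M) < \<infinity>"

definition Lp_loc_fun :: "'a::metric_space measure \<Rightarrow> real \<Rightarrow> 'a set \<Rightarrow> ('a \<Rightarrow> ennreal) \<Rightarrow> bool" where
  "Lp_loc_fun M p A \<rho> \<longleftrightarrow>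
     \<rho> \<in> borel_measurable (restrict_space M A) \<and>
     (\<forall>x\<in>A. \<exists>r>0. Lp_fun M p (A \<inter> ball x r) \<rho>)"

definition ae_curve ::
  "'a::metric_space measure \<Rightarrow> real \<Rightarrow> 'a set \<Rightarrow> ((real \<Rightarrow> 'a) \<Rightarrow> real \<Rightarrow> bool) \<Rightarrow> bool" where
  "ae_curve M p A P \<longleftrightarrow>
     (\<exists>\<rho>. Lp_fun M p A \<rho> \<and>
       (\<forall>\<gamma> l. arc_curve A \<gamma> l \<and> \<not> P \<gamma> l \<longrightarrow> curve_integral \<rho> \<gamma> l = \<infinity>))"

definition ext_diff :: "ereal \<Rightarrow> ereal \<Rightarrow> ennreal" where
  "ext_diff a b = (if \<bar>a\<bar> = \<infinity> \<or> \<bar>b\<bar> = \<infinity> then \<infinity> else e2ennreal \<bar>a - b\<bar>)"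

definition weak_upper_gradient ::
  "'a::metric_space measure \<Rightarrow> real \<Rightarrow> 'a set \<Rightarrow> ('a \<Rightarrow> ereal) \<Rightarrow> ('a \<Rightarrow> ennreal) \<Rightarrow> bool" where
  "weak_upper_gradient M p A f g \<longleftrightarrow>
     g \<in> borel_measurable (restrict_space M A) \<and>
     ae_curve M p A (\<lambda>\<gamma> l. ext_diff (f (\<gamma> 0)) (f (\<gamma> l)) \<le> curve_integral g \<gamma> l)"

definition is_min_weak_upper_gradient ::
  "'a::metric_space measure \<Rightarrow> real \<Rightarrow> 'a set \<Rightarrow> ('a \<Rightarrow> ereal) \<Rightarrow> ('a \<Rightarrow> ennreal) \<Rightarrow> bool" where
  "is_min_weak_upper_gradient M p A f g \<longleftrightarrow>
     weak_upper_gradient M p A f g \<and> Lp_loc_fun M p A g \<and>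
     (\<forall>g'. weak_upper_gradient M p A f g' \<and> Lp_loc_fun M p A g' \<longrightarrow>
        (AE x in restrict_space M A. g x \<le> g' x))"

text \<open>The minimal weak upper gradient \<open>g\<^sub>f\<close> is unique up to null sets; a representative is chosen.\<close>

definition min_weak_upper_gradient ::
  "'a::metric_space measure \<Rightarrow> real \<Rightarrow> 'a set \<Rightarrow> ('a \<Rightarrow> ereal) \<Rightarrow> 'a \<Rightarrow> ennreal" where
  "min_weak_upper_gradient M p A f = (SOME g. is_min_weak_upper_gradient M p A f g)"

text \<open>The \<open>p\<close>-th power of the Newtonian norm, and the space \<open>N\<^sup>1\<^sup>,\<^sup>p(A)\<close>.\<close>

definition newtonian_norm_pow ::
  "'a::metric_space measure \<Rightarrow> real \<Rightarrow> 'a set \<Rightarrow> ('a \<Rightarrow> ereal) \<Rightarrow> ennreal" where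
  "newtonian_norm_pow M p A f =
     (\<integral>\<^sup>+ x\<in>A. epow (e2ennreal \<bar>f x\<bar>) p \<partial>M) +
     (INF g \<in> {g. weak_upper_gradient M p A f g}. \<integral>\<^sup>+ x\<in>A. epow (g x) p \<partial>M)"

definition newtonian ::
  "'a::metric_space measure \<Rightarrow> real \<Rightarrow> 'a set \<Rightarrow> ('a \<Rightarrow> ereal) set" where
  "newtonian M p A =
     {f. f \<in> borel_measurable (restrict_space M A) \<and> newtonian_norm_pow M p A f < \<infinity>}"

section \<open>Doubling and Poincare inequality\<close>

definition doubling_within :: "'a::metric_space measure \<Rightarrow> 'a set \<Rightarrow> bool" where
  "doubling_within M U \<longleftrightarrow>
     (\<exists>C::real. 0 < C \<and>
       (\<forall>x r. 0 < r \<and> ball x r \<subseteq> U \<longrightarrow>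
          emeasure M (ball x (2 * r)) \<le> ennreal C * emeasure M (ball x r)))"

definition locally_doubling :: "'a::metric_space measure \<Rightarrow> bool" where
  "locally_doubling M \<longleftrightarrow> (\<forall>x. \<exists>r>0. doubling_within M (ball x r))"

text \<open>
  Integrable functions may be infinite on a null set, where \<open>real_of_ereal\<close> replaces the value by
  \<open>0\<close> without changing the integral.
\<close>

definition ext_integrable_on :: "'a measure \<Rightarrow> 'a set \<Rightarrow> ('a \<Rightarrow> ereal) \<Rightarrow> bool" where
  "ext_integrable_on M A u \<longleftrightarrow>
     u \<in> borel_measurable (restrict_space M A) \<and> (\<integral>\<^sup>+ x\<in>A. e2ennreal \<bar>u x\<bar> \<partial>M) < \<infinity>"

definition mean_on :: "'a measure \<Rightarrow> 'a set \<Rightarrow> ('a \<Rightarrow> ereal) \<Rightarrow> real" where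
  "mean_on M B u = (\<integral> x. real_of_ereal (u x) \<partial>(restrict_space M B)) / measure M B"

definition poincare_within :: "'a::metric_space measure \<Rightarrow> real \<Rightarrow> 'a set \<Rightarrow> bool" where
  "poincare_within M p U \<longleftrightarrow>
     (\<exists>(C::real) (\<Lambda>::real). 0 < C \<and> 1 \<le> \<Lambda> \<and>
       (\<forall>x r. 0 < r \<and> ball x r \<subseteq> U \<longrightarrow>
         (\<forall>u g. ext_integrable_on M (ball x (\<Lambda> * r)) u \<and>
                weak_upper_gradient M p (ball x (\<Lambda> * r)) u g \<longrightarrow>
            (\<integral>\<^sup>+ y\<in>ball x r. e2ennreal \<bar>u y - ereal (mean_on M (ball x r) u)\<bar> \<partial>M)
                / emeasure M (ball x r)
            \<le> ennreal (C * r) *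
               epow ((\<integral>\<^sup>+ y\<in>ball x (\<Lambda> * r). epow (g y) p \<partial>M)
                      / emeasure M (ball x (\<Lambda> * r))) (1 / p))))"

definition local_poincare :: "'a::metric_space measure \<Rightarrow> real \<Rightarrow> bool" where
  "local_poincare M p \<longleftrightarrow> (\<forall>x. \<exists>r>0. poincare_within M p (ball x r))"

section \<open>Condenser capacity\<close>

definition bounded_cap ::
  "'a::metric_space measure \<Rightarrow> real \<Rightarrow> 'a set \<Rightarrow> 'a set \<Rightarrow> ennreal" where
  "bounded_cap M p E \<Omega> =
     (INF u \<in> {u \<in> newtonian M p UNIV. \<forall>x. indicator E x \<le> u x \<and> u x \<le> indicator \<Omega> x}.
        \<integral>\<^sup>+ x\<in>\<Omega>. epow (min_weak_upper_gradient M p UNIV u x) p \<partial>M)"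

text \<open>
  In the unbounded case the capacity is the limit common to all base points \<open>x\<^sub>0\<close>; it exists since
  \<open>bounded_cap\<close> is monotone in \<open>E\<close>. The argument \<open>E\<close> is meant to be a subset of \<open>\<Omega>\<close>.
\<close>

definition cap ::
  "'a::metric_space measure \<Rightarrow> real \<Rightarrow> 'a set \<Rightarrow> 'a set \<Rightarrow> ennreal" where
  "cap M p E \<Omega> =
     (if E = {} \<and> \<Omega> = {} then 0
      else if bounded E then bounded_cap M p E \<Omega>
      else (THE c. \<forall>x0. (\<lambda>j. bounded_cap M p (E \<inter> ball x0 (real j)) \<Omega>) \<longlonglongrightarrow> c))"

end

theory Submission
  imports Defs
begin

text \<open>
  The capacity of a bounded set is the infimum of the energies of \<open>g\<close> over pairs \<open>(u, g)\<close> of an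
  admissible function and one of its weak upper gradients. For \<open>E 0 \<subseteq> E 1 \<subseteq> \<dots>\<close> take nearly minimal
  pairs \<open>(u i, g i)\<close>. The mean of two such pairs is again a competitor, so uniform convexity of \<open>L\<^sup>p\<close>
  makes \<open>g\<close> a Cauchy sequence; along a fast subsequence all \<open>g i\<close> with \<open>i \<ge> j\<close> lie below one function
  \<open>H\<close> whose energy is close to the limit of the capacities, and \<open>v = (SUP i\<in>{j..}. u i)\<close>, which is \<open>1\<close>
  on the union, has \<open>H\<close> as an upper gradient. Since \<open>v\<close> need not be in \<open>L\<^sup>p\<close>, it is glued on a ball
  around the bounded union to a finite maximum \<open>w\<close> of the \<open>u i\<close>; as \<open>v\<close> and \<open>w\<close> share the upper
  gradient \<open>H\<close>, the gluing costs only \<open>v - w\<close> on a ball, which tends to \<open>0\<close> in \<open>L\<^sup>p\<close>.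
  Unbounded sets are exhausted by balls, and countable subadditivity reduces to the finite one, which
  follows from \<open>max u v\<close>.
\<close>

section \<open>Powers, path integrals and arc length curves\<close>

text \<open>Bounded energies need not bound the norms of the competitors in L^p when
  \<open>\<Omega>\<close> is unbounded, so no limit of the functions can be expected in the
  Newtonian norm. Domination of all gradients by one function takes its place: it passes directly to
  infinite suprema. It also shapes the gluing, since two increments bounded by the same quantity can
  be combined convexly without loss. The other obstacle is that the capacity is written with a
  minimal weak upper gradient, which is a mere choice until a minimizer is known to exist. Existence
  comes from two closure properties, under minima and under decreasing limits. Both are proved curve
  by curve, and for that the inequality must be available on all subarcs of almost every curve, with
  Borel gradients. Sums in L^p are estimated with a free parameter \<open>\<theta>\<close>. One of
  the two resulting factors blows up as \<open>\<theta>\<close> tends to 0, so the error that it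
  multiplies has to be removed first.\<close>

lemma epow_ennreal: "0 \<le> x \<Longrightarrow> epow (ennreal x) p = ennreal (x powr p)"
  by (simp add: epow_def)

lemma epow_0 [simp]: "epow 0 p = 0"
  by (simp add: epow_def)

lemma epow_1 [simp]: "epow 1 p = 1"
  by (simp add: epow_def)

lemma epow_eq_infinity_iff [simp]: "epow x p = \<infinity> \<longleftrightarrow> x = \<infinity>"
  by (simp add: epow_def)

lemma epow_mono: "x \<le> y \<Longrightarrow> 0 < p \<Longrightarrow> epow x p \<le> epow y p"
  by (cases x; cases y) (auto simp: epow_def top_unique intro!: ennreal_leI powr_mono2)

lemma epow_epow: "epow (epow x p) q = epow x (p * q)"
  by (cases x) (auto simp: epow_def powr_powr)

lemma epow_inverse [simp]: "0 < p \<Longrightarrow> epow (epow x p) (1 / p) = x" "0 < p \<Longrightarrow> epow (epow x (1 / p)) p = x"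
  by (cases x; simp add: epow_epow; simp add: epow_def)+

lemma epow_le_iff: "0 < p \<Longrightarrow> epow x p \<le> y \<longleftrightarrow> x \<le> epow y (1 / p)"
  by (metis epow_inverse epow_mono zero_less_divide_1_iff)

lemma epow_mult: "0 < p \<Longrightarrow> epow (x * y) p = epow x p * epow y p"
  by (cases x; cases y)
     (auto simp: epow_def ennreal_mult_eq_top_iff powr_mult ennreal_mult[symmetric] ennreal_top_mult ennreal_mult_top
       simp flip: ennreal_mult)

lemma measurable_epow [measurable (raw)]:
  assumes [measurable]: "f \<in> borel_measurable N"
  shows "(\<lambda>x. epow (f x) p) \<in> borel_measurable N"
  unfolding epow_def by measurable

lemma epow_cSUP_le:
  assumes "0 < p" "\<And>i. i \<in> I \<Longrightarrow> epow (f i) p \<le> y"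
  shows "epow (SUP i\<in>I. f i) p \<le> y"
  using assms by (simp add: epow_le_iff SUP_least)

text \<open>A substitute for Minkowski's inequality: split according to whether \<open>y \<le> \<theta> x\<close>.\<close>

lemma epow_add_le:
  assumes "0 < \<theta>" "0 < p"
  shows "epow (x + y) p \<le> ennreal ((1 + \<theta>) powr p) * epow x p + ennreal ((1 + 1 / \<theta>) powr p) * epow y p"
proof (cases "y \<le> ennreal \<theta> * x")
  case True
  have "x + y \<le> x + ennreal \<theta> * x"
    using True by (intro add_left_mono)
  also have "\<dots> = ennreal (1 + \<theta>) * x"
    using assms by (simp add: distrib_right)
  finally have "epow (x + y) p \<le> epow (ennreal (1 + \<theta>) * x) p"
    using assms by (intro epow_mono)
  also have "\<dots> = ennreal ((1 + \<theta>) powr p) * epow x p"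
    using assms by (simp add: epow_mult epow_ennreal del: ennreal_plus)
  finally show ?thesis
    by (simp add: add_increasing2)
next
  case False
  have "x \<le> ennreal (1 / \<theta>) * y"
  proof -
    have "ennreal (1 / \<theta>) * (ennreal \<theta> * x) = x"
      using assms by (simp add: mult.assoc[symmetric] ennreal_mult[symmetric])
    moreover have "ennreal (1 / \<theta>) * (ennreal \<theta> * x) \<le> ennreal (1 / \<theta>) * y"
      using False by (intro mult_left_mono) auto
    ultimately show ?thesis by simp
  qed
  then have "x + y \<le> ennreal (1 / \<theta>) * y + y"
    by (intro add_right_mono)
  also have "\<dots> = ennreal (1 + 1 / \<theta>) * y"
    using assms by (simp add: distrib_right add.commute)
  finally have "epow (x + y) p \<le> epow (ennreal (1 + 1 / \<theta>) * y) p"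
    using assms by (intro epow_mono)
  also have "\<dots> = ennreal ((1 + 1 / \<theta>) powr p) * epow y p"
    using assms by (simp add: epow_mult epow_ennreal del: ennreal_plus)
  finally show ?thesis
    by (simp add: add_increasing)
qed

lemma epow_max: "0 < p \<Longrightarrow> epow (max x y) p \<le> epow x p + epow y p"
  by (auto simp: max_def)

text \<open>Integrals over arbitrary parameter intervals make additivity and subarc estimates
  available without reparametrization. Lebesgue-Borel measure is enough since the densities will be
  Borel.\<close>

definition path_int :: "('a \<Rightarrow> ennreal) \<Rightarrow> (real \<Rightarrow> 'a) \<Rightarrow> real \<Rightarrow> real \<Rightarrow> ennreal" where
  "path_int g \<gamma> s t = (\<integral>\<^sup>+ \<tau>\<in>{s..t}. g (\<gamma> \<tau>) \<partial>lborel)"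

text \<open>No measurability of \<open>\<rho>\<close> is required: completing the measure does not
  change the \<open>nn_integral\<close> of any function.\<close>

lemma curve_integral_eq: "curve_integral \<rho> \<gamma> l = path_int \<rho> \<gamma> 0 l"
  by (simp add: curve_integral_def path_int_def nn_integral_completion)

text \<open>The curve is known to be continuous on \<open>{0..l}\<close> only and is arbitrary
  elsewhere, so measurability on the line is claimed for the truncated integrand.\<close>

lemma arc_curve_measurable:
  assumes "arc_curve A \<gamma> l" "g \<in> borel_measurable borel" "0 \<le> s" "t \<le> l"
  shows "(\<lambda>\<tau>. (g (\<gamma> \<tau>) :: ennreal) * indicator {s..t} \<tau>) \<in> borel_measurable borel"
proof -
  have "continuous_on {s..t} \<gamma>"
    using assms unfolding arc_curve_def by (auto intro: continuous_on_subset)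
  then have "\<gamma> \<in> borel_measurable (restrict_space borel {s..t})"
    by (rule borel_measurable_continuous_on_restrict)
  then have "(\<lambda>\<tau>. g (\<gamma> \<tau>)) \<in> borel_measurable (restrict_space borel {s..t})"
    using assms(2) by measurable
  then show ?thesis
    by (subst (asm) borel_measurable_restrict_space_iff_ennreal) auto
qed

lemma path_int_mono:
  assumes "\<And>\<tau>. s \<le> \<tau> \<Longrightarrow> \<tau> \<le> t \<Longrightarrow> f (\<gamma> \<tau>) \<le> g (\<gamma> \<tau>)"
  shows "path_int f \<gamma> s t \<le> path_int g \<gamma> s t"
  unfolding path_int_def
proof (rule nn_integral_mono)
  show "f (\<gamma> \<tau>) * indicator {s..t} \<tau> \<le> g (\<gamma> \<tau>) * indicator {s..t} \<tau>" for \<tau>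
    using assms[of \<tau>] by (cases "\<tau> \<in> {s..t}") simp_all
qed

lemma path_int_subset:
  assumes "s' \<le> s" "t \<le> t'"
  shows "path_int f \<gamma> s t \<le> path_int f \<gamma> s' t'"
  unfolding path_int_def
proof (rule nn_integral_mono)
  show "f (\<gamma> \<tau>) * indicator {s..t} \<tau> \<le> f (\<gamma> \<tau>) * indicator {s'..t'} \<tau>" for \<tau>
    using assms by (intro mult_left_mono) (auto simp: indicator_def)
qed

lemma path_int_add:
  assumes "arc_curve A \<gamma> l" "g \<in> borel_measurable borel" "0 \<le> s" "s \<le> t" "t \<le> u" "u \<le> l"
  shows "path_int g \<gamma> s u = path_int g \<gamma> s t + path_int g \<gamma> t u"
proof -
  have "path_int g \<gamma> s u = (\<integral>\<^sup>+ \<tau>. g (\<gamma> \<tau>) * indicator {s..t} \<tau> + g (\<gamma> \<tau>) * indicator {t..u} \<tau> \<partial>lborel)"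
    unfolding path_int_def
  proof (rule nn_integral_cong_AE)
    have "AE \<tau> in lborel. \<tau> \<noteq> t"
      using AE_lborel_singleton by auto
    then show "AE \<tau> in lborel. g (\<gamma> \<tau>) * indicator {s..u} \<tau>
        = g (\<gamma> \<tau>) * indicator {s..t} \<tau> + g (\<gamma> \<tau>) * indicator {t..u} \<tau>"
      by eventually_elim (use assms in \<open>auto simp: indicator_def\<close>)
  qed
  also have "\<dots> = path_int g \<gamma> s t + path_int g \<gamma> t u"
    unfolding path_int_def using assms arc_curve_measurable[OF assms(1,2)]
    by (intro nn_integral_add) auto
  finally show ?thesis .
qed

lemma path_int_plus:
  assumes "arc_curve A \<gamma> l" "f \<in> borel_measurable borel" "g \<in> borel_measurable borel" "0 \<le> s" "t \<le> l"
  shows "path_int (\<lambda>x. f x + g x) \<gamma> s t = path_int f \<gamma> s t + path_int g \<gamma> s t"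
  unfolding path_int_def using assms arc_curve_measurable[OF assms(1)]
  by (simp add: distrib_right nn_integral_add)

lemma path_int_cmult:
  assumes "arc_curve A \<gamma> l" "f \<in> borel_measurable borel" "0 \<le> s" "t \<le> l"
  shows "path_int (\<lambda>x. c * f x) \<gamma> s t = c * path_int f \<gamma> s t"
  unfolding path_int_def using assms arc_curve_measurable[OF assms(1)]
  by (simp add: mult.assoc nn_integral_cmult)

section \<open>Subarcs, reparametrized by translation\<close>

lemma path_int_shift:
  assumes "arc_curve A \<gamma> l" "g \<in> borel_measurable borel" "0 \<le> a" "0 \<le> s" "a + t \<le> l"
  shows "path_int g (\<lambda>\<tau>. \<gamma> (a + \<tau>)) s t = path_int g \<gamma> (a + s) (a + t)"
proof -
  have "path_int g \<gamma> (a + s) (a + t)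
      = ennreal \<bar>1\<bar> * (\<integral>\<^sup>+ \<tau>. g (\<gamma> (a + 1 * \<tau>)) * indicator {a + s..a + t} (a + 1 * \<tau>) \<partial>lborel)"
    unfolding path_int_def using assms arc_curve_measurable[OF assms(1,2)]
    by (intro nn_integral_real_affine) auto
  also have "\<dots> = path_int g (\<lambda>\<tau>. \<gamma> (a + \<tau>)) s t"
    unfolding path_int_def by (auto intro!: nn_integral_cong simp: indicator_def)
  finally show ?thesis by simp
qed

lemma curve_length_shift:
  "curve_length (\<lambda>\<tau>. \<gamma> (a + \<tau>)) s t = curve_length \<gamma> (a + s) (a + t)"
proof -
  have le: "curve_length (\<lambda>\<tau>. \<gamma> (a + \<tau>)) s t \<le> curve_length \<gamma> (a + s) (a + t)" for \<gamma> a s t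
    unfolding curve_length_def
  proof (rule SUP_least, clarify)
    fix n :: nat and T :: "nat \<Rightarrow> real"
    assume T: "mono T" "range T \<subseteq> {s..t}"
    then have "(n, \<lambda>i. a + T i) \<in> {(n, T). mono T \<and> range T \<subseteq> {a + s..a + t}}"
      by (auto simp: mono_def)
    then show "ennreal (\<Sum>i<n. dist (\<gamma> (a + T i)) (\<gamma> (a + T (Suc i))))
        \<le> (SUP (n, t)\<in>{(n, T). mono T \<and> range T \<subseteq> {a + s..a + t}}.
              ennreal (\<Sum>i<n. dist (\<gamma> (t i)) (\<gamma> (t (Suc i)))))"
      by (rule SUP_upper2) simp
  qed
  \<comment> \<open>The reverse inequality is the same one for the shifted curve, shifted back by
    \<open>- a\<close>.\<close>
  show ?thesis
    using le[of \<gamma> a s t] le[of "\<lambda>\<tau>. \<gamma> (a + \<tau>)" "- a" "a + s" "a + t"] by (intro antisym) simp_all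
qed

lemma arc_curve_shift:
  assumes \<gamma>: "arc_curve A \<gamma> l" and ab: "0 \<le> a" "a < b" "b \<le> l"
  shows "arc_curve A (\<lambda>\<tau>. \<gamma> (a + \<tau>)) (b - a)"
  unfolding arc_curve_def
proof (intro conjI allI impI)
  have cont: "continuous_on {0..l} \<gamma>" and img: "\<gamma> ` {0..l} \<subseteq> A"
    using \<gamma> by (simp_all add: arc_curve_def)
  show "0 < b - a"
    using ab by simp
  show "continuous_on {0..b - a} (\<lambda>\<tau>. \<gamma> (a + \<tau>))"
    using ab by (intro continuous_on_compose2[OF cont] continuous_intros) auto
  show "(\<lambda>\<tau>. \<gamma> (a + \<tau>)) ` {0..b - a} \<subseteq> A"
  proof
    fix x assume "x \<in> (\<lambda>\<tau>. \<gamma> (a + \<tau>)) ` {0..b - a}"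
    then obtain \<tau> where "x = \<gamma> (a + \<tau>)" "0 \<le> \<tau>" "\<tau> \<le> b - a"
      by auto
    then show "x \<in> A"
      using ab img by (intro subsetD[OF img] image_eqI[of _ _ "a + \<tau>"]) auto
  qed
  show "curve_length (\<lambda>\<tau>. \<gamma> (a + \<tau>)) s t = ennreal (t - s)" if "0 \<le> s \<and> s \<le> t \<and> t \<le> b - a" for s t
  proof -
    have "curve_length \<gamma> (a + s) (a + t) = ennreal ((a + t) - (a + s))"
      using \<gamma> ab that unfolding arc_curve_def by (simp del: diff_add_cancel)
    then show ?thesis by (simp add: curve_length_shift)
  qed
qed

lemma arc_curve_dist_le:
  assumes "arc_curve A \<gamma> l" "0 \<le> s" "s \<le> t" "t \<le> l"
  shows "dist (\<gamma> s) (\<gamma> t) \<le> t - s"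
proof -
  \<comment> \<open>Partitions are encoded as infinite monotone sequences of which only
    \<open>n\<close> steps are counted; here the single step from \<open>s\<close> to
    \<open>t\<close> is counted and the sequence then stays at \<open>t\<close>.\<close>
  let ?T = "\<lambda>i::nat. if i = 0 then s else t"
  have "(1::nat, ?T) \<in> {(n, T). mono T \<and> range T \<subseteq> {s..t}}"
    using assms by (auto simp: mono_def)
  then have "ennreal (dist (\<gamma> s) (\<gamma> t)) \<le> curve_length \<gamma> s t"
    unfolding curve_length_def by (intro SUP_upper2[of "(1::nat, ?T)"]) auto
  also have "\<dots> = ennreal (t - s)"
    using assms unfolding arc_curve_def by auto
  finally show ?thesis
    using assms by simp
qed

section \<open>Almost every curve\<close>

locale metric_measure =
  fixes M :: "'a::metric_space measure" and p :: real
  assumes mms: "metric_measure_space M" and p_gt_1: "1 < p"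
begin

lemma p_pos [simp]: "0 < p"
  using p_gt_1 by simp

abbreviation energy :: "('a \<Rightarrow> ennreal) \<Rightarrow> ennreal" where
  "energy g \<equiv> (\<integral>\<^sup>+ x. epow (g x) p \<partial>M)"

abbreviation ae_path :: "((real \<Rightarrow> 'a) \<Rightarrow> real \<Rightarrow> bool) \<Rightarrow> bool" where
  "ae_path \<equiv> ae_curve M p UNIV"

section \<open>Borel representatives for the complete measure\<close>

lemma borel_sets_M: "A \<in> sets borel \<Longrightarrow> A \<in> sets M"
  using mms unfolding metric_measure_space_def complete_borel_measure_def by auto

lemma space_M [simp]: "space M = UNIV"
  using mms unfolding metric_measure_space_def complete_borel_measure_def
  by (auto dest: sets_eq_imp_space_eq)

lemma restrict_UNIV [simp]: "restrict_space M UNIV = M"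
proof -
  have U: "UNIV \<in> sets M"
    by (rule borel_sets_M) simp
  show ?thesis
  proof (rule measure_eqI)
    show sets: "sets (restrict_space M UNIV) = sets M"
      by (auto simp: sets_restrict_space)
    show "emeasure (restrict_space M UNIV) A = emeasure M A" if "A \<in> sets (restrict_space M UNIV)" for A
      by (rule emeasure_restrict_space) (use U in simp_all)
  qed
qed

lemma borel_measurable_M:
  assumes "f \<in> borel_measurable borel"
  shows "f \<in> borel_measurable M"
proof (rule measurableI)
  show "f -` A \<inter> space M \<in> sets M" if "A \<in> sets borel" for A
    using borel_sets_M[OF measurable_sets[OF assms that]] by simp
qed simp

lemma null_set_borel_cover:
  assumes "AE x in M. P x"
  shows "\<exists>Z. Z \<in> sets borel \<and> Z \<in> null_sets M \<and> (\<forall>x. x \<notin> Z \<longrightarrow> P x)"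
proof -
  obtain N where N: "sets N = sets borel" "M = completion N"
    using mms unfolding metric_measure_space_def complete_borel_measure_def by auto
  have "AE x in N. P x"
    using assms unfolding N(2) AE_completion_iff .
  then obtain Z where "{x \<in> space N. \<not> P x} \<subseteq> Z" "Z \<in> null_sets N"
    by (auto simp: eventually_ae_filter)
  moreover have "space N = UNIV"
    using N by (auto dest: sets_eq_imp_space_eq)
  moreover have "Z \<in> sets borel" "Z \<in> null_sets M"
    using \<open>Z \<in> null_sets N\<close> null_sets_completionI[of Z N] N by (auto simp: null_sets_def)
  ultimately show ?thesis
    by blast
qed

text \<open>The value \<open>\<infinity>\<close> on the exceptional Borel null set gives a majorant
  everywhere. Equality almost everywhere would not do: a curve may lie in the null set, and
  integrals along it must not drop.\<close>

lemma borel_version: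
  fixes g :: "'a \<Rightarrow> ennreal"
  assumes "g \<in> borel_measurable M"
  obtains g0 where "g0 \<in> borel_measurable borel" "AE x in M. g0 x = g x" "\<And>x. g x \<le> g0 x"
proof -
  obtain N where N: "sets N = sets borel" "M = completion N"
    using mms unfolding metric_measure_space_def complete_borel_measure_def by auto
  obtain g1 where g1: "g1 \<in> borel_measurable N" "AE x in N. g x = g1 x"
    using completion_ex_borel_measurable[OF assms[unfolded N(2)]] by blast
  have "AE x in M. g x = g1 x"
    using AE_completion[OF g1(2)] unfolding N(2)[symmetric] .
  from null_set_borel_cover[OF this]
  obtain Z where Z: "Z \<in> sets borel" "Z \<in> null_sets M" "\<forall>x. x \<notin> Z \<longrightarrow> g x = g1 x"
    by blast
  have [measurable]: "g1 \<in> borel_measurable borel"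
    using g1(1) unfolding measurable_cong_sets[OF N(1) refl] .
  have [measurable]: "Z \<in> sets borel" by fact
  show ?thesis
  proof (rule that[of "\<lambda>x. if x \<in> Z then \<infinity> else g1 x"])
    show "AE x in M. (if x \<in> Z then \<infinity> else g1 x) = g x"
      using AE_not_in[OF Z(2)] by eventually_elim (use Z(3) in simp)
    show "g x \<le> (if x \<in> Z then \<infinity> else g1 x)" for x
      using Z(3) by simp
  qed measurable
qed

text \<open>Replacing the witness by a Borel majorant keeps its energy and can only enlarge its
  integrals, so the exceptional curves remain detected.\<close>

lemma ae_pathE:
  assumes "ae_path P"
  obtains \<rho> where "\<rho> \<in> borel_measurable borel" "energy \<rho> < \<infinity>"
    "\<And>\<gamma> l. arc_curve UNIV \<gamma> l \<Longrightarrow> path_int \<rho> \<gamma> 0 l < \<infinity> \<Longrightarrow> P \<gamma> l"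
proof -
  obtain \<rho> where \<rho>: "\<rho> \<in> borel_measurable M" "energy \<rho> < \<infinity>"
    and P: "\<And>\<gamma> l. arc_curve UNIV \<gamma> l \<Longrightarrow> \<not> P \<gamma> l \<Longrightarrow> path_int \<rho> \<gamma> 0 l = \<infinity>"
    using assms unfolding ae_curve_def Lp_fun_def by (auto simp: curve_integral_eq)
  obtain \<rho>0 where \<rho>0: "\<rho>0 \<in> borel_measurable borel" "AE x in M. \<rho>0 x = \<rho> x" "\<And>x. \<rho> x \<le> \<rho>0 x"
    using borel_version[OF \<rho>(1)] by blast
  have "energy \<rho>0 = energy \<rho>"
    using \<rho>0(2) by (intro nn_integral_cong_AE) auto
  moreover have "P \<gamma> l" if "arc_curve UNIV \<gamma> l" "path_int \<rho>0 \<gamma> 0 l < \<infinity>" for \<gamma> l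
  proof (rule ccontr)
    assume "\<not> P \<gamma> l"
    then have "\<infinity> = path_int \<rho> \<gamma> 0 l"
      using P that by simp
    also have "\<dots> \<le> path_int \<rho>0 \<gamma> 0 l"
      using \<rho>0 by (intro path_int_mono)
    finally show False using that by simp
  qed
  ultimately show ?thesis
    using \<rho> \<rho>0 by (intro that[of \<rho>0]) auto
qed

lemma ae_pathI:
  assumes "\<rho> \<in> borel_measurable borel" "energy \<rho> < \<infinity>"
    "\<And>\<gamma> l. arc_curve UNIV \<gamma> l \<Longrightarrow> path_int \<rho> \<gamma> 0 l < \<infinity> \<Longrightarrow> P \<gamma> l"
  shows "ae_path P"
  unfolding ae_curve_def Lp_fun_def
  using assms borel_measurable_M by (intro exI[of _ \<rho>]) (auto simp: curve_integral_eq less_top[symmetric])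

lemma ae_path_mono:
  assumes "ae_path P" "\<And>\<gamma> l. arc_curve UNIV \<gamma> l \<Longrightarrow> P \<gamma> l \<Longrightarrow> Q \<gamma> l"
  shows "ae_path Q"
  using assms unfolding ae_curve_def by blast

lemma ae_path_True: "(\<And>\<gamma> l. arc_curve UNIV \<gamma> l \<Longrightarrow> P \<gamma> l) \<Longrightarrow> ae_path P"
  by (rule ae_pathI[of "\<lambda>_. 0"]) auto

text \<open>This is countable subadditivity of the modulus of curve families: scaled witnesses with
  summable energies are merged into one.\<close>

lemma ae_path_all:
  assumes "\<And>i::nat. ae_path (P i)"
  shows "ae_path (\<lambda>\<gamma> l. \<forall>i. P i \<gamma> l)"
proof -
  have "\<exists>\<rho>. \<rho> \<in> borel_measurable borel \<and> energy \<rho> < \<infinity> \<and>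
      (\<forall>\<gamma> l. arc_curve UNIV \<gamma> l \<longrightarrow> path_int \<rho> \<gamma> 0 l < \<infinity> \<longrightarrow> P i \<gamma> l)" for i
    by (rule ae_pathE[OF assms[of i]]) blast
  then obtain \<rho> where \<rho>: "\<And>i. \<rho> i \<in> borel_measurable borel" "\<And>i. energy (\<rho> i) < \<infinity>"
    "\<And>i \<gamma> l. arc_curve UNIV \<gamma> l \<Longrightarrow> path_int (\<rho> i) \<gamma> 0 l < \<infinity> \<Longrightarrow> P i \<gamma> l"
    by metis
  note [measurable] = \<rho>(1) \<rho>(1)[THEN borel_measurable_M]
  \<comment> \<open>\<open>K i\<close> exceeds the energy of \<open>\<rho> i\<close> and is never 0,
    so the weight \<open>c i\<close> is well defined and brings the energy of
    \<open>c i * \<rho> i\<close> down to at most \<open>(1/2)^i\<close>.\<close>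
  define K where "K i = 1 + enn2real (energy (\<rho> i))" for i
  define c where "c i = ((1/2)^i / K i) powr (1 / p)" for i
  have K: "K i \<ge> 1" for i
    by (simp add: K_def)
  have c: "c i > 0" for i
    using K[of i] by (simp add: c_def)
  have cp: "c i powr p = (1/2)^i / K i" for i
    using K[of i] p_gt_1 by (auto simp: c_def powr_powr)
  have le: "energy (\<lambda>x. ennreal (c i) * \<rho> i x) \<le> ennreal ((1/2)^i)" for i
  proof -
    have "energy (\<rho> i) = ennreal (K i - 1)"
      using \<rho>(2)[of i] by (simp add: K_def)
    moreover have "(1/2)^i / K i * (K i - 1) \<le> (1/2)^i"
      using K[of i] by (simp add: field_simps)
    ultimately show ?thesis
      using c[of i] K[of i]
      by (simp add: epow_mult epow_ennreal nn_integral_cmult cp ennreal_mult[symmetric] del: power_divide)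
  qed
  show ?thesis
  \<comment> \<open>A supremum instead of a sum avoids the triangle inequality in L^p: its p-th
    power is below the sum of the p-th powers, and it still dominates a positive multiple of each
    \<open>\<rho> i\<close>.\<close>
  proof (rule ae_pathI[of "\<lambda>x. SUP i. ennreal (c i) * \<rho> i x"])
    have "energy (\<lambda>x. SUP i. ennreal (c i) * \<rho> i x) \<le> (\<integral>\<^sup>+ x. (\<Sum>i. epow (ennreal (c i) * \<rho> i x) p) \<partial>M)"
    proof (intro nn_integral_mono epow_cSUP_le)
      show "epow (ennreal (c i) * \<rho> i x) p \<le> (\<Sum>i. epow (ennreal (c i) * \<rho> i x) p)" for i x
        using sum_le_suminf[of "\<lambda>i. epow (ennreal (c i) * \<rho> i x) p" "{i}"] by simp
    qed simp
    also have "\<dots> = (\<Sum>i. energy (\<lambda>x. ennreal (c i) * \<rho> i x))"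
      by (intro nn_integral_suminf) measurable
    also have "\<dots> \<le> (\<Sum>i. ennreal ((1/2)^i))"
      by (intro suminf_le le) auto
    also have "\<dots> = ennreal 2"
      by (subst suminf_ennreal2) (auto simp: suminf_geometric summable_geometric)
    finally show "energy (\<lambda>x. SUP i. ennreal (c i) * \<rho> i x) < \<infinity>"
      by (simp add: le_less_trans)
    show "\<forall>i. P i \<gamma> l" if \<gamma>: "arc_curve UNIV \<gamma> l" "path_int (\<lambda>x. SUP i. ennreal (c i) * \<rho> i x) \<gamma> 0 l < \<infinity>" for \<gamma> l
    proof
      fix i
      have "ennreal (c i) * path_int (\<rho> i) \<gamma> 0 l = path_int (\<lambda>x. ennreal (c i) * \<rho> i x) \<gamma> 0 l"
        using \<gamma>(1) \<rho>(1) by (subst path_int_cmult) auto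
      also have "\<dots> \<le> path_int (\<lambda>x. SUP i. ennreal (c i) * \<rho> i x) \<gamma> 0 l"
        by (intro path_int_mono SUP_upper) auto
      also have "\<dots> < \<infinity>" by fact
      finally have "path_int (\<rho> i) \<gamma> 0 l < \<infinity>"
        using c[of i] by (auto simp: ennreal_mult_less_top)
      then show "P i \<gamma> l"
        using \<rho>(3) \<gamma>(1) by auto
    qed
  qed measurable
qed

lemma ae_path_conj:
  assumes "ae_path P" "ae_path Q"
  shows "ae_path (\<lambda>\<gamma> l. P \<gamma> l \<and> Q \<gamma> l)"
proof -
  have "ae_path (\<lambda>\<gamma> l. \<forall>i::nat. (if i = 0 then P else Q) \<gamma> l)"
    by (rule ae_path_all) (use assms in auto)
  then show ?thesis
  proof (rule ae_path_mono)
    fix \<gamma> l assume *: "\<forall>i::nat. (if i = 0 then P else Q) \<gamma> l"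
    show "P \<gamma> l \<and> Q \<gamma> l"
      using *[rule_format, of 0] *[rule_format, of 1] by simp
  qed
qed

lemma ae_path_finite:
  assumes "g \<in> borel_measurable borel" "energy g < \<infinity>"
  shows "ae_path (\<lambda>\<gamma> l. path_int g \<gamma> 0 l < \<infinity>)"
  using assms by (intro ae_pathI[of g]) auto

text \<open>The function equal to \<open>\<infinity>\<close> on \<open>Z\<close> and 0 elsewhere has
  energy 0, while its integral along a curve is finite only if the curve spends no time in
  \<open>Z\<close>.\<close>

lemma ae_path_avoids_null:
  assumes "Z \<in> sets borel" "Z \<in> null_sets M"
  shows "ae_path (\<lambda>\<gamma> l. AE \<tau> in lborel. \<tau> \<in> {0..l} \<longrightarrow> \<gamma> \<tau> \<notin> Z)"
proof -
  have [measurable]: "Z \<in> sets borel" by fact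
  have "energy (\<lambda>x. \<infinity> * indicator Z x) = (\<integral>\<^sup>+ x. 0 \<partial>M)"
    using AE_not_in[OF assms(2)] by (intro nn_integral_cong_AE) auto
  then have "ae_path (\<lambda>\<gamma> l. path_int (\<lambda>x. \<infinity> * indicator Z x) \<gamma> 0 l < \<infinity>)"
    by (intro ae_path_finite) auto
  then show ?thesis
  proof (rule ae_path_mono)
    fix \<gamma> l assume \<gamma>: "arc_curve UNIV \<gamma> l" and fin: "path_int (\<lambda>x. \<infinity> * indicator Z x) \<gamma> 0 l < \<infinity>"
    have "(\<lambda>\<tau>. \<infinity> * indicator Z (\<gamma> \<tau>) * indicator {0..l} \<tau> :: ennreal) \<in> borel_measurable lborel"
      using arc_curve_measurable[OF \<gamma>, of "\<lambda>x. \<infinity> * indicator Z x" 0 l] by simp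
    then have "AE \<tau> in lborel. \<infinity> * indicator Z (\<gamma> \<tau>) * indicator {0..l} \<tau> \<noteq> (\<infinity>::ennreal)"
      using fin unfolding path_int_def by (intro nn_integral_noteq_infinite) auto
    then show "AE \<tau> in lborel. \<tau> \<in> {0..l} \<longrightarrow> \<gamma> \<tau> \<notin> Z"
      by eventually_elim (auto simp: indicator_def)
  qed
qed

text \<open>One witness serves the uncountably many subarcs at once, as its integral over a subarc
  is at most that over the whole curve.\<close>

lemma ae_path_subcurves:
  assumes "ae_path P"
  shows "ae_path (\<lambda>\<gamma> l. \<forall>a b. 0 \<le> a \<and> a < b \<and> b \<le> l \<longrightarrow> P (\<lambda>\<tau>. \<gamma> (a + \<tau>)) (b - a))"
proof -
  obtain \<rho> where \<rho>: "\<rho> \<in> borel_measurable borel" "energy \<rho> < \<infinity>"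
    "\<And>\<gamma> l. arc_curve UNIV \<gamma> l \<Longrightarrow> path_int \<rho> \<gamma> 0 l < \<infinity> \<Longrightarrow> P \<gamma> l"
    using ae_pathE[OF assms] by blast
  show ?thesis
  proof (rule ae_pathI[OF \<rho>(1,2)], intro allI impI)
    fix \<gamma> l a b
    assume \<gamma>: "arc_curve UNIV \<gamma> l" and fin: "path_int \<rho> \<gamma> 0 l < \<infinity>" and ab: "0 \<le> a \<and> a < b \<and> b \<le> l"
    have "path_int \<rho> (\<lambda>\<tau>. \<gamma> (a + \<tau>)) 0 (b - a) = path_int \<rho> \<gamma> a b"
      using ab by (subst path_int_shift[OF \<gamma> \<rho>(1)]) auto
    also have "\<dots> \<le> path_int \<rho> \<gamma> 0 l"
      using ab by (intro path_int_subset) auto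
    also note fin
    finally show "P (\<lambda>\<tau>. \<gamma> (a + \<tau>)) (b - a)"
      using ab \<gamma> by (intro \<rho>(3) arc_curve_shift[of _ _ l]) auto
  qed
qed

end

section \<open>Upper gradients along almost every curve\<close>

lemma path_int_cong_interior:
  assumes "\<And>\<tau>. s < \<tau> \<Longrightarrow> \<tau> < t \<Longrightarrow> f (\<gamma> \<tau>) = g (\<gamma> \<tau>)"
  shows "path_int f \<gamma> s t = path_int g \<gamma> s t"
  unfolding path_int_def
proof (rule nn_integral_cong_AE)
  have "AE \<tau> in lborel. \<tau> \<noteq> s" "AE \<tau> in lborel. \<tau> \<noteq> t"
    using AE_lborel_singleton by auto
  then show "AE \<tau> in lborel. f (\<gamma> \<tau>) * indicator {s..t} \<tau> = g (\<gamma> \<tau>) * indicator {s..t} \<tau>"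
  proof eventually_elim
    fix \<tau> assume "\<tau> \<noteq> s" "\<tau> \<noteq> t"
    then show "f (\<gamma> \<tau>) * indicator {s..t} \<tau> = g (\<gamma> \<tau>) * indicator {s..t} \<tau>"
      using assms[of \<tau>] by (cases "\<tau> \<in> {s..t}") auto
  qed
qed

lemma abs_diff_SUP_le:
  fixes a b :: "'i \<Rightarrow> real"
  assumes "I \<noteq> {}" "bdd_above (a ` I)" "bdd_above (b ` I)" "\<And>i. i \<in> I \<Longrightarrow> \<bar>a i - b i\<bar> \<le> k"
  shows "\<bar>(SUP i\<in>I. a i) - (SUP i\<in>I. b i)\<bar> \<le> k"
proof -
  have "(SUP i\<in>I. a i) \<le> (SUP i\<in>I. b i) + k"
  proof (rule cSUP_least[OF assms(1)])
    fix i assume "i \<in> I"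
    then show "a i \<le> (SUP i\<in>I. b i) + k"
      using assms(4)[of i] cSUP_upper[of i I b] assms(3) by linarith
  qed
  moreover have "(SUP i\<in>I. b i) \<le> (SUP i\<in>I. a i) + k"
  proof (rule cSUP_least[OF assms(1)])
    fix i assume "i \<in> I"
    then show "b i \<le> (SUP i\<in>I. a i) + k"
      using assms(4)[of i] cSUP_upper[of i I a] assms(2) by linarith
  qed
  ultimately show ?thesis by linarith
qed

text \<open>Real values suffice because competitors for the capacity lie between 0 and 1. The
  inequality on all subintervals compares increments of \<open>u\<close> along the curve with an
  additive function of intervals, which can be tested locally.\<close>

definition ug_along :: "('a \<Rightarrow> real) \<Rightarrow> ('a \<Rightarrow> ennreal) \<Rightarrow> (real \<Rightarrow> 'a) \<Rightarrow> real \<Rightarrow> bool" where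
  "ug_along u g \<gamma> l \<longleftrightarrow>
     (\<forall>s t. 0 \<le> s \<and> s \<le> t \<and> t \<le> l \<longrightarrow> ennreal \<bar>u (\<gamma> s) - u (\<gamma> t)\<bar> \<le> path_int g \<gamma> s t)"

lemma ug_alongD:
  "ug_along u g \<gamma> l \<Longrightarrow> 0 \<le> s \<Longrightarrow> s \<le> t \<Longrightarrow> t \<le> l \<Longrightarrow> ennreal \<bar>u (\<gamma> s) - u (\<gamma> t)\<bar> \<le> path_int g \<gamma> s t"
  by (simp add: ug_along_def)

text \<open>The parameters at which the curve is outside the open set form a compact set. At its
  first and last points \<open>a\<close> and \<open>b\<close> the function vanishes, so only the
  pieces before \<open>a\<close> and after \<open>b\<close> contribute to the increment, and the
  interiors of these pieces stay in \<open>\<Omega>\<close>.\<close>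

lemma ug_along_indicator:
  assumes \<gamma>: "arc_curve UNIV \<gamma> l" and "open \<Omega>" "\<And>x. x \<notin> \<Omega> \<Longrightarrow> u x = 0"
    and [measurable]: "g \<in> borel_measurable borel" and ug: "ug_along u g \<gamma> l"
  shows "ug_along u (\<lambda>x. g x * indicator \<Omega> x) \<gamma> l"
  unfolding ug_along_def
proof (intro allI impI, elim conjE)
  fix s t assume st: "0 \<le> s" "s \<le> t" "t \<le> l"
  let ?g = "\<lambda>x. g x * indicator \<Omega> x"
  have [measurable]: "\<Omega> \<in> sets borel"
    using \<open>open \<Omega>\<close> by simp
  have cont: "continuous_on {s..t} \<gamma>"
    using \<gamma> st unfolding arc_curve_def by (auto intro: continuous_on_subset)
  define K where "K = {s..t} \<inter> \<gamma> -` (- \<Omega>)"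
  have "closed K"
    unfolding K_def using \<open>open \<Omega>\<close> by (intro continuous_closed_preimage[OF cont]) auto
  moreover have "bounded K"
    unfolding K_def by (rule bounded_subset[OF bounded_closed_interval]) auto
  ultimately have K: "compact K"
    by (simp add: compact_eq_bounded_closed)
  have g_eq: "?g (\<gamma> \<tau>) = g (\<gamma> \<tau>)" if "\<tau> \<notin> K" "s \<le> \<tau>" "\<tau> \<le> t" for \<tau>
    using that by (simp add: K_def)
  show "ennreal \<bar>u (\<gamma> s) - u (\<gamma> t)\<bar> \<le> path_int ?g \<gamma> s t"
  proof (cases "K = {}")
    case True
    have "path_int ?g \<gamma> s t = path_int g \<gamma> s t"
      using True by (intro path_int_cong_interior g_eq) auto
    then show ?thesis
      using ug_alongD[OF ug st] by simp
  next
    case False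
    obtain a where a: "a \<in> K" "\<And>\<tau>. \<tau> \<in> K \<Longrightarrow> a \<le> \<tau>"
      using compact_attains_inf[OF K False] by blast
    obtain b where b: "b \<in> K" "\<And>\<tau>. \<tau> \<in> K \<Longrightarrow> \<tau> \<le> b"
      using compact_attains_sup[OF K False] by blast
    have ab: "s \<le> a" "a \<le> b" "b \<le> t"
      using a b by (auto simp: K_def)
    have zero: "u (\<gamma> a) = 0" "u (\<gamma> b) = 0"
      using a b assms(3) by (auto simp: K_def)
    have sa: "path_int ?g \<gamma> s a = path_int g \<gamma> s a"
      using a(2) ab by (intro path_int_cong_interior g_eq) force+
    have bt: "path_int ?g \<gamma> b t = path_int g \<gamma> b t"
      using b(2) ab by (intro path_int_cong_interior g_eq) force+
    have "ennreal \<bar>u (\<gamma> s) - u (\<gamma> t)\<bar> \<le> ennreal (\<bar>u (\<gamma> s) - u (\<gamma> a)\<bar> + \<bar>u (\<gamma> b) - u (\<gamma> t)\<bar>)"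
      using zero by (intro ennreal_leI) linarith
    also have "\<dots> \<le> path_int ?g \<gamma> s a + path_int ?g \<gamma> b t"
      using ug_alongD[OF ug, of s a] ug_alongD[OF ug, of b t] ab st sa bt
      by (auto intro: add_mono)
    also have "\<dots> \<le> path_int ?g \<gamma> s a + path_int ?g \<gamma> a t"
      using ab by (intro add_left_mono path_int_subset) auto
    also have "\<dots> = path_int ?g \<gamma> s t"
      using ab st by (intro path_int_add[OF \<gamma>, symmetric]) auto
    finally show ?thesis .
  qed
qed

context metric_measure
begin

text \<open>Compared with \<^const>\<open>weak_upper_gradient\<close>, \<open>g\<close> is Borel on the nose and the inequality is
  required on every subarc; both can be had after modifying \<open>g\<close> on a null set.\<close>

definition wug :: "('a \<Rightarrow> real) \<Rightarrow> ('a \<Rightarrow> ennreal) \<Rightarrow> bool" where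
  "wug u g \<longleftrightarrow> g \<in> borel_measurable borel \<and> ae_path (ug_along u g)"

lemma wug_measurable: "wug u g \<Longrightarrow> g \<in> borel_measurable borel"
  by (simp add: wug_def)

lemma wug_imp_weak_upper_gradient:
  assumes "wug u g"
  shows "weak_upper_gradient M p UNIV (\<lambda>x. ereal (u x)) g"
proof -
  have "ae_path (\<lambda>\<gamma> l. ext_diff (ereal (u (\<gamma> 0))) (ereal (u (\<gamma> l))) \<le> curve_integral g \<gamma> l)"
    using assms unfolding wug_def
  proof (elim conjE ae_path_mono)
    fix \<gamma> l assume "arc_curve UNIV \<gamma> l" "ug_along u g \<gamma> l"
    then show "ext_diff (ereal (u (\<gamma> 0))) (ereal (u (\<gamma> l))) \<le> curve_integral g \<gamma> l"
      using ug_alongD[of u g \<gamma> l 0 l] by (simp add: ext_diff_def curve_integral_eq arc_curve_def)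
  qed
  then show ?thesis
    using borel_measurable_M[OF wug_measurable[OF assms]]
    unfolding weak_upper_gradient_def restrict_UNIV by blast
qed

text \<open>A subarc is again an arc length curve, so on almost every curve the endpoint inequality
  holds for every subarc; passing to a Borel majorant of \<open>g\<close> preserves it.\<close>

lemma weak_upper_gradient_imp_wug:
  assumes "weak_upper_gradient M p UNIV (\<lambda>x. ereal (u x)) g"
  shows "\<exists>g0. wug u g0 \<and> (AE x in M. g0 x = g x)"
proof -
  have g: "g \<in> borel_measurable M"
    and ae: "ae_path (\<lambda>\<gamma> l. ext_diff (ereal (u (\<gamma> 0))) (ereal (u (\<gamma> l))) \<le> curve_integral g \<gamma> l)"
    using assms unfolding weak_upper_gradient_def restrict_UNIV by blast+
  obtain g0 where g0: "g0 \<in> borel_measurable borel" "AE x in M. g0 x = g x" "\<And>x. g x \<le> g0 x"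
    by (rule borel_version[OF g]) blast
  have "ae_path (ug_along u g0)"
  proof (rule ae_path_mono[OF ae_path_subcurves[OF ae]])
    fix \<gamma> l
    assume \<gamma>: "arc_curve UNIV \<gamma> l"
      and *: "\<forall>a b. 0 \<le> a \<and> a < b \<and> b \<le> l \<longrightarrow>
         ext_diff (ereal (u (\<gamma> (a + 0)))) (ereal (u (\<gamma> (a + (b - a)))))
           \<le> curve_integral g (\<lambda>\<tau>. \<gamma> (a + \<tau>)) (b - a)"
    show "ug_along u g0 \<gamma> l"
      unfolding ug_along_def
    proof (intro allI impI, elim conjE)
      fix s t assume st: "0 \<le> s" "s \<le> t" "t \<le> l"
      show "ennreal \<bar>u (\<gamma> s) - u (\<gamma> t)\<bar> \<le> path_int g0 \<gamma> s t"
      proof (cases "s = t")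
        case False
        then have "ennreal \<bar>u (\<gamma> s) - u (\<gamma> t)\<bar> \<le> path_int g (\<lambda>\<tau>. \<gamma> (s + \<tau>)) 0 (t - s)"
          using *[rule_format, of s t] st by (simp add: ext_diff_def curve_integral_eq)
        also have "\<dots> \<le> path_int g0 (\<lambda>\<tau>. \<gamma> (s + \<tau>)) 0 (t - s)"
          by (intro path_int_mono g0)
        also have "\<dots> = path_int g0 \<gamma> s t"
          using st by (subst path_int_shift[OF \<gamma> g0(1)]) auto
        finally show ?thesis .
      qed simp
    qed
  qed
  then show ?thesis
    using g0 by (auto simp: wug_def)
qed

section \<open>Closure properties of upper gradients\<close>

lemma wug_mono:
  assumes "wug u g" "h \<in> borel_measurable borel" "\<And>x. g x \<le> h x"
  shows "wug u h"
  unfolding wug_def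
proof (intro conjI)
  show "ae_path (ug_along u h)"
    using assms(1) unfolding wug_def
  proof (elim conjE ae_path_mono)
    fix \<gamma> l assume "ug_along u g \<gamma> l"
    then show "ug_along u h \<gamma> l"
      unfolding ug_along_def using path_int_mono[of _ _ g \<gamma> h] assms(3) order_trans by blast
  qed
qed fact

text \<open>Almost every curve spends no time in the exceptional null set and so cannot distinguish
  the two functions.\<close>

lemma wug_cong_AE:
  assumes "wug u g" "h \<in> borel_measurable borel" "AE x in M. g x = h x"
  shows "wug u h"
  unfolding wug_def
proof (intro conjI)
  obtain Z where Z: "Z \<in> sets borel" "Z \<in> null_sets M" "\<forall>x. x \<notin> Z \<longrightarrow> g x = h x"
    using null_set_borel_cover[OF assms(3)] by blast
  have "ae_path (ug_along u g)"
    using assms(1) by (simp add: wug_def)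
  from ae_path_conj[OF this ae_path_avoids_null[OF Z(1,2)]]
  show "ae_path (ug_along u h)"
  proof (rule ae_path_mono, elim conjE)
    fix \<gamma> l assume ug: "ug_along u g \<gamma> l" and ae: "AE \<tau> in lborel. \<tau> \<in> {0..l} \<longrightarrow> \<gamma> \<tau> \<notin> Z"
    have "path_int g \<gamma> s t = path_int h \<gamma> s t" if "0 \<le> s" "t \<le> l" for s t
      unfolding path_int_def
    proof (rule nn_integral_cong_AE)
      show "AE \<tau> in lborel. g (\<gamma> \<tau>) * indicator {s..t} \<tau> = h (\<gamma> \<tau>) * indicator {s..t} \<tau>"
        using ae by eventually_elim (use Z(3) that in \<open>auto simp: indicator_def\<close>)
    qed
    then show "ug_along u h \<gamma> l"
      using ug by (simp add: ug_along_def)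
  qed
qed fact

lemma wug_const: "wug (\<lambda>_. c) (\<lambda>_. 0)"
  by (auto simp: wug_def ug_along_def intro: ae_path_True)

text \<open>Each \<open>u i\<close> varies by at most the integral of the common majorant, and a
  bounded supremum varies no more than that. Constant \<open>g\<close> yields infinite suprema with
  one gradient, a two-element \<open>I\<close> the maximum of two functions.\<close>

lemma wug_SUP:
  fixes I :: "nat set"
  assumes "I \<noteq> {}" "\<And>i. i \<in> I \<Longrightarrow> wug (u i) (g i)" "\<And>i x. i \<in> I \<Longrightarrow> u i x \<le> c"
  shows "wug (\<lambda>x. SUP i\<in>I. u i x) (\<lambda>x. SUP i\<in>I. g i x)"
  unfolding wug_def
proof (intro conjI)
  have [measurable]: "i \<in> I \<Longrightarrow> g i \<in> borel_measurable borel" for i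
    using assms by (simp add: wug_def)
  show "(\<lambda>x. SUP i\<in>I. g i x) \<in> borel_measurable borel"
    by measurable
  have bdd: "bdd_above ((\<lambda>i. u i x) ` I)" for x
    using assms(3) by (intro bdd_aboveI[of _ c]) auto
  have "ae_path (\<lambda>\<gamma> l. \<forall>i. i \<in> I \<longrightarrow> ug_along (u i) (g i) \<gamma> l)"
  proof (rule ae_path_all)
    show "ae_path (\<lambda>\<gamma> l. i \<in> I \<longrightarrow> ug_along (u i) (g i) \<gamma> l)" for i
      using assms(2)[of i] by (cases "i \<in> I") (auto simp: wug_def intro: ae_path_True)
  qed
  then show "ae_path (ug_along (\<lambda>x. SUP i\<in>I. u i x) (\<lambda>x. SUP i\<in>I. g i x))"
  proof (rule ae_path_mono)
    fix \<gamma> l assume ug: "\<forall>i. i \<in> I \<longrightarrow> ug_along (u i) (g i) \<gamma> l"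
    show "ug_along (\<lambda>x. SUP i\<in>I. u i x) (\<lambda>x. SUP i\<in>I. g i x) \<gamma> l"
      unfolding ug_along_def
    proof (intro allI impI, elim conjE)
      fix s t assume st: "0 \<le> s" "s \<le> t" "t \<le> l"
      let ?J = "path_int (\<lambda>x. SUP i\<in>I. g i x) \<gamma> s t"
      have le: "ennreal \<bar>u i (\<gamma> s) - u i (\<gamma> t)\<bar> \<le> ?J" if "i \<in> I" for i
        using ug_alongD[OF ug[rule_format, OF that] st]
          path_int_mono[of s t "g i" \<gamma> "\<lambda>x. SUP i\<in>I. g i x"] that
        by (meson SUP_upper order_trans)
      show "ennreal \<bar>(SUP i\<in>I. u i (\<gamma> s)) - (SUP i\<in>I. u i (\<gamma> t))\<bar> \<le> ?J"
      proof (cases "?J")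
        case (real r)
        then have "\<bar>(SUP i\<in>I. u i (\<gamma> s)) - (SUP i\<in>I. u i (\<gamma> t))\<bar> \<le> r"
          using le by (intro abs_diff_SUP_le assms(1) bdd) (simp_all add: real)
        then show ?thesis
          using real by (simp add: ennreal_leI)
      qed simp
    qed
  qed
qed

lemma wug_mean:
  assumes "wug u g" "wug v h"
  shows "wug (\<lambda>x. (u x + v x) / 2) (\<lambda>x. ennreal (1/2) * (g x + h x))"
  unfolding wug_def
proof (intro conjI)
  have [measurable]: "g \<in> borel_measurable borel" "h \<in> borel_measurable borel"
    using assms by (simp_all add: wug_def)
  show "(\<lambda>x. ennreal (1/2) * (g x + h x)) \<in> borel_measurable borel"
    by measurable
  have "ae_path (\<lambda>\<gamma> l. ug_along u g \<gamma> l \<and> ug_along v h \<gamma> l)"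
    using assms by (intro ae_path_conj) (simp_all add: wug_def)
  then show "ae_path (ug_along (\<lambda>x. (u x + v x) / 2) (\<lambda>x. ennreal (1/2) * (g x + h x)))"
  proof (rule ae_path_mono, elim conjE)
    fix \<gamma> l assume \<gamma>: "arc_curve UNIV \<gamma> l" and ug: "ug_along u g \<gamma> l" "ug_along v h \<gamma> l"
    show "ug_along (\<lambda>x. (u x + v x) / 2) (\<lambda>x. ennreal (1/2) * (g x + h x)) \<gamma> l"
      unfolding ug_along_def
    proof (intro allI impI, elim conjE)
      fix s t assume st: "0 \<le> s" "s \<le> t" "t \<le> l"
      have "ennreal \<bar>(u (\<gamma> s) + v (\<gamma> s)) / 2 - (u (\<gamma> t) + v (\<gamma> t)) / 2\<bar>
          \<le> ennreal ((1/2) * (\<bar>u (\<gamma> s) - u (\<gamma> t)\<bar> + \<bar>v (\<gamma> s) - v (\<gamma> t)\<bar>))"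
        by (intro ennreal_leI) (simp add: field_simps abs_if)
      also have "\<dots> = ennreal (1/2) * (ennreal \<bar>u (\<gamma> s) - u (\<gamma> t)\<bar> + ennreal \<bar>v (\<gamma> s) - v (\<gamma> t)\<bar>)"
        by (subst ennreal_mult) auto
      also have "\<dots> \<le> ennreal (1/2) * (path_int g \<gamma> s t + path_int h \<gamma> s t)"
        using st by (intro mult_left_mono add_mono ug_alongD[OF ug(1)] ug_alongD[OF ug(2)]) auto
      also have "\<dots> = path_int (\<lambda>x. ennreal (1/2) * (g x + h x)) \<gamma> s t"
        using st by (subst path_int_cmult[OF \<gamma>]) (auto simp: path_int_plus[OF \<gamma>])
      finally show "ennreal \<bar>(u (\<gamma> s) + v (\<gamma> s)) / 2 - (u (\<gamma> t) + v (\<gamma> t)) / 2\<bar>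
          \<le> path_int (\<lambda>x. ennreal (1/2) * (g x + h x)) \<gamma> s t" .
    qed
  qed
qed

text \<open>Monotone convergence for decreasing sequences needs a finite first integral along the
  curve; the finite energy of \<open>g 0\<close> provides it for almost every curve.\<close>

lemma wug_INF:
  assumes "decseq g" "\<And>n::nat. wug u (g n)" "energy (g 0) < \<infinity>"
  shows "wug u (\<lambda>x. INF n. g n x)"
  unfolding wug_def
proof (intro conjI)
  have [measurable]: "g n \<in> borel_measurable borel" for n
    using assms by (simp add: wug_def)
  show "(\<lambda>x. INF n. g n x) \<in> borel_measurable borel"
    by measurable
  have "ae_path (\<lambda>\<gamma> l. \<forall>n. ug_along u (g n) \<gamma> l)"
    using assms(2) by (intro ae_path_all) (simp add: wug_def)
  from ae_path_conj[OF this ae_path_finite[OF _ assms(3)]]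
  show "ae_path (ug_along u (\<lambda>x. INF n. g n x))"
  proof (rule ae_path_mono, goal_cases)
    case (2 \<gamma> l)
    then have ug: "\<And>n. ug_along u (g n) \<gamma> l" and fin: "path_int (g 0) \<gamma> 0 l < \<infinity>"
      by auto
    show ?case
      unfolding ug_along_def
    proof (intro allI impI, elim conjE)
      fix s t assume st: "0 \<le> s" "s \<le> t" "t \<le> l"
      have "path_int (\<lambda>x. INF n. g n x) \<gamma> s t = (\<integral>\<^sup>+ \<tau>. (INF n. g n (\<gamma> \<tau>) * indicator {s..t} \<tau>) \<partial>lborel)"
        unfolding path_int_def
      proof (rule nn_integral_cong)
        show "(INF n. g n (\<gamma> \<tau>)) * indicator {s..t} \<tau> = (INF n. g n (\<gamma> \<tau>) * indicator {s..t} \<tau>)" for \<tau>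
          by (cases "\<tau> \<in> {s..t}") auto
      qed
      also have "\<dots> = (INF n. path_int (g n) \<gamma> s t)"
        unfolding path_int_def
      proof (rule nn_integral_monotone_convergence_INF_decseq)
        show "decseq (\<lambda>n \<tau>. g n (\<gamma> \<tau>) * indicator {s..t} \<tau>)"
          using assms(1) unfolding monotone_def le_fun_def by (auto intro!: mult_right_mono)
        show "(\<lambda>\<tau>. g n (\<gamma> \<tau>) * indicator {s..t} \<tau>) \<in> borel_measurable lborel" for n
          using arc_curve_measurable[OF 2(1), of "g n" s t] st by simp
        have "path_int (g 0) \<gamma> s t \<le> path_int (g 0) \<gamma> 0 l"
          using st by (intro path_int_subset) auto
        then show "(\<integral>\<^sup>+ \<tau>. g 0 (\<gamma> \<tau>) * indicator {s..t} \<tau> \<partial>lborel) < \<infinity>"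
          using fin unfolding path_int_def by (rule le_less_trans)
      qed
      finally show "ennreal \<bar>u (\<gamma> s) - u (\<gamma> t)\<bar> \<le> path_int (\<lambda>x. INF n. g n x) \<gamma> s t"
        using ug_alongD[OF ug st] by (auto intro: INF_greatest)
    qed
  qed (simp)
qed

text \<open>The capacity integrates over \<open>\<Omega>\<close> while \<open>energy\<close>
  integrates over the whole space; truncation reconciles the two.\<close>

lemma wug_indicator:
  assumes "wug u g" "open \<Omega>" "\<And>x. x \<notin> \<Omega> \<Longrightarrow> u x = 0"
  shows "wug u (\<lambda>x. g x * indicator \<Omega> x)"
  unfolding wug_def
proof (intro conjI)
  have [measurable]: "g \<in> borel_measurable borel" "\<Omega> \<in> sets borel"
    using assms by (simp_all add: wug_def)
  show "(\<lambda>x. g x * indicator \<Omega> x) \<in> borel_measurable borel"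
    by measurable
  have "ae_path (ug_along u g)"
    using assms by (simp add: wug_def)
  then show "ae_path (ug_along u (\<lambda>x. g x * indicator \<Omega> x))"
  proof (rule ae_path_mono)
    show "ug_along u (\<lambda>x. g x * indicator \<Omega> x) \<gamma> l" if "arc_curve UNIV \<gamma> l" "ug_along u g \<gamma> l" for \<gamma> l
      by (rule ug_along_indicator) (use that assms in auto)
  qed
qed

end

section \<open>The lattice property and the cutoff\<close>

lemma nn_integral_Icc_add:
  fixes m :: "real \<Rightarrow> ennreal"
  assumes [measurable]: "m \<in> borel_measurable borel" and "a \<le> b" "b \<le> c"
  shows "(\<integral>\<^sup>+ \<tau>\<in>{a..c}. m \<tau> \<partial>lborel) = (\<integral>\<^sup>+ \<tau>\<in>{a..b}. m \<tau> \<partial>lborel) + (\<integral>\<^sup>+ \<tau>\<in>{b..c}. m \<tau> \<partial>lborel)"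
proof -
  have "(\<integral>\<^sup>+ \<tau>\<in>{a..c}. m \<tau> \<partial>lborel) = (\<integral>\<^sup>+ \<tau>. m \<tau> * indicator {a..b} \<tau> + m \<tau> * indicator {b..c} \<tau> \<partial>lborel)"
  proof (rule nn_integral_cong_AE)
    have "AE \<tau> in lborel. \<tau> \<noteq> b"
      using AE_lborel_singleton by auto
    then show "AE \<tau> in lborel. m \<tau> * indicator {a..c} \<tau> = m \<tau> * indicator {a..b} \<tau> + m \<tau> * indicator {b..c} \<tau>"
      by eventually_elim (use assms in \<open>auto simp: indicator_def\<close>)
  qed
  also have "\<dots> = (\<integral>\<^sup>+ \<tau>\<in>{a..b}. m \<tau> \<partial>lborel) + (\<integral>\<^sup>+ \<tau>\<in>{b..c}. m \<tau> \<partial>lborel)"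
    by (intro nn_integral_add) measurable
  finally show ?thesis .
qed

text \<open>The estimate is stable under joining adjacent intervals and holds on all short intervals
  around each point, so bisection in the form of \<open>Bolzano\<close> extends it to the whole
  interval. The function \<open>f\<close> may be discontinuous.\<close>

lemma variation_le_of_local:
  fixes f :: "real \<Rightarrow> real" and m :: "real \<Rightarrow> ennreal"
  assumes "s \<le> t" and m: "m \<in> borel_measurable borel"
    and local: "\<And>x. s \<le> x \<Longrightarrow> x \<le> t \<Longrightarrow> \<exists>d>0. \<forall>a b. s \<le> a \<and> a \<le> x \<and> x \<le> b \<and> b \<le> t \<and> b - a < d \<longrightarrow>
        ennreal \<bar>f a - f b\<bar> \<le> (\<integral>\<^sup>+ \<tau>\<in>{a..b}. m \<tau> \<partial>lborel)"
  shows "ennreal \<bar>f s - f t\<bar> \<le> (\<integral>\<^sup>+ \<tau>\<in>{s..t}. m \<tau> \<partial>lborel)"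
proof -
  have "s \<le> s \<and> t \<le> t \<longrightarrow> ennreal \<bar>f s - f t\<bar> \<le> (\<integral>\<^sup>+ \<tau>\<in>{s..t}. m \<tau> \<partial>lborel)"
    using \<open>s \<le> t\<close>
  proof (rule Bolzano[of s t "\<lambda>a b. s \<le> a \<and> b \<le> t \<longrightarrow> ennreal \<bar>f a - f b\<bar> \<le> (\<integral>\<^sup>+ \<tau>\<in>{a..b}. m \<tau> \<partial>lborel)"])
    fix a b c
    assume *: "s \<le> a \<and> b \<le> t \<longrightarrow> ennreal \<bar>f a - f b\<bar> \<le> (\<integral>\<^sup>+ \<tau>\<in>{a..b}. m \<tau> \<partial>lborel)"
      "s \<le> b \<and> c \<le> t \<longrightarrow> ennreal \<bar>f b - f c\<bar> \<le> (\<integral>\<^sup>+ \<tau>\<in>{b..c}. m \<tau> \<partial>lborel)"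
      and abc: "a \<le> b" "b \<le> c"
    show "s \<le> a \<and> c \<le> t \<longrightarrow> ennreal \<bar>f a - f c\<bar> \<le> (\<integral>\<^sup>+ \<tau>\<in>{a..c}. m \<tau> \<partial>lborel)"
    proof (intro impI, elim conjE)
      assume "s \<le> a" "c \<le> t"
      have "ennreal \<bar>f a - f c\<bar> \<le> ennreal (\<bar>f a - f b\<bar> + \<bar>f b - f c\<bar>)"
        by (intro ennreal_leI) linarith
      also have "\<dots> \<le> (\<integral>\<^sup>+ \<tau>\<in>{a..b}. m \<tau> \<partial>lborel) + (\<integral>\<^sup>+ \<tau>\<in>{b..c}. m \<tau> \<partial>lborel)"
        using * abc \<open>s \<le> a\<close> \<open>c \<le> t\<close> by (auto intro!: add_mono)
      also have "\<dots> = (\<integral>\<^sup>+ \<tau>\<in>{a..c}. m \<tau> \<partial>lborel)"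
        using nn_integral_Icc_add[OF m abc] by simp
      finally show "ennreal \<bar>f a - f c\<bar> \<le> (\<integral>\<^sup>+ \<tau>\<in>{a..c}. m \<tau> \<partial>lborel)" .
    qed
  next
    fix x assume "s \<le> x" "x \<le> t"
    from local[OF this] show "\<exists>d>0. \<forall>a b. a \<le> x \<and> x \<le> b \<and> b - a < d \<longrightarrow> (s \<le> a \<and> b \<le> t \<longrightarrow>
        ennreal \<bar>f a - f b\<bar> \<le> (\<integral>\<^sup>+ \<tau>\<in>{a..b}. m \<tau> \<partial>lborel))"
      by meson
  qed
  then show ?thesis by simp
qed

text \<open>With density \<open>k\<close> the line carries a finite Borel measure, and such measures
  are inner regular with respect to compact sets.\<close>

lemma nn_integral_inner_regular:
  fixes k :: "real \<Rightarrow> ennreal"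
  assumes [measurable]: "k \<in> borel_measurable borel" "A \<in> sets borel"
    and fin: "(\<integral>\<^sup>+ \<tau>. k \<tau> \<partial>lborel) < \<infinity>" and "0 < e"
  shows "\<exists>C. compact C \<and> C \<subseteq> A \<and> (\<integral>\<^sup>+ \<tau>\<in>A - C. k \<tau> \<partial>lborel) \<le> ennreal e"
proof -
  define \<nu> where "\<nu> = density lborel k"
  have em: "emeasure \<nu> B = (\<integral>\<^sup>+ \<tau>\<in>B. k \<tau> \<partial>lborel)" if "B \<in> sets borel" for B
    unfolding \<nu>_def using that by (intro emeasure_density) auto
  have sets: "sets \<nu> = sets borel"
    by (simp add: \<nu>_def)
  have space: "emeasure \<nu> (space \<nu>) \<noteq> \<infinity>"
    using fin em[of UNIV] by (simp add: \<nu>_def)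
  have reg: "emeasure \<nu> A = (SUP C\<in>{C. C \<subseteq> A \<and> compact C}. emeasure \<nu> C)"
    by (rule inner_regular[OF sets space]) simp
  have finA: "emeasure \<nu> A < \<infinity>"
    using space emeasure_space[of \<nu> A] by (simp add: less_top[symmetric] top_unique)
      (metis top_unique)
  have "{C. C \<subseteq> A \<and> compact C} \<noteq> {}"
    using compact_empty by blast
  then have "\<exists>C\<in>{C. C \<subseteq> A \<and> compact C}. emeasure \<nu> A < emeasure \<nu> C + ennreal e"
    using finA by (intro SUP_approx_ennreal[OF \<open>0 < e\<close> _ reg]) auto
  then obtain C where C: "C \<subseteq> A" "compact C" "emeasure \<nu> A < emeasure \<nu> C + ennreal e"
    by blast
  have [measurable]: "C \<in> sets borel"
    using C(2) by (simp add: borel_compact)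
  have "emeasure \<nu> C + emeasure \<nu> (A - C) = emeasure \<nu> (C \<union> (A - C))"
    by (rule plus_emeasure) (auto simp: sets)
  also have "C \<union> (A - C) = A"
    using C(1) by auto
  finally have "emeasure \<nu> C + emeasure \<nu> (A - C) \<le> emeasure \<nu> C + ennreal e"
    using C(3) by simp
  moreover have "emeasure \<nu> C \<noteq> top"
    using finA emeasure_mono[OF C(1), of \<nu>] by (auto simp: sets top_unique)
  ultimately have "emeasure \<nu> (A - C) \<le> ennreal e"
    by (simp add: ennreal_add_left_cancel_le)
  then show ?thesis
    using C em[of "A - C"] by (intro exI[of _ C]) simp
qed

text \<open>Up to small \<open>g + h\<close>-mass, \<open>{h < g}\<close> and its complement are disjoint compact sets \<open>C\<close> and \<open>D\<close>. Short
  subarcs meeting \<open>C\<close> avoid \<open>D\<close> and are controlled by \<open>h\<close>, all others by \<open>g\<close>; no differentiation along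
  the curve is needed.\<close>

lemma ug_along_min:
  assumes \<gamma>: "arc_curve UNIV \<gamma> l"
    and g: "g \<in> borel_measurable borel" "ug_along u g \<gamma> l" "path_int g \<gamma> 0 l < \<infinity>"
    and h: "h \<in> borel_measurable borel" "ug_along u h \<gamma> l" "path_int h \<gamma> 0 l < \<infinity>"
  shows "ug_along u (\<lambda>x. min (g x) (h x)) \<gamma> l"
  unfolding ug_along_def
proof (intro allI impI, elim conjE)
  fix s t assume st: "0 \<le> s" "s \<le> t" "t \<le> l"
  define G where "G \<tau> = g (\<gamma> \<tau>) * indicator {s..t} \<tau>" for \<tau>
  define H where "H \<tau> = h (\<gamma> \<tau>) * indicator {s..t} \<tau>" for \<tau>
  have [measurable]: "G \<in> borel_measurable borel" "H \<in> borel_measurable borel"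
    unfolding G_def H_def using st by (auto intro!: arc_curve_measurable[OF \<gamma>] g h)
  have G_int: "(\<integral>\<^sup>+ \<tau>\<in>{a..b}. G \<tau> \<partial>lborel) = path_int g \<gamma> a b" if "s \<le> a" "b \<le> t" for a b
    unfolding path_int_def using that by (intro nn_integral_cong) (auto simp: indicator_def G_def)
  have H_int: "(\<integral>\<^sup>+ \<tau>\<in>{a..b}. H \<tau> \<partial>lborel) = path_int h \<gamma> a b" if "s \<le> a" "b \<le> t" for a b
    unfolding path_int_def using that by (intro nn_integral_cong) (auto simp: indicator_def H_def)
  have "path_int g \<gamma> s t < \<infinity>" "path_int h \<gamma> s t < \<infinity>"
    using path_int_subset[of 0 s t l g \<gamma>] path_int_subset[of 0 s t l h \<gamma>] st g(3) h(3)
    by (auto elim: le_less_trans)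
  then have fin: "(\<integral>\<^sup>+ \<tau>. G \<tau> + H \<tau> \<partial>lborel) < \<infinity>"
    by (simp add: nn_integral_add path_int_def G_def[symmetric] H_def[symmetric])
  define A where "A = {\<tau>. H \<tau> < G \<tau>}"
  have [measurable]: "A \<in> sets borel"
    unfolding A_def by measurable
  show "ennreal \<bar>u (\<gamma> s) - u (\<gamma> t)\<bar> \<le> path_int (\<lambda>x. min (g x) (h x)) \<gamma> s t"
  proof (rule ennreal_le_epsilon)
    fix e :: real assume "0 < e"
    then have e: "0 < e / 2" by simp
    obtain C where C: "compact C" "C \<subseteq> A" "(\<integral>\<^sup>+ \<tau>\<in>A - C. G \<tau> + H \<tau> \<partial>lborel) \<le> ennreal (e / 2)"
      using nn_integral_inner_regular[OF _ _ fin e, of A] by auto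
    obtain D where D: "compact D" "D \<subseteq> - A" "(\<integral>\<^sup>+ \<tau>\<in>- A - D. G \<tau> + H \<tau> \<partial>lborel) \<le> ennreal (e / 2)"
      using nn_integral_inner_regular[OF _ _ fin e, of "- A"] by auto
    have [measurable]: "C \<in> sets borel" "D \<in> sets borel"
      using C(1) D(1) by (simp_all add: borel_compact)
    \<comment> \<open>\<open>m\<close> dominates \<open>G\<close> off \<open>C\<close> and
      \<open>H\<close> off \<open>D\<close>, which is what the local estimates use, and on
      \<open>{s..t}\<close> it can exceed the minimum only in the leftover sets \<open>A - C\<close>
      and \<open>- A - D\<close>.\<close>
    define m where "m \<tau> = (if \<tau> \<in> C then H \<tau> else if \<tau> \<in> D then G \<tau> else G \<tau> + H \<tau>)" for \<tau>
    have [measurable]: "m \<in> borel_measurable borel"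
      unfolding m_def by measurable
    have mG: "G \<tau> \<le> m \<tau>" if "\<tau> \<notin> C" for \<tau>
      using that by (simp add: m_def)
    have mH: "H \<tau> \<le> m \<tau>" if "\<tau> \<notin> D" for \<tau>
      using that by (simp add: m_def)
    have near: "\<exists>d>0. \<forall>\<tau>. \<bar>\<tau> - x\<bar> < d \<longrightarrow> \<tau> \<notin> K" if K: "compact K" "x \<notin> K" for K and x :: real
    proof -
      have "open (- K)" "x \<in> - K"
        using K compact_imp_closed by auto
      then have "\<exists>d>0. ball x d \<subseteq> - K"
        by (simp only: open_contains_ball)
      then obtain d where "0 < d" "ball x d \<subseteq> - K"
        by (elim exE conjE)
      moreover have "\<tau> \<in> ball x d" if "\<bar>\<tau> - x\<bar> < d" for \<tau>
        using that by (simp add: dist_real_def abs_minus_commute)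
      ultimately show ?thesis
        by blast
    qed
    have "ennreal \<bar>u (\<gamma> s) - u (\<gamma> t)\<bar> \<le> (\<integral>\<^sup>+ \<tau>\<in>{s..t}. m \<tau> \<partial>lborel)"
    proof (rule variation_le_of_local[of s t m "\<lambda>\<tau>. u (\<gamma> \<tau>)"])
      fix x assume x: "s \<le> x" "x \<le> t"
      show "\<exists>d>0. \<forall>a b. s \<le> a \<and> a \<le> x \<and> x \<le> b \<and> b \<le> t \<and> b - a < d \<longrightarrow>
          ennreal \<bar>u (\<gamma> a) - u (\<gamma> b)\<bar> \<le> (\<integral>\<^sup>+ \<tau>\<in>{a..b}. m \<tau> \<partial>lborel)"
      proof (cases "x \<in> C")
        case True
        then have "x \<notin> D"
          using C(2) D(2) by auto
        then obtain d where d: "0 < d" "\<And>\<tau>. \<bar>\<tau> - x\<bar> < d \<Longrightarrow> \<tau> \<notin> D"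
          using near[OF D(1)] by blast
        have "ennreal \<bar>u (\<gamma> a) - u (\<gamma> b)\<bar> \<le> (\<integral>\<^sup>+ \<tau>\<in>{a..b}. m \<tau> \<partial>lborel)"
          if ab: "s \<le> a \<and> a \<le> x \<and> x \<le> b \<and> b \<le> t \<and> b - a < d" for a b
        proof -
          have "ennreal \<bar>u (\<gamma> a) - u (\<gamma> b)\<bar> \<le> path_int h \<gamma> a b"
            using ab st by (intro ug_alongD[OF h(2)]) auto
          also have "\<dots> = (\<integral>\<^sup>+ \<tau>\<in>{a..b}. H \<tau> \<partial>lborel)"
            using ab by (simp add: H_int)
          also have "\<dots> \<le> (\<integral>\<^sup>+ \<tau>\<in>{a..b}. m \<tau> \<partial>lborel)"
          proof (rule nn_integral_mono)
            show "H \<tau> * indicator {a..b} \<tau> \<le> m \<tau> * indicator {a..b} \<tau>" for \<tau>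
              using mH[OF d(2), of \<tau>] ab by (cases "\<tau> \<in> {a..b}") auto
          qed
          finally show ?thesis .
        qed
        with d(1) show ?thesis by blast
      next
        case False
        then obtain d where d: "0 < d" "\<And>\<tau>. \<bar>\<tau> - x\<bar> < d \<Longrightarrow> \<tau> \<notin> C"
          using near[OF C(1)] by blast
        have "ennreal \<bar>u (\<gamma> a) - u (\<gamma> b)\<bar> \<le> (\<integral>\<^sup>+ \<tau>\<in>{a..b}. m \<tau> \<partial>lborel)"
          if ab: "s \<le> a \<and> a \<le> x \<and> x \<le> b \<and> b \<le> t \<and> b - a < d" for a b
        proof -
          have "ennreal \<bar>u (\<gamma> a) - u (\<gamma> b)\<bar> \<le> path_int g \<gamma> a b"
            using ab st by (intro ug_alongD[OF g(2)]) auto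
          also have "\<dots> = (\<integral>\<^sup>+ \<tau>\<in>{a..b}. G \<tau> \<partial>lborel)"
            using ab by (simp add: G_int)
          also have "\<dots> \<le> (\<integral>\<^sup>+ \<tau>\<in>{a..b}. m \<tau> \<partial>lborel)"
          proof (rule nn_integral_mono)
            show "G \<tau> * indicator {a..b} \<tau> \<le> m \<tau> * indicator {a..b} \<tau>" for \<tau>
              using mG[OF d(2), of \<tau>] ab by (cases "\<tau> \<in> {a..b}") auto
          qed
          finally show ?thesis .
        qed
        with d(1) show ?thesis by blast
      qed
    qed (use st in auto)
    also have "\<dots> \<le> (\<integral>\<^sup>+ \<tau>. min (g (\<gamma> \<tau>)) (h (\<gamma> \<tau>)) * indicator {s..t} \<tau>
        + ((G \<tau> + H \<tau>) * indicator (A - C) \<tau> + (G \<tau> + H \<tau>) * indicator (- A - D) \<tau>) \<partial>lborel)"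
    proof (rule nn_integral_mono)
      fix \<tau>
      show "m \<tau> * indicator {s..t} \<tau> \<le> min (g (\<gamma> \<tau>)) (h (\<gamma> \<tau>)) * indicator {s..t} \<tau>
        + ((G \<tau> + H \<tau>) * indicator (A - C) \<tau> + (G \<tau> + H \<tau>) * indicator (- A - D) \<tau>)"
      proof (cases "\<tau> \<in> {s..t}")
        case True
        then have GH: "G \<tau> = g (\<gamma> \<tau>)" "H \<tau> = h (\<gamma> \<tau>)"
          by (simp_all add: G_def H_def)
        consider "\<tau> \<in> C" | "\<tau> \<in> D" | "\<tau> \<in> A - C" | "\<tau> \<in> - A - D" by blast
        then show ?thesis
        proof cases
          case 1
          then have "H \<tau> < G \<tau>" using C(2) by (auto simp: A_def)
          then have "min (g (\<gamma> \<tau>)) (h (\<gamma> \<tau>)) = H \<tau>" unfolding GH by (intro min.absorb2 less_imp_le)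
          then show ?thesis using 1 True by (simp add: m_def add_increasing2)
        next
          case 2
          then have "G \<tau> \<le> H \<tau>" "\<tau> \<notin> C" using D(2) C(2) by (auto simp: A_def)
          then have "min (g (\<gamma> \<tau>)) (h (\<gamma> \<tau>)) = G \<tau>" unfolding GH by (intro min.absorb1)
          then show ?thesis using 2 True \<open>\<tau> \<notin> C\<close> by (simp add: m_def add_increasing2)
        next
          case 3
          have "m \<tau> \<le> G \<tau> + H \<tau>" by (simp add: m_def)
          then show ?thesis using 3 True by (simp add: add_increasing)
        next
          case 4
          have "m \<tau> \<le> G \<tau> + H \<tau>" by (simp add: m_def)
          then show ?thesis using 4 True by (simp add: add_increasing)
        qed
      qed simp
    qed
    also have "\<dots> = path_int (\<lambda>x. min (g x) (h x)) \<gamma> s t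
        + ((\<integral>\<^sup>+ \<tau>\<in>A - C. G \<tau> + H \<tau> \<partial>lborel) + (\<integral>\<^sup>+ \<tau>\<in>- A - D. G \<tau> + H \<tau> \<partial>lborel))"
    proof -
      have "(\<lambda>x. min (g x) (h x)) \<in> borel_measurable borel"
        using g(1) h(1) by measurable
      from arc_curve_measurable[OF \<gamma> this st(1,3)]
      have [measurable]: "(\<lambda>\<tau>. min (g (\<gamma> \<tau>)) (h (\<gamma> \<tau>)) * indicator {s..t} \<tau>) \<in> borel_measurable borel" .
      show ?thesis
        unfolding path_int_def by (simp add: nn_integral_add)
    qed
    also have "\<dots> \<le> path_int (\<lambda>x. min (g x) (h x)) \<gamma> s t + (ennreal (e / 2) + ennreal (e / 2))"
      using C(3) D(3) by (intro add_left_mono add_mono)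
    also have "ennreal (e / 2) + ennreal (e / 2) = ennreal e"
      using e by (simp add: ennreal_plus[symmetric] del: ennreal_plus)
    finally show "ennreal \<bar>u (\<gamma> s) - u (\<gamma> t)\<bar> \<le> path_int (\<lambda>x. min (g x) (h x)) \<gamma> s t + ennreal e" .
  qed
qed

section \<open>Gluing two functions by a Lipschitz cutoff\<close>

definition cutoff :: "'a::metric_space \<Rightarrow> real \<Rightarrow> 'a \<Rightarrow> real" where
  "cutoff x0 R x = max 0 (min 1 (R + 1 - dist x0 x))"

lemma cutoff_bounds: "0 \<le> cutoff x0 R x" "cutoff x0 R x \<le> 1"
  by (auto simp: cutoff_def)

lemma cutoff_eq_1: "x \<in> ball x0 R \<Longrightarrow> cutoff x0 R x = 1"
  by (auto simp: cutoff_def)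

lemma cutoff_eq_0: "R + 1 \<le> dist x0 x \<Longrightarrow> cutoff x0 R x = 0"
  by (auto simp: cutoff_def)

lemma cutoff_lipschitz: "\<bar>cutoff x0 R x - cutoff x0 R y\<bar> \<le> dist x y"
proof -
  have "\<bar>max 0 (min 1 a) - max 0 (min 1 b)\<bar> \<le> \<bar>a - b\<bar>" for a b :: real
    by linarith
  from this[of "R + 1 - dist x0 x" "R + 1 - dist x0 y"]
  have "\<bar>cutoff x0 R x - cutoff x0 R y\<bar> \<le> \<bar>dist x x0 - dist x0 y\<bar>"
    by (simp add: cutoff_def dist_commute[of x x0] abs_minus_commute)
  also have "\<dots> \<le> dist x y"
    by (rule abs_dist_diff_le)
  finally show ?thesis .
qed

text \<open>On a subarc \<open>{a..b}\<close> with \<open>J = path_int H \<gamma> a b\<close>, the value of \<open>v - w\<close> at the endpoint differs from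
  its other values by at most \<open>2 J\<close>, which is absorbed by \<open>(1 + \<epsilon>) H\<close> when \<open>b - a < \<epsilon> / 2\<close>.\<close>

lemma ug_along_cutoff:
  assumes \<gamma>: "arc_curve UNIV \<gamma> l"
    and H: "H \<in> borel_measurable borel" "path_int H \<gamma> 0 l < \<infinity>"
    and v: "ug_along v H \<gamma> l" and w: "ug_along w H \<gamma> l"
    and D: "D \<in> borel_measurable borel" "\<And>x. ennreal (v x - w x) \<le> D x" and wv: "\<And>x. w x \<le> v x"
  shows "ug_along (\<lambda>x. w x + cutoff x0 R x * (v x - w x)) (\<lambda>x. H x + D x * indicator (ball x0 (R + 2)) x) \<gamma> l"
    (is "ug_along ?f ?m \<gamma> l")
  unfolding ug_along_def
proof (intro allI impI, elim conjE)
  fix s t assume st: "0 \<le> s" "s \<le> t" "t \<le> l"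
  let ?D = "\<lambda>x. D x * indicator (ball x0 (R + 2)) x"
  have [measurable]: "D \<in> borel_measurable borel" "H \<in> borel_measurable borel" "ball x0 (R + 2) \<in> sets borel"
    using H D by auto
  define m where "m \<epsilon> \<tau> = (ennreal (1 + \<epsilon>) * H (\<gamma> \<tau>) + ?D (\<gamma> \<tau>)) * indicator {s..t} \<tau>" for \<epsilon> \<tau>
  have m_meas: "m \<epsilon> \<in> borel_measurable borel" for \<epsilon>
    unfolding m_def
    by (rule arc_curve_measurable[OF \<gamma>, of "\<lambda>x. ennreal (1 + \<epsilon>) * H x + ?D x"]) (use st in auto)
  have m_int: "(\<integral>\<^sup>+ \<tau>\<in>{a..b}. m \<epsilon> \<tau> \<partial>lborel) = ennreal (1 + \<epsilon>) * path_int H \<gamma> a b + path_int ?D \<gamma> a b"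
    if ab: "s \<le> a" "b \<le> t" for a b \<epsilon>
  proof -
    have "(\<integral>\<^sup>+ \<tau>\<in>{a..b}. m \<epsilon> \<tau> \<partial>lborel) = path_int (\<lambda>x. ennreal (1 + \<epsilon>) * H x + ?D x) \<gamma> a b"
      unfolding path_int_def using ab by (intro nn_integral_cong) (auto simp: indicator_def m_def)
    also have "\<dots> = path_int (\<lambda>x. ennreal (1 + \<epsilon>) * H x) \<gamma> a b + path_int ?D \<gamma> a b"
      using ab st by (intro path_int_plus[OF \<gamma>]) auto
    also have "path_int (\<lambda>x. ennreal (1 + \<epsilon>) * H x) \<gamma> a b = ennreal (1 + \<epsilon>) * path_int H \<gamma> a b"
      using ab st by (intro path_int_cmult[OF \<gamma>]) auto
    finally show ?thesis .
  qed
  have fin: "path_int H \<gamma> a b < \<infinity>" if "0 \<le> a" "b \<le> l" for a b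
    using path_int_subset[of 0 a b l H \<gamma>] that H(2) by (auto elim: le_less_trans)
  have step: "ennreal \<bar>?f (\<gamma> a) - ?f (\<gamma> b)\<bar> \<le> (\<integral>\<^sup>+ \<tau>\<in>{a..b}. m \<epsilon> \<tau> \<partial>lborel)"
    if ab: "s \<le> a" "a \<le> b" "b \<le> t" and \<epsilon>: "0 < \<epsilon>" "b - a < \<epsilon> / 2" "b - a < 1 / 2" for a b \<epsilon>
  proof -
    have abl: "0 \<le> a" "b \<le> l" using ab st by auto
    obtain J where J: "path_int H \<gamma> a b = ennreal J" "0 \<le> J"
      using fin[OF abl] by (cases "path_int H \<gamma> a b") auto
    have osc: "\<bar>v (\<gamma> a') - v (\<gamma> b')\<bar> \<le> J" "\<bar>w (\<gamma> a') - w (\<gamma> b')\<bar> \<le> J" if "a \<le> a'" "a' \<le> b'" "b' \<le> b" for a' b'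
    proof -
      have "path_int H \<gamma> a' b' \<le> ennreal J"
        unfolding J(1)[symmetric] using that by (intro path_int_subset) auto
      then have "ennreal \<bar>v (\<gamma> a') - v (\<gamma> b')\<bar> \<le> ennreal J" "ennreal \<bar>w (\<gamma> a') - w (\<gamma> b')\<bar> \<le> ennreal J"
        using ug_alongD[OF v, of a' b'] ug_alongD[OF w, of a' b'] that abl by (auto elim: order_trans)
      then show "\<bar>v (\<gamma> a') - v (\<gamma> b')\<bar> \<le> J" "\<bar>w (\<gamma> a') - w (\<gamma> b')\<bar> \<le> J"
        using J(2) by auto
    qed
    have dist_ab: "dist (\<gamma> a) (\<gamma> \<tau>) < 1 / 2" if "a \<le> \<tau>" "\<tau> \<le> b" for \<tau>
      using arc_curve_dist_le[OF \<gamma>, of a \<tau>] that abl \<epsilon> by auto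
    have J_le: "ennreal J \<le> ennreal (1 + \<epsilon>) * ennreal J"
      using J(2) \<epsilon>(1) by (simp add: ennreal_mult[symmetric] ennreal_leI algebra_simps del: ennreal_plus)
    show ?thesis
    \<comment> \<open>The subarc moves by less than 1/2. It therefore stays either at distance at
      least \<open>R + 1\<close>, where the cutoff vanishes, or inside the ball of radius
      \<open>R + 2\<close> on which \<open>D\<close> is counted.\<close>
    proof (cases "R + 3 / 2 \<le> dist x0 (\<gamma> a)")
      case True
      have "R + 1 \<le> dist x0 (\<gamma> \<tau>)" if "a \<le> \<tau>" "\<tau> \<le> b" for \<tau>
        using True dist_ab[OF that] dist_triangle[of x0 "\<gamma> a" "\<gamma> \<tau>"] by (auto simp: dist_commute)
      then have "?f (\<gamma> a) = w (\<gamma> a)" "?f (\<gamma> b) = w (\<gamma> b)"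
        using ab by (simp_all add: cutoff_eq_0)
      then have "ennreal \<bar>?f (\<gamma> a) - ?f (\<gamma> b)\<bar> \<le> ennreal J"
        using osc(2)[of a b] ab by (auto intro!: ennreal_leI)
      also have "\<dots> \<le> ennreal (1 + \<epsilon>) * path_int H \<gamma> a b + path_int ?D \<gamma> a b"
        unfolding J(1) using J_le by (rule order_trans) simp
      finally show ?thesis
        using ab by (simp add: m_int)
    next
      case False
      have in_ball: "\<gamma> \<tau> \<in> ball x0 (R + 2)" if "a \<le> \<tau>" "\<tau> \<le> b" for \<tau>
        using False dist_ab[OF that] dist_triangle[of x0 "\<gamma> \<tau>" "\<gamma> a"] by (auto simp: dist_commute)
      define c d where "c = cutoff x0 R (\<gamma> a)" and "d = cutoff x0 R (\<gamma> b)"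
      have c: "0 \<le> c" "c \<le> 1"
        using cutoff_bounds by (auto simp: c_def)
      have cd: "\<bar>c - d\<bar> \<le> b - a"
        using cutoff_lipschitz[of x0 R "\<gamma> a" "\<gamma> b"] arc_curve_dist_le[OF \<gamma>, of a b] ab abl
        by (auto simp: c_def d_def)
      \<comment> \<open>A discrete product rule: the increments of \<open>w\<close> and
        \<open>v\<close> carry the weights \<open>1 - c\<close> and \<open>c\<close>, so both being
        at most \<open>J\<close> gives \<open>J\<close> and not \<open>2 * J\<close>. The Lipschitz
        bound of the cutoff enters only in the last term.\<close>
      have split: "?f (\<gamma> a) - ?f (\<gamma> b) = (1 - c) * (w (\<gamma> a) - w (\<gamma> b)) + c * (v (\<gamma> a) - v (\<gamma> b))
          + (c - d) * (v (\<gamma> b) - w (\<gamma> b))"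
        unfolding c_def[symmetric] d_def[symmetric] by (simp add: algebra_simps)
      have "\<bar>?f (\<gamma> a) - ?f (\<gamma> b)\<bar> \<le> (1 - c) * J + c * J + (b - a) * (v (\<gamma> b) - w (\<gamma> b))"
      proof -
        have "\<bar>(1 - c) * (w (\<gamma> a) - w (\<gamma> b))\<bar> \<le> (1 - c) * J"
          using c osc(2)[of a b] ab by (simp add: abs_mult mult_left_mono)
        moreover have "\<bar>c * (v (\<gamma> a) - v (\<gamma> b))\<bar> \<le> c * J"
          using c osc(1)[of a b] ab by (simp add: abs_mult mult_left_mono)
        moreover have "\<bar>(c - d) * (v (\<gamma> b) - w (\<gamma> b))\<bar> \<le> (b - a) * (v (\<gamma> b) - w (\<gamma> b))"
          using cd wv[of "\<gamma> b"] by (simp add: abs_mult mult_right_mono)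
        ultimately show ?thesis
          unfolding split by linarith
      qed
      also have "\<dots> = J + (b - a) * (v (\<gamma> b) - w (\<gamma> b))"
        by (simp add: algebra_simps)
      finally have "ennreal \<bar>?f (\<gamma> a) - ?f (\<gamma> b)\<bar> \<le> ennreal (J + (b - a) * (v (\<gamma> b) - w (\<gamma> b)))"
        by (rule ennreal_leI)
      also have "\<dots> = ennreal J + ennreal ((b - a) * (v (\<gamma> b) - w (\<gamma> b)))"
        using J(2) ab wv[of "\<gamma> b"] by (intro ennreal_plus) auto
      also have "ennreal ((b - a) * (v (\<gamma> b) - w (\<gamma> b))) \<le> path_int ?D \<gamma> a b + ennreal (\<epsilon> * J)"
      proof -
        have "ennreal ((b - a) * (v (\<gamma> b) - w (\<gamma> b))) = (\<integral>\<^sup>+ \<tau>\<in>{a..b}. ennreal (v (\<gamma> b) - w (\<gamma> b)) \<partial>lborel)"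
          using ab wv[of "\<gamma> b"]
          by (subst nn_integral_cmult_indicator) (auto simp: ennreal_mult mult.commute)
        also have "\<dots> \<le> (\<integral>\<^sup>+ \<tau>. ?D (\<gamma> \<tau>) * indicator {a..b} \<tau> + ennreal (2 * J) * indicator {a..b} \<tau> \<partial>lborel)"
        proof (rule nn_integral_mono)
          fix \<tau>
          show "ennreal (v (\<gamma> b) - w (\<gamma> b)) * indicator {a..b} \<tau>
              \<le> ?D (\<gamma> \<tau>) * indicator {a..b} \<tau> + ennreal (2 * J) * indicator {a..b} \<tau>"
          proof (cases "\<tau> \<in> {a..b}")
            case True
            have "v (\<gamma> b) - w (\<gamma> b) \<le> (v (\<gamma> \<tau>) - w (\<gamma> \<tau>)) + 2 * J"
              using osc(1)[of \<tau> b] osc(2)[of \<tau> b] True by auto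
            then have "ennreal (v (\<gamma> b) - w (\<gamma> b)) \<le> ennreal (v (\<gamma> \<tau>) - w (\<gamma> \<tau>)) + ennreal (2 * J)"
              using J(2) wv[of "\<gamma> \<tau>"] by (simp add: ennreal_plus[symmetric] ennreal_leI del: ennreal_plus)
            also have "\<dots> \<le> D (\<gamma> \<tau>) + ennreal (2 * J)"
              by (intro add_right_mono D)
            finally show ?thesis
              using True in_ball[of \<tau>] by simp
          qed simp
        qed
        also have "\<dots> = path_int ?D \<gamma> a b + ennreal (2 * J) * ennreal (b - a)"
          unfolding path_int_def using arc_curve_measurable[OF \<gamma>, of ?D a b] ab abl
          by (subst nn_integral_add) (auto simp: nn_integral_cmult_indicator)
        also have "ennreal (2 * J) * ennreal (b - a) \<le> ennreal (\<epsilon> * J)"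
          using J(2) ab \<epsilon> mult_right_mono[of "2 * (b - a)" \<epsilon> J]
          by (simp add: ennreal_mult[symmetric] ennreal_leI algebra_simps)
        finally show ?thesis
          by (simp add: add_left_mono)
      qed
      also have "ennreal J + (path_int ?D \<gamma> a b + ennreal (\<epsilon> * J)) = ennreal (1 + \<epsilon>) * path_int H \<gamma> a b + path_int ?D \<gamma> a b"
        unfolding J(1) using J(2) \<epsilon>(1) by (simp add: distrib_left distrib_right ennreal_mult ac_simps)
      finally show ?thesis
        using ab by (simp add: m_int add_left_mono)
    qed
  qed
  obtain k where k: "path_int H \<gamma> s t = ennreal k" "0 \<le> k"
    using fin[of s t] st by (cases "path_int H \<gamma> s t") auto
  show "ennreal \<bar>?f (\<gamma> s) - ?f (\<gamma> t)\<bar> \<le> path_int ?m \<gamma> s t"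
  proof (rule ennreal_le_epsilon)
    fix e :: real assume "0 < e"
    \<comment> \<open>The denominator \<open>k + 1\<close> stays positive when the integral
      \<open>k\<close> of \<open>H\<close> vanishes, and it makes \<open>\<epsilon> * k\<close> at
      most \<open>e\<close>.\<close>
    define \<epsilon> where "\<epsilon> = e / (k + 1)"
    have \<epsilon>: "0 < \<epsilon>" "\<epsilon> * k \<le> e"
      using k(2) \<open>0 < e\<close> by (simp_all add: \<epsilon>_def field_simps)
    have "ennreal \<bar>?f (\<gamma> s) - ?f (\<gamma> t)\<bar> \<le> (\<integral>\<^sup>+ \<tau>\<in>{s..t}. m \<epsilon> \<tau> \<partial>lborel)"
    proof (rule variation_le_of_local[of s t "m \<epsilon>" "\<lambda>\<tau>. ?f (\<gamma> \<tau>)"])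
      fix x
      show "\<exists>d>0. \<forall>a b. s \<le> a \<and> a \<le> x \<and> x \<le> b \<and> b \<le> t \<and> b - a < d \<longrightarrow>
          ennreal \<bar>?f (\<gamma> a) - ?f (\<gamma> b)\<bar> \<le> (\<integral>\<^sup>+ \<tau>\<in>{a..b}. m \<epsilon> \<tau> \<partial>lborel)"
      proof (intro exI[of _ "min (\<epsilon> / 2) (1 / 2)"] conjI allI impI)
        show "0 < min (\<epsilon> / 2) (1 / 2)" using \<epsilon>(1) by simp
        show "ennreal \<bar>?f (\<gamma> a) - ?f (\<gamma> b)\<bar> \<le> (\<integral>\<^sup>+ \<tau>\<in>{a..b}. m \<epsilon> \<tau> \<partial>lborel)"
          if "s \<le> a \<and> a \<le> x \<and> x \<le> b \<and> b \<le> t \<and> b - a < min (\<epsilon> / 2) (1 / 2)" for a b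
          by (rule step) (use that \<epsilon> in auto)
      qed
    qed (use st m_meas in auto)
    also have "\<dots> = ennreal (k + \<epsilon> * k) + path_int ?D \<gamma> s t"
      using k \<epsilon>(1) by (simp add: m_int ennreal_mult[symmetric] algebra_simps del: ennreal_plus)
    also have "\<dots> \<le> ennreal (k + e) + path_int ?D \<gamma> s t"
      using \<epsilon> by (intro add_right_mono ennreal_leI) auto
    also have "\<dots> = path_int H \<gamma> s t + path_int ?D \<gamma> s t + ennreal e"
      using k \<open>0 < e\<close> by (simp add: ac_simps)
    also have "path_int H \<gamma> s t + path_int ?D \<gamma> s t = path_int ?m \<gamma> s t"
      using st by (intro path_int_plus[OF \<gamma>, symmetric]) auto
    finally show "ennreal \<bar>?f (\<gamma> s) - ?f (\<gamma> t)\<bar> \<le> path_int ?m \<gamma> s t + ennreal e" .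
  qed
qed

context metric_measure
begin

text \<open>Finiteness is assumed for path integrals instead of energies because minimality must be
  tested against gradients that are only locally in L^p.\<close>

lemma wug_min:
  assumes "wug u g" "wug u h"
    "ae_path (\<lambda>\<gamma> l. path_int g \<gamma> 0 l < \<infinity>)" "ae_path (\<lambda>\<gamma> l. path_int h \<gamma> 0 l < \<infinity>)"
  shows "wug u (\<lambda>x. min (g x) (h x))"
  unfolding wug_def
proof (intro conjI)
  have gh: "g \<in> borel_measurable borel" "h \<in> borel_measurable borel"
    "ae_path (ug_along u g)" "ae_path (ug_along u h)"
    using assms by (simp_all add: wug_def)
  show "(\<lambda>x. min (g x) (h x)) \<in> borel_measurable borel"
    using gh(1,2) by measurable
  show "ae_path (ug_along u (\<lambda>x. min (g x) (h x)))"
    by (rule ae_path_mono[OF ae_path_conj[OF ae_path_conj[OF gh(3,4)] ae_path_conj[OF assms(3,4)]]])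
       (auto intro: ug_along_min gh)
qed

lemma wug_cutoff:
  assumes "wug v H" "wug w H" "energy H < \<infinity>"
    and D: "D \<in> borel_measurable borel" "\<And>x. ennreal (v x - w x) \<le> D x" and wv: "\<And>x. w x \<le> v x"
  shows "wug (\<lambda>x. w x + cutoff x0 R x * (v x - w x)) (\<lambda>x. H x + D x * indicator (ball x0 (R + 2)) x)"
  unfolding wug_def
proof (intro conjI)
  have H: "H \<in> borel_measurable borel" "ae_path (ug_along v H)" "ae_path (ug_along w H)"
    using assms by (simp_all add: wug_def)
  show "(\<lambda>x. H x + D x * indicator (ball x0 (R + 2)) x) \<in> borel_measurable borel"
  proof -
    have [measurable]: "ball x0 (R + 2) \<in> sets borel" by simp
    show ?thesis using H(1) D(1) by measurable
  qed
  show "ae_path (ug_along (\<lambda>x. w x + cutoff x0 R x * (v x - w x)) (\<lambda>x. H x + D x * indicator (ball x0 (R + 2)) x))"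
    by (rule ae_path_mono[OF ae_path_conj[OF ae_path_conj[OF H(2,3)] ae_path_finite[OF H(1) assms(3)]]])
       (rule ug_along_cutoff, use H(1) D wv in auto)
qed

end

section \<open>Minimal upper gradients and the capacity as an infimum over pairs\<close>

lemma epow_mult_indicator: "epow (x * indicator A y) p = epow x p * indicator A y"
  by (simp add: indicator_def)

context metric_measure
begin

section \<open>Local integrability and finiteness along curves\<close>

lemma energy_mono: "(\<And>x. g x \<le> h x) \<Longrightarrow> energy g \<le> energy h"
  by (intro nn_integral_mono epow_mono) auto

lemma measurable_energy:
  assumes "g \<in> borel_measurable borel"
  shows "(\<lambda>x. epow (g x) p) \<in> borel_measurable M"
  using borel_measurable_M[OF assms] by measurable

lemma Lp_imp_Lp_loc:
  assumes "g \<in> borel_measurable borel" "energy g < \<infinity>"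
  shows "Lp_loc_fun M p UNIV g"
proof -
  have gM: "g \<in> borel_measurable M"
    using borel_measurable_M[OF assms(1)] .
  have "Lp_fun M p (UNIV \<inter> ball x 1) g" for x
  proof -
    have "(\<integral>\<^sup>+ y\<in>UNIV \<inter> ball x 1. epow (g y) p \<partial>M) \<le> energy g"
      by (intro nn_integral_mono) (auto simp: indicator_def)
    then show ?thesis
      unfolding Lp_fun_def using assms(2) measurable_restrict_space1[OF gM] by (auto elim: le_less_trans)
  qed
  then show ?thesis
    unfolding Lp_loc_fun_def restrict_UNIV using gM by (auto intro!: exI[of _ "1::real"])
qed

text \<open>Closed balls are compact, hence covered by finitely many balls on which \<open>g\<close>
  is in L^p. A curve of length \<open>l\<close> stays in one closed ball about \<open>x0\<close>, so
  countably many truncations of \<open>g\<close> handle all curves.\<close>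

lemma Lp_loc_ae_finite:
  assumes proper: "proper_space TYPE('a)"
    and [measurable]: "g \<in> borel_measurable borel" and "Lp_loc_fun M p UNIV g"
  shows "ae_path (\<lambda>\<gamma> l. path_int g \<gamma> 0 l < \<infinity>)"
proof -
  fix x0 :: 'a
  have gM [measurable]: "(\<lambda>x. epow (g x) p) \<in> borel_measurable M"
    by (rule measurable_energy) fact
  have "\<exists>r>0. Lp_fun M p (UNIV \<inter> ball x r) g" for x
    using assms(3) unfolding Lp_loc_fun_def by blast
  then obtain r where r: "\<And>x. r x > 0" "\<And>x. Lp_fun M p (UNIV \<inter> ball x (r x)) g"
    by metis
  have fin: "energy (\<lambda>x. g x * indicator (cball x0 (real n)) x) < \<infinity>" for n
  proof -
    have cpt: "compact (cball x0 (real n))"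
      using proper unfolding proper_space_def by blast
    have cover: "cball x0 (real n) \<subseteq> (\<Union>x\<in>cball x0 (real n). ball x (r x))"
      using r(1) by auto
    obtain C where C: "C \<subseteq> cball x0 (real n)" "finite C" "cball x0 (real n) \<subseteq> (\<Union>x\<in>C. ball x (r x))"
      by (rule compactE_image[OF cpt _ cover]) auto
    have "energy (\<lambda>x. g x * indicator (cball x0 (real n)) x)
        \<le> (\<integral>\<^sup>+ x. (\<Sum>c\<in>C. epow (g x) p * indicator (ball c (r c)) x) \<partial>M)"
    proof (rule nn_integral_mono)
      fix x
      show "epow (g x * indicator (cball x0 (real n)) x) p \<le> (\<Sum>c\<in>C. epow (g x) p * indicator (ball c (r c)) x)"
      proof (cases "x \<in> cball x0 (real n)")
        case True
        then obtain c where "c \<in> C" "x \<in> ball c (r c)"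
          using C(3) by auto
        then have "epow (g x) p \<le> (\<Sum>c\<in>C. epow (g x) p * indicator (ball c (r c)) x)"
          using C(2) member_le_sum[of c C "\<lambda>c. epow (g x) p * indicator (ball c (r c)) x"] by auto
        then show ?thesis using True by simp
      qed simp
    qed
    also have "\<dots> = (\<Sum>c\<in>C. \<integral>\<^sup>+ x\<in>ball c (r c). epow (g x) p \<partial>M)"
    proof (rule nn_integral_sum)
      fix c
      have [measurable]: "ball c (r c) \<in> sets M"
        by (rule borel_sets_M) simp
      show "(\<lambda>x. epow (g x) p * indicator (ball c (r c)) x) \<in> borel_measurable M"
        by measurable
    qed
    also have "\<dots> < \<infinity>"
      using r(2) C(2) unfolding Lp_fun_def by (simp add: less_top)
    finally show ?thesis .
  qed
  have "ae_path (\<lambda>\<gamma> l. \<forall>n. path_int (\<lambda>x. g x * indicator (cball x0 (real n)) x) \<gamma> 0 l < \<infinity>)"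
  proof (intro ae_path_all ae_path_finite fin)
    fix n
    have [measurable]: "cball x0 (real n) \<in> sets borel" by simp
    show "(\<lambda>x. g x * indicator (cball x0 (real n)) x) \<in> borel_measurable borel"
      by measurable
  qed
  then show ?thesis
  proof (rule ae_path_mono)
    fix \<gamma> l
    assume \<gamma>: "arc_curve UNIV \<gamma> l"
      and *: "\<forall>n. path_int (\<lambda>x. g x * indicator (cball x0 (real n)) x) \<gamma> 0 l < \<infinity>"
    obtain n :: nat where n: "dist x0 (\<gamma> 0) + l \<le> real n"
      using real_arch_simple by blast
    have "path_int g \<gamma> 0 l \<le> path_int (\<lambda>x. g x * indicator (cball x0 (real n)) x) \<gamma> 0 l"
    proof (rule path_int_mono)
      fix \<tau> assume "0 \<le> \<tau>" "\<tau> \<le> l"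
      then have "\<gamma> \<tau> \<in> cball x0 (real n)"
        using n arc_curve_dist_le[OF \<gamma>, of 0 \<tau>] dist_triangle[of x0 "\<gamma> \<tau>" "\<gamma> 0"] by auto
      then show "g (\<gamma> \<tau>) \<le> g (\<gamma> \<tau>) * indicator (cball x0 (real n)) (\<gamma> \<tau>)"
        by simp
    qed
    then show "path_int g \<gamma> 0 l < \<infinity>"
      using * by (auto elim: le_less_trans)
  qed
qed

text \<open>If \<open>h\<close> exceeded \<open>g\<close> on a set of positive measure, replacing
  \<open>h\<close> by the minimum would strictly lower its energy, which is finite.\<close>

lemma energy_eq_imp_AE_le:
  assumes gh [measurable]: "g \<in> borel_measurable borel" "h \<in> borel_measurable borel"
    and "energy h < \<infinity>" "energy h \<le> energy (\<lambda>x. min (h x) (g x))"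
  shows "AE x in M. h x \<le> g x"
proof -
  let ?m = "\<lambda>x. min (h x) (g x)"
  have m: "?m \<in> borel_measurable borel"
    by measurable
  note [measurable] = measurable_energy[OF gh(2)] measurable_energy[OF m]
  have le: "energy ?m \<le> energy h"
    by (rule energy_mono) simp
  have "(\<integral>\<^sup>+ x. epow (h x) p - epow (?m x) p \<partial>M) = energy h - energy ?m"
    using assms(3) le by (intro nn_integral_diff) (auto intro!: epow_mono simp: top_unique)
  also have "\<dots> = 0"
    using assms(3,4) le by (simp add: antisym)
  finally have "AE x in M. epow (h x) p - epow (?m x) p = 0"
    by (subst (asm) nn_integral_0_iff_AE) auto
  moreover have "AE x in M. epow (h x) p \<noteq> \<infinity>"
    using assms(3) by (intro nn_integral_noteq_infinite) auto
  ultimately show ?thesis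
  proof eventually_elim
    case (elim x)
    then have "epow (h x) p \<le> epow (?m x) p"
      by (simp add: diff_eq_0_iff_ennreal less_top)
    then have "h x \<le> ?m x"
      by (simp add: epow_le_iff)
    then show ?case by simp
  qed
qed

text \<open>A minimizing sequence can be made decreasing, so a monotone pointwise limit does the
  work of a weak limit, and closure under minima upgrades least energy to minimality almost
  everywhere.\<close>

lemma minimal_wug_exists:
  assumes "wug u g0" "energy g0 < \<infinity>"
  shows "\<exists>h. wug u h \<and> energy h < \<infinity> \<and>
    (\<forall>g. wug u g \<and> ae_path (\<lambda>\<gamma> l. path_int g \<gamma> 0 l < \<infinity>) \<longrightarrow> (AE x in M. h x \<le> g x))"
proof -
  define a where "a = (INF g\<in>{g. wug u g}. energy g)"
  have a_le: "a \<le> energy g" if "wug u g" for g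
    unfolding a_def using that by (intro INF_lower) simp
  have a_fin: "a < \<infinity>"
    using a_le[OF assms(1)] assms(2) by (rule le_less_trans)
  have "\<exists>g. wug u g \<and> energy g < a + ennreal (1 / real (Suc n))" for n
  proof -
    have "a < a + ennreal (1 / real (Suc n))"
      using a_fin by (simp add: ennreal_less_zero_iff less_top[symmetric])
    then show ?thesis
      unfolding a_def INF_less_iff by auto
  qed
  then obtain f where f: "\<And>n. wug u (f n)" "\<And>n. energy (f n) < a + ennreal (1 / real (Suc n))"
    by metis
  \<comment> \<open>Running minima are still upper gradients and still minimize the energy, and they
    decrease, as \<open>wug_INF\<close> requires.\<close>
  define G where "G = rec_nat (f 0) (\<lambda>n g x. min (g x) (f (Suc n) x))"
  have G: "G 0 = f 0" "G (Suc n) = (\<lambda>x. min (G n x) (f (Suc n) x))" for n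
    by (simp_all add: G_def)
  have f_fin: "energy (f n) < \<infinity>" for n
    using f(2)[of n] a_fin by (auto simp: less_top[symmetric] elim!: less_trans)
  have G_le: "G n x \<le> f n x" for n x
    by (cases n) (simp_all add: G)
  have dec: "decseq G"
    by (intro decseq_SucI le_funI) (simp add: G)
  have wG: "wug u (G n) \<and> energy (G n) < \<infinity>" for n
  proof (induction n)
    case 0
    then show ?case using f f_fin by (simp add: G)
  next
    case (Suc n)
    have "energy (G (Suc n)) \<le> energy (f (Suc n))"
      by (intro energy_mono G_le)
    moreover have "wug u (G (Suc n))"
      unfolding G using Suc f f_fin
      by (intro wug_min ae_path_finite) (auto intro: wug_measurable)
    ultimately show ?case
      using f_fin[of "Suc n"] by (auto elim: le_less_trans)
  qed
  define h where "h x = (INF n. G n x)" for x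
  have wh: "wug u h"
    unfolding h_def using wG by (intro wug_INF dec) auto
  have h_le: "energy h \<le> a + ennreal (1 / real (Suc n))" for n
  proof -
    have "energy h \<le> energy (f n)"
      unfolding h_def by (intro energy_mono INF_lower2[of n] G_le) simp
    then show ?thesis
      using f(2)[of n] by (meson order_trans less_imp_le)
  qed
  have h_fin: "energy h < \<infinity>"
    using h_le[of 0] a_fin by (auto simp: less_top[symmetric] top_unique)
  have "energy h \<le> a"
  proof (rule ennreal_le_epsilon)
    fix e :: real assume "0 < e"
    then obtain n where n: "1 / real (Suc n) < e"
      using nat_approx_posE by blast
    have "energy h \<le> a + ennreal (1 / real (Suc n))" by (rule h_le)
    also have "\<dots> \<le> a + ennreal e"
      using n by (intro add_left_mono ennreal_leI) simp
    finally show "energy h \<le> a + ennreal e" .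
  qed
  show ?thesis
  proof (intro exI[of _ h] conjI allI impI wh h_fin, elim conjE)
    fix g assume g: "wug u g" "ae_path (\<lambda>\<gamma> l. path_int g \<gamma> 0 l < \<infinity>)"
    \<comment> \<open>\<open>g\<close> may have infinite energy, but its minimum with
      \<open>h\<close> is a competitor in the infimum \<open>a\<close>.\<close>
    have "wug u (\<lambda>x. min (h x) (g x))"
      by (rule wug_min[OF wh g(1) ae_path_finite[OF wug_measurable[OF wh] h_fin] g(2)])
    then have "energy h \<le> energy (\<lambda>x. min (h x) (g x))"
      using a_le \<open>energy h \<le> a\<close> order_trans by blast
    then show "AE x in M. h x \<le> g x"
      using wh g h_fin by (intro energy_eq_imp_AE_le) (auto intro: wug_measurable)
  qed
qed

text \<open>\<open>min_weak_upper_gradient\<close> is a Hilbert choice, so its properties rest on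
  the existence of some minimal gradient; the \<open>h\<close> of least energy is one. The
  competitors in the definition of minimality are first replaced by Borel versions, for which
  \<open>wug\<close> is available.\<close>

lemma min_weak_upper_gradient_props:
  assumes proper: "proper_space TYPE('a)" and "wug u g0" "energy g0 < \<infinity>"
  shows "weak_upper_gradient M p UNIV (\<lambda>x. ereal (u x)) (min_weak_upper_gradient M p UNIV (\<lambda>x. ereal (u x)))"
    and "\<And>g. wug u g \<Longrightarrow> energy g < \<infinity> \<Longrightarrow> AE x in M. min_weak_upper_gradient M p UNIV (\<lambda>x. ereal (u x)) x \<le> g x"
proof -
  obtain h where h: "wug u h" "energy h < \<infinity>"
    "\<forall>g. wug u g \<and> ae_path (\<lambda>\<gamma> l. path_int g \<gamma> 0 l < \<infinity>) \<longrightarrow> (AE x in M. h x \<le> g x)"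
    using minimal_wug_exists[OF assms(2,3)] by (elim exE conjE)
  have "is_min_weak_upper_gradient M p UNIV (\<lambda>x. ereal (u x)) h"
    unfolding is_min_weak_upper_gradient_def
  proof (intro conjI allI impI)
    show "weak_upper_gradient M p UNIV (\<lambda>x. ereal (u x)) h"
      by (rule wug_imp_weak_upper_gradient) fact
    show "Lp_loc_fun M p UNIV h"
      using h by (intro Lp_imp_Lp_loc wug_measurable)
    fix g' assume g': "weak_upper_gradient M p UNIV (\<lambda>x. ereal (u x)) g' \<and> Lp_loc_fun M p UNIV g'"
    then obtain g where g: "wug u g" "AE x in M. g x = g' x"
      using weak_upper_gradient_imp_wug by blast
    have gM: "g \<in> borel_measurable M"
      using borel_measurable_M[OF wug_measurable[OF g(1)]] .
    have "Lp_fun M p (UNIV \<inter> ball x r) g" if "Lp_fun M p (UNIV \<inter> ball x r) g'" for x r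
    proof -
      have "(\<integral>\<^sup>+ y\<in>UNIV \<inter> ball x r. epow (g y) p \<partial>M) = (\<integral>\<^sup>+ y\<in>UNIV \<inter> ball x r. epow (g' y) p \<partial>M)"
        using g(2) by (intro nn_integral_cong_AE) auto
      then show ?thesis
        using that measurable_restrict_space1[OF gM] unfolding Lp_fun_def by auto
    qed
    then have "Lp_loc_fun M p UNIV g"
      using g' gM unfolding Lp_loc_fun_def restrict_UNIV by blast
    then have "AE x in M. h x \<le> g x"
      using h(3)[rule_format, OF conjI[OF g(1) Lp_loc_ae_finite[OF proper wug_measurable[OF g(1)]]]] by simp
    then show "AE x in restrict_space M UNIV. h x \<le> g' x"
      unfolding restrict_UNIV using g(2) by eventually_elim simp
  qed
  then have *: "is_min_weak_upper_gradient M p UNIV (\<lambda>x. ereal (u x)) (min_weak_upper_gradient M p UNIV (\<lambda>x. ereal (u x)))"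
    unfolding min_weak_upper_gradient_def
    using someI[of "is_min_weak_upper_gradient M p UNIV (\<lambda>x. ereal (u x))" h] by simp
  then show "weak_upper_gradient M p UNIV (\<lambda>x. ereal (u x)) (min_weak_upper_gradient M p UNIV (\<lambda>x. ereal (u x)))"
    by (simp only: is_min_weak_upper_gradient_def)
  show "AE x in M. min_weak_upper_gradient M p UNIV (\<lambda>x. ereal (u x)) x \<le> g x" if "wug u g" "energy g < \<infinity>" for g
    using * wug_imp_weak_upper_gradient[OF that(1)] Lp_imp_Lp_loc[OF wug_measurable[OF that(1)] that(2)]
    unfolding is_min_weak_upper_gradient_def restrict_UNIV by blast
qed

text \<open>Membership in the Newtonian space is split: the L^p part stays here, whereas the
  gradient part is carried by a separate \<open>g\<close> with \<open>wug u g\<close>, so that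
  functions and gradients can be manipulated in pairs.\<close>

definition admissible :: "'a set \<Rightarrow> 'a set \<Rightarrow> ('a \<Rightarrow> real) \<Rightarrow> bool" where
  "admissible E \<Omega> u \<longleftrightarrow> u \<in> borel_measurable M \<and>
     (\<forall>x. indicator E x \<le> u x \<and> u x \<le> indicator \<Omega> x) \<and> energy (\<lambda>x. ennreal (u x)) < \<infinity>"

lemma admissibleD:
  assumes "admissible E \<Omega> u"
  shows "u \<in> borel_measurable M" "energy (\<lambda>x. ennreal (u x)) < \<infinity>"
    "0 \<le> u x" "u x \<le> 1" "x \<in> E \<Longrightarrow> u x = 1" "x \<notin> \<Omega> \<Longrightarrow> u x = 0"
proof -
  have *: "indicator E x \<le> u x" "u x \<le> indicator \<Omega> x"
    using assms by (auto simp: admissible_def)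
  have "(indicator \<Omega> x :: real) \<le> 1" "(0::real) \<le> indicator E x"
    by (auto simp: indicator_def)
  then show 0: "0 \<le> u x" "u x \<le> 1"
    using * by linarith+
  show "u x = 1" if "x \<in> E"
    using * 0 that by simp
  show "u x = 0" if "x \<notin> \<Omega>"
    using * 0 that by simp
qed (use assms in \<open>auto simp: admissible_def\<close>)

text \<open>Together with \<open>bounded_cap_approx\<close> this turns the capacity into an infimum
  of energies over pairs, after which the chosen minimal gradient can be forgotten.\<close>

lemma bounded_cap_le_energy:
  assumes proper: "proper_space TYPE('a)" and u: "admissible E \<Omega> u" and g: "wug u g"
  shows "bounded_cap M p E \<Omega> \<le> energy g"
proof (cases "energy g < \<infinity>")
  case True
  let ?U = "\<lambda>x. ereal (u x)"
  have "e2ennreal \<bar>?U x\<bar> = ennreal (u x)" for x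
    using admissibleD(3)[OF u, of x] by (simp add: e2ennreal_ereal)
  moreover have "(INF g\<in>{g. weak_upper_gradient M p UNIV ?U g}. \<integral>\<^sup>+ x\<in>UNIV. epow (g x) p \<partial>M) \<le> energy g"
    using wug_imp_weak_upper_gradient[OF g] by (intro INF_lower2[of g]) auto
  then have "(INF g\<in>{g. weak_upper_gradient M p UNIV ?U g}. \<integral>\<^sup>+ x\<in>UNIV. epow (g x) p \<partial>M) < \<infinity>"
    using True by (rule le_less_trans)
  ultimately have "newtonian_norm_pow M p UNIV ?U < \<infinity>"
    unfolding newtonian_norm_pow_def using admissibleD(2)[OF u] by simp
  moreover have "?U \<in> borel_measurable M"
    using admissibleD(1)[OF u] by (rule borel_measurable_ereal)
  ultimately have "?U \<in> newtonian M p UNIV"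
    unfolding newtonian_def restrict_UNIV by blast
  moreover have "indicator E x \<le> ?U x \<and> ?U x \<le> indicator \<Omega> x" for x
    using u unfolding admissible_def
    by (cases "x \<in> E"; cases "x \<in> \<Omega>") (auto simp: indicator_def one_ereal_def zero_ereal_def dest!: spec[of _ x])
  ultimately have "bounded_cap M p E \<Omega> \<le> (\<integral>\<^sup>+ x\<in>\<Omega>. epow (min_weak_upper_gradient M p UNIV ?U x) p \<partial>M)"
    unfolding bounded_cap_def by (intro INF_lower) blast
  also have "\<dots> \<le> energy g"
  proof (rule nn_integral_mono_AE)
    show "AE x in M. epow (min_weak_upper_gradient M p UNIV ?U x) p * indicator \<Omega> x \<le> epow (g x) p"
      using min_weak_upper_gradient_props(2)[OF proper g True g True]
    proof eventually_elim
      case (elim x)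
      then have "epow (min_weak_upper_gradient M p UNIV ?U x) p \<le> epow (g x) p"
        by (intro epow_mono) auto
      then show ?case by (simp add: indicator_def)
    qed
  qed
  finally show ?thesis .
qed (simp add: less_top[symmetric])

lemma bounded_cap_approx:
  assumes proper: "proper_space TYPE('a)" and "open \<Omega>" and "bounded_cap M p E \<Omega> < c"
  shows "\<exists>u g. admissible E \<Omega> u \<and> wug u g \<and> energy g < c"
proof -
  obtain U where U: "U \<in> newtonian M p UNIV" "\<And>x. indicator E x \<le> U x" "\<And>x. U x \<le> indicator \<Omega> x"
    and lt: "(\<integral>\<^sup>+ x\<in>\<Omega>. epow (min_weak_upper_gradient M p UNIV U x) p \<partial>M) < c"
    using assms(3) unfolding bounded_cap_def INF_less_iff by auto
  define u where "u x = real_of_ereal (U x)" for x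
  have U01: "0 \<le> U x" "U x \<le> 1" for x
    using order_trans[OF _ U(2)[of x], of 0] order_trans[OF U(3)[of x], of 1] by (simp_all add: indicator_def)
  have U_eq: "U = (\<lambda>x. ereal (u x))"
  proof
    show "U x = ereal (u x)" for x
      using U01[of x] by (cases "U x") (auto simp: u_def)
  qed
  have u0: "0 \<le> u x" for x
    using U01[of x] by (simp add: U_eq)
  have U_meas: "U \<in> borel_measurable M" and norm: "newtonian_norm_pow M p UNIV U < \<infinity>"
    using U(1) unfolding newtonian_def restrict_UNIV by auto
  have abs_U: "e2ennreal \<bar>U x\<bar> = ennreal (u x)" for x
    using u0[of x] by (simp add: U_eq e2ennreal_ereal)
  have fin: "energy (\<lambda>x. ennreal (u x)) < \<infinity>"
    and "(INF g\<in>{g. weak_upper_gradient M p UNIV U g}. \<integral>\<^sup>+ x\<in>UNIV. epow (g x) p \<partial>M) < \<infinity>"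
    using norm unfolding newtonian_norm_pow_def by (auto simp: abs_U)
  \<comment> \<open>Any gradient of finite energy will do; it guarantees that the chosen minimal
    gradient is a genuine one.\<close>
  then obtain g1 where g1: "weak_upper_gradient M p UNIV U g1" "energy g1 < \<infinity>"
    unfolding INF_less_iff by auto
  then obtain g2 where g2: "wug u g2" "AE x in M. g2 x = g1 x"
    using weak_upper_gradient_imp_wug unfolding U_eq by blast
  have "energy g2 = energy g1"
    using g2(2) by (intro nn_integral_cong_AE) auto
  then have g2_fin: "energy g2 < \<infinity>"
    using g1 by simp
  have ind: "indicator E x \<le> u x \<and> u x \<le> indicator \<Omega> x" for x
    using U(2,3)[of x] by (auto simp: U_eq indicator_def one_ereal_def zero_ereal_def split: if_splits)
  have adm: "admissible E \<Omega> u"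
    unfolding admissible_def using fin ind borel_measurable_real_of_ereal[OF U_meas]
    unfolding u_def by blast
  obtain h where h: "wug u h" "AE x in M. h x = min_weak_upper_gradient M p UNIV U x"
    using weak_upper_gradient_imp_wug[OF min_weak_upper_gradient_props(1)[OF proper g2(1) g2_fin]]
    unfolding U_eq by blast
  \<comment> \<open>Truncation to \<open>\<Omega>\<close> makes the energy over the whole space
    equal to the integral that defines the capacity.\<close>
  have "wug u (\<lambda>x. h x * indicator \<Omega> x)"
    using admissibleD(6)[OF adm] by (intro wug_indicator h assms)
  moreover have "energy (\<lambda>x. h x * indicator \<Omega> x) = (\<integral>\<^sup>+ x\<in>\<Omega>. epow (min_weak_upper_gradient M p UNIV U x) p \<partial>M)"
    using h(2) by (intro nn_integral_cong_AE) (auto simp: epow_mult_indicator)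
  ultimately show ?thesis
    using adm lt by (intro exI[of _ u] exI[of _ "\<lambda>x. h x * indicator \<Omega> x"] conjI) simp_all
qed

end

section \<open>Uniform convexity\<close>

lemma ennreal_mean:
  assumes "0 \<le> x" "0 \<le> y"
  shows "ennreal (1/2) * (ennreal x + ennreal y) = ennreal ((x + y) / 2)"
proof -
  have "ennreal (1/2) * (ennreal x + ennreal y) = ennreal ((1/2) * (x + y))"
    using assms by (subst ennreal_mult) simp_all
  then show ?thesis by simp
qed

text \<open>For \<open>a = s (1 + x)\<close> and \<open>b = s (1 - x)\<close> the mean of \<open>a\<^sup>p\<close> and \<open>b\<^sup>p\<close> is \<open>s\<^sup>p powr_mean p x\<close>.\<close>

definition powr_mean :: "real \<Rightarrow> real \<Rightarrow> real" where
  "powr_mean p x = ((1 + x) powr p + (1 - x) powr p) / 2"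

lemma powr_mean_strict_mono:
  assumes "1 < p" "0 \<le> x" "x < y" "y \<le> 1"
  shows "powr_mean p x < powr_mean p y"
proof (rule DERIV_pos_imp_increasing_open[OF \<open>x < y\<close>])
  fix z assume z: "x < z" "z < y"
  have "(powr_mean p has_real_derivative (p * (1 + z) powr (p - 1) - p * (1 - z) powr (p - 1)) / 2) (at z)"
    unfolding powr_mean_def using z assms
    by (auto intro!: derivative_eq_intros)
  moreover have "0 < (p * (1 + z) powr (p - 1) - p * (1 - z) powr (p - 1)) / 2"
    using z assms by (simp add: powr_less_mono2)
  ultimately show "\<exists>d. DERIV (powr_mean p) z :> d \<and> 0 < d"
    by blast
next
  show "continuous_on {x..y} (powr_mean p)"
    unfolding powr_mean_def
    by (intro continuous_on_divide continuous_on_add continuous_on_diff continuous_on_powr' continuous_on_const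
        continuous_on_id) (use assms in auto)
qed

lemma powr_mean_mono: "1 < p \<Longrightarrow> 0 \<le> x \<Longrightarrow> x \<le> y \<Longrightarrow> y \<le> 1 \<Longrightarrow> powr_mean p x \<le> powr_mean p y"
  using powr_mean_strict_mono[of p x y] by (cases "x = y") auto

lemma powr_mean_0: "powr_mean p 0 = 1"
  by (simp add: powr_mean_def)

text \<open>By homogeneity and symmetry only \<open>x = (a - b) / (a + b)\<close> between 0 and 1
  matters. For small \<open>x\<close> the difference term is below \<open>\<eta>\<close> times the
  p-th power of the mean; for the other \<open>x\<close> the convexity gap
  \<open>powr_mean p x - 1\<close> is bounded below, and a large \<open>K\<close> pays for the
  difference. One argument covers all p > 1, without the two ranges of Clarkson's
  inequalities.\<close>

lemma powr_uniformly_convex: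
  fixes p \<eta> :: real
  assumes "1 < p" "0 < \<eta>"
  shows "\<exists>K\<ge>0. \<forall>a\<ge>0. \<forall>b\<ge>0. \<bar>a - b\<bar> powr p + K * ((a + b) / 2) powr p
           \<le> \<eta> * ((a + b) / 2) powr p + K * ((a powr p + b powr p) / 2)"
proof -
  \<comment> \<open>The second entry makes \<open>(2 * x0) powr p\<close> at most
    \<open>\<eta>\<close>; the first keeps \<open>x0\<close> below 1.\<close>
  define x0 where "x0 = min (1 / 2) (\<eta> powr (1 / p) / 2)"
  have x0: "0 < x0" "x0 < 1"
    using assms by (auto simp: x0_def)
  have x0p: "(2 * x0) powr p \<le> \<eta>"
  proof -
    have "(2 * x0) powr p \<le> (\<eta> powr (1 / p)) powr p"
      using assms x0 by (intro powr_mono2) (auto simp: x0_def)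
    also have "\<dots> = \<eta>"
      using assms by (simp add: powr_powr)
    finally show ?thesis .
  qed
  define \<kappa> where "\<kappa> = powr_mean p x0 - 1"
  have \<kappa>: "0 < \<kappa>"
    using powr_mean_strict_mono[of p 0 x0] x0 assms by (simp add: \<kappa>_def powr_mean_0)
  \<comment> \<open>Chosen so that \<open>K * \<kappa>\<close> is \<open>2 powr p\<close>, the
    largest value of \<open>(2 * x) powr p\<close>.\<close>
  define K where "K = 2 powr p / \<kappa>"
  have K: "0 \<le> K"
    using \<kappa> by (simp add: K_def)
  have main: "\<bar>a - b\<bar> powr p + K * ((a + b) / 2) powr p
      \<le> \<eta> * ((a + b) / 2) powr p + K * ((a powr p + b powr p) / 2)" if "0 \<le> b" "b \<le> a" for a b
  proof (cases "a = 0")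
    case False
    define s where "s = (a + b) / 2"
    define x where "x = (a - b) / (a + b)"
    have s: "0 < s"
      using that False by (simp add: s_def)
    have x: "0 \<le> x" "x \<le> 1"
      using that False by (auto simp: x_def field_simps)
    have sum: "a + b \<noteq> 0"
      using that False by auto
    have "1 + x = a / s" "1 - x = b / s" "2 * x = (a - b) / s"
      using sum by (simp_all add: x_def s_def field_simps)
    then have ab: "a = s * (1 + x)" "b = s * (1 - x)" "a - b = s * (2 * x)"
      using s by simp_all
    have mean: "(a powr p + b powr p) / 2 = s powr p * powr_mean p x"
    proof -
      have "a powr p = s powr p * (1 + x) powr p" "b powr p = s powr p * (1 - x) powr p"
        using s x unfolding ab(1,2) by (simp_all add: powr_mult)
      then show ?thesis
        by (simp add: powr_mean_def algebra_simps)
    qed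
    have diff: "\<bar>a - b\<bar> powr p = s powr p * (2 * x) powr p"
      using s x unfolding ab(3) by (simp add: powr_mult abs_mult)
    have "(2 * x) powr p + K \<le> \<eta> + K * powr_mean p x"
    proof (cases "x < x0")
      case True
      have "(2 * x) powr p \<le> \<eta>"
        using True x assms x0p by (intro order_trans[OF powr_mono2 x0p]) auto
      moreover have "K * 1 \<le> K * powr_mean p x"
        using K x assms powr_mean_mono[of p 0 x] by (intro mult_left_mono) (auto simp: powr_mean_0)
      ultimately show ?thesis by simp
    next
      case False
      have "(2 * x) powr p \<le> 2 powr p"
        using x assms by (intro powr_mono2) auto
      also have "\<dots> = K * \<kappa>"
        using \<kappa> by (simp add: K_def)
      also have "\<dots> \<le> K * (powr_mean p x - 1)"
        unfolding \<kappa>_def using K False x x0 assms powr_mean_mono[of p x0 x] by (intro mult_left_mono) auto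
      finally show ?thesis
        using assms by (simp add: algebra_simps)
    qed
    then have "s powr p * ((2 * x) powr p + K) \<le> s powr p * (\<eta> + K * powr_mean p x)"
      by (rule mult_left_mono) simp
    then show ?thesis
      unfolding mean diff s_def[symmetric] by (simp add: algebra_simps)
  qed (use that assms in simp)
  have "\<bar>a - b\<bar> powr p + K * ((a + b) / 2) powr p
      \<le> \<eta> * ((a + b) / 2) powr p + K * ((a powr p + b powr p) / 2)" if "0 \<le> a" "0 \<le> b" for a b
    using main[of b a] main[of a b] that by (cases "b \<le> a") (auto simp: abs_minus_commute add.commute)
  then show ?thesis
    using K by blast
qed

context metric_measure
begin

text \<open>\<open>K\<close> depends only on \<open>\<eta>\<close> and \<open>p\<close>, so it is
  fixed before the functions. When the average of \<open>a\<close> and \<open>b\<close> is close to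
  the lower bound \<open>c\<close> for the energy of the mean, the right side is small up to the
  freely chosen \<open>\<eta>\<close>.\<close>

lemma energy_diff_le:
  assumes "0 < \<eta>"
  shows "\<exists>K\<ge>0. \<forall>g h a b c. g \<in> borel_measurable borel \<and> h \<in> borel_measurable borel \<and> (\<forall>x. 0 \<le> g x \<and> 0 \<le> h x) \<and>
      0 \<le> a \<and> 0 \<le> b \<and> 0 \<le> c \<and> energy (\<lambda>x. ennreal (g x)) \<le> ennreal a \<and> energy (\<lambda>x. ennreal (h x)) \<le> ennreal b \<and>
      ennreal c \<le> energy (\<lambda>x. ennreal ((g x + h x) / 2)) \<longrightarrow>
      energy (\<lambda>x. ennreal \<bar>g x - h x\<bar>) \<le> ennreal (\<eta> * ((a + b) / 2) + K * ((a + b) / 2 - c))"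
proof -
  obtain K where K: "0 \<le> K" and uc: "\<And>a b. 0 \<le> a \<Longrightarrow> 0 \<le> b \<Longrightarrow> \<bar>a - b\<bar> powr p + K * ((a + b) / 2) powr p
           \<le> \<eta> * ((a + b) / 2) powr p + K * ((a powr p + b powr p) / 2)"
    using powr_uniformly_convex[OF p_gt_1 assms] by blast
  \<comment> \<open>Plain convexity bounds the energy of the mean by \<open>(a + b) / 2\<close>;
    this makes it finite, so that it can be subtracted in the integrated inequality.\<close>
  have mid: "((a + b) / 2) powr p \<le> (a powr p + b powr p) / 2" if "0 \<le> a" "0 \<le> b" for a b
  proof (cases "a = 0 \<or> b = 0")
    case True
    have "(x / 2) powr p \<le> x powr p / 2" if "0 \<le> x" for x
    proof -
      have "(2::real) powr 1 \<le> 2 powr p"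
        using p_gt_1 by (intro powr_mono) auto
      then have "x powr p / 2 powr p \<le> x powr p / 2"
        by (intro divide_left_mono) auto
      then show ?thesis
        using that by (simp add: powr_divide)
    qed
    then show ?thesis
      using True that by auto
  next
    case False
    then show ?thesis
      using convex_onD[OF powr_convex, of p "1/2" a b] p_gt_1 that by (simp add: field_simps)
  qed
  show ?thesis
  proof (intro exI[of _ K] conjI K allI impI, elim conjE)
    fix g h :: "'a \<Rightarrow> real" and a b c :: real
    assume [measurable]: "g \<in> borel_measurable borel" "h \<in> borel_measurable borel"
      and pos: "\<forall>x. 0 \<le> g x \<and> 0 \<le> h x" and abc: "0 \<le> a" "0 \<le> b" "0 \<le> c"
      and a: "energy (\<lambda>x. ennreal (g x)) \<le> ennreal a"
      and b: "energy (\<lambda>x. ennreal (h x)) \<le> ennreal b"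
      and c: "ennreal c \<le> energy (\<lambda>x. ennreal ((g x + h x) / 2))"
    define k where "k = K / 2"
    have k: "0 \<le> k" "K = 2 * k"
      using K by (simp_all add: k_def)
    let ?D = "energy (\<lambda>x. ennreal \<bar>g x - h x\<bar>)"
    let ?m = "energy (\<lambda>x. ennreal ((g x + h x) / 2))"
    have [measurable]: "(\<lambda>x. epow (ennreal (g x)) p) \<in> borel_measurable M"
      "(\<lambda>x. epow (ennreal (h x)) p) \<in> borel_measurable M"
      "(\<lambda>x. epow (ennreal \<bar>g x - h x\<bar>) p) \<in> borel_measurable M"
      "(\<lambda>x. epow (ennreal ((g x + h x) / 2)) p) \<in> borel_measurable M"
      by (intro measurable_energy; measurable)+
    have "?m \<le> (\<integral>\<^sup>+ x. ennreal (1/2) * epow (ennreal (g x)) p + ennreal (1/2) * epow (ennreal (h x)) p \<partial>M)"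
    proof (rule nn_integral_mono)
      fix x
      have "ennreal (((g x + h x) / 2) powr p) \<le> ennreal ((1/2) * g x powr p + (1/2) * h x powr p)"
        using mid[of "g x" "h x"] pos by (intro ennreal_leI) (simp add: field_simps)
      also have "\<dots> = ennreal ((1/2) * g x powr p) + ennreal ((1/2) * h x powr p)"
        by (intro ennreal_plus) simp_all
      also have "\<dots> = ennreal (1/2) * ennreal (g x powr p) + ennreal (1/2) * ennreal (h x powr p)"
        by (intro arg_cong2[of _ _ _ _ "(+)"] ennreal_mult) simp_all
      finally show "epow (ennreal ((g x + h x) / 2)) p \<le> ennreal (1/2) * epow (ennreal (g x)) p + ennreal (1/2) * epow (ennreal (h x)) p"
        using pos by (simp add: epow_ennreal)
    qed
    also have "\<dots> = ennreal (1/2) * energy (\<lambda>x. ennreal (g x)) + ennreal (1/2) * energy (\<lambda>x. ennreal (h x))"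
      by (simp add: nn_integral_add nn_integral_cmult)
    also have "\<dots> \<le> ennreal (1/2) * ennreal a + ennreal (1/2) * ennreal b"
      using a b by (intro add_mono mult_left_mono) auto
    also have "\<dots> = ennreal ((a + b) / 2)"
      using abc by (simp only: ennreal_mean flip: distrib_left)
    finally have m_le: "?m \<le> ennreal ((a + b) / 2)" .
    then obtain m where m: "?m = ennreal m" "0 \<le> m"
      by (cases ?m) (auto simp: top_unique)
    have m_bounds: "c \<le> m" "m \<le> (a + b) / 2"
      using c m_le m abc by auto
    have "?D + ennreal K * ?m = (\<integral>\<^sup>+ x. epow (ennreal \<bar>g x - h x\<bar>) p + ennreal K * epow (ennreal ((g x + h x) / 2)) p \<partial>M)"
      by (simp add: nn_integral_add nn_integral_cmult)
    also have "\<dots> \<le> (\<integral>\<^sup>+ x. ennreal \<eta> * epow (ennreal ((g x + h x) / 2)) p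
        + (ennreal k * epow (ennreal (g x)) p + ennreal k * epow (ennreal (h x)) p) \<partial>M)"
    proof (rule nn_integral_mono)
      fix x
      have gh: "0 \<le> g x" "0 \<le> h x" using pos by auto
      have "ennreal (\<bar>g x - h x\<bar> powr p + K * ((g x + h x) / 2) powr p)
          \<le> ennreal (\<eta> * ((g x + h x) / 2) powr p + (k * g x powr p + k * h x powr p))"
        using uc[OF gh] by (intro ennreal_leI) (simp add: k(2) algebra_simps add_divide_distrib)
      then show "epow (ennreal \<bar>g x - h x\<bar>) p + ennreal K * epow (ennreal ((g x + h x) / 2)) p
          \<le> ennreal \<eta> * epow (ennreal ((g x + h x) / 2)) p
            + (ennreal k * epow (ennreal (g x)) p + ennreal k * epow (ennreal (h x)) p)"
        using gh K k(1) assms by (simp add: epow_ennreal ennreal_mult)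
    qed
    also have "\<dots> = ennreal \<eta> * ?m + (ennreal k * energy (\<lambda>x. ennreal (g x)) + ennreal k * energy (\<lambda>x. ennreal (h x)))"
      by (simp add: nn_integral_add nn_integral_cmult)
    also have "\<dots> \<le> ennreal \<eta> * ennreal m + (ennreal k * ennreal a + ennreal k * ennreal b)"
      unfolding m(1) using a b by (intro add_mono mult_left_mono) auto
    also have "\<dots> = ennreal (\<eta> * m + K * ((a + b) / 2))"
      using assms m(2) k abc by (simp add: ennreal_mult[symmetric] ennreal_plus[symmetric] algebra_simps del: ennreal_plus)
    finally have le: "?D + ennreal (K * m) \<le> ennreal (\<eta> * m + K * ((a + b) / 2))"
      using K m by (simp add: ennreal_mult)
    then obtain d where d: "?D = ennreal d" "0 \<le> d"
      by (cases ?D) (auto simp: top_unique)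
    have "d + K * m \<le> \<eta> * m + K * ((a + b) / 2)"
      using le d K m(2) assms abc by (simp add: ennreal_plus[symmetric] del: ennreal_plus)
    moreover have "K * c \<le> K * m" "\<eta> * m \<le> \<eta> * ((a + b) / 2)"
      using m_bounds K assms by (auto intro: mult_left_mono)
    ultimately have "d \<le> \<eta> * ((a + b) / 2) + K * ((a + b) / 2 - c)"
      by (simp add: right_diff_distrib)
    then show "?D \<le> ennreal (\<eta> * ((a + b) / 2) + K * ((a + b) / 2 - c))"
      using d by (simp add: ennreal_leI)
  qed
qed

end

section \<open>Nearly minimal pairs for an increasing sequence\<close>

lemma bounded_cap_mono:
  assumes "A \<subseteq> B"
  shows "bounded_cap M p A \<Omega> \<le> bounded_cap M p B \<Omega>"
proof -
  have "indicator A x \<le> (indicator B x :: ereal)" for x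
    using assms by (auto simp: indicator_def)
  then show ?thesis
    unfolding bounded_cap_def by (intro INF_superset_mono) (auto intro: order_trans)
qed

context metric_measure
begin

text \<open>Differences of gradients call for real values. Finite energy makes \<open>g\<close>
  finite almost everywhere, and changing it on a null set is harmless for
  \<open>wug\<close>.\<close>

lemma wug_real_version:
  assumes "wug u g" "energy g < \<infinity>"
  shows "\<exists>f. f \<in> borel_measurable borel \<and> (\<forall>x. 0 \<le> f x) \<and> wug u (\<lambda>x. ennreal (f x)) \<and>
    energy (\<lambda>x. ennreal (f x)) = energy g"
proof (intro exI[of _ "\<lambda>x. enn2real (g x)"] conjI allI)
  have g: "g \<in> borel_measurable borel"
    by (rule wug_measurable) fact
  then show meas: "(\<lambda>x. enn2real (g x)) \<in> borel_measurable borel"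
    by measurable
  have "AE x in M. epow (g x) p \<noteq> \<infinity>"
    using assms(2) measurable_energy[OF g] by (intro nn_integral_noteq_infinite) auto
  then have eq: "AE x in M. g x = ennreal (enn2real (g x))"
    unfolding epow_eq_infinity_iff by eventually_elim (simp add: less_top)
  show "wug u (\<lambda>x. ennreal (enn2real (g x)))"
    by (rule wug_cong_AE[OF assms(1) _ eq]) (use meas in measurable)
  show "energy (\<lambda>x. ennreal (enn2real (g x))) = energy g"
    by (rule nn_integral_cong_AE) (use eq in eventually_elim, simp)
qed simp

lemma admissible_measurable_energy:
  assumes "admissible E \<Omega> u"
  shows "(\<lambda>x. epow (ennreal (u x)) p) \<in> borel_measurable M"
  using admissibleD(1)[OF assms] by measurable

lemma admissible_dominated:
  assumes "u \<in> borel_measurable M" "\<And>x. indicator E x \<le> u x" "\<And>x. u x \<le> indicator \<Omega> x"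
    and "\<And>x. epow (ennreal (u x)) p \<le> h x" "(\<integral>\<^sup>+ x. h x \<partial>M) < \<infinity>"
  shows "admissible E \<Omega> u"
proof -
  have "energy (\<lambda>x. ennreal (u x)) \<le> (\<integral>\<^sup>+ x. h x \<partial>M)"
    by (rule nn_integral_mono) (rule assms)
  then show ?thesis
    unfolding admissible_def using assms by (auto elim: le_less_trans)
qed

lemma admissible_mean:
  assumes u: "admissible A \<Omega> u" and v: "admissible B \<Omega> v" and "A \<subseteq> B"
  shows "admissible A \<Omega> (\<lambda>x. (u x + v x) / 2)"
proof (rule admissible_dominated)
  show "(\<lambda>x. (u x + v x) / 2) \<in> borel_measurable M"
    using admissibleD(1)[OF u] admissibleD(1)[OF v] by measurable
  show "indicator A x \<le> (u x + v x) / 2" for x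
    using admissibleD(3,5)[OF u, of x] admissibleD(3,5)[OF v, of x] \<open>A \<subseteq> B\<close>
    by (cases "x \<in> A") auto
  show "(u x + v x) / 2 \<le> indicator \<Omega> x" for x
    using admissibleD(4,6)[OF u, of x] admissibleD(4,6)[OF v, of x]
    by (cases "x \<in> \<Omega>") auto
  show "epow (ennreal ((u x + v x) / 2)) p \<le> epow (ennreal (u x)) p + epow (ennreal (v x)) p" for x
  proof -
    have "ennreal ((u x + v x) / 2) \<le> max (ennreal (u x)) (ennreal (v x))"
      using admissibleD(3)[OF u, of x] admissibleD(3)[OF v, of x] by (auto simp: max_def intro!: ennreal_leI)
    then show ?thesis
      using epow_mono epow_max p_pos order_trans by blast
  qed
  show "(\<integral>\<^sup>+ x. epow (ennreal (u x)) p + epow (ennreal (v x)) p \<partial>M) < \<infinity>"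
    using admissible_measurable_energy[OF u] admissible_measurable_energy[OF v]
      admissibleD(2)[OF u] admissibleD(2)[OF v]
    by (simp add: nn_integral_add)
qed

text \<open>The capacity at the smaller of two indices bounds the energy of the mean from below, so
  the gap fed to \<open>energy_diff_le\<close> is controlled by the distance of the capacities from
  their limit. The tolerances \<open>\<zeta>\<close> are left open because the later summation needs
  weights; thinning out along \<open>r\<close> meets any choice of them.\<close>

lemma near_minimizers:
  fixes E :: "nat \<Rightarrow> 'a set"
  assumes proper: "proper_space TYPE('a)" and \<Omega>: "open \<Omega>" and E: "incseq E"
    and cc: "\<And>k. bounded_cap M p (E k) \<Omega> \<le> ennreal cc" "0 \<le> cc" and \<zeta>: "\<And>i. 0 < \<zeta> i"
  shows "\<exists>(r :: nat \<Rightarrow> nat) u g. strict_mono r \<and> (\<forall>i. admissible (E (r i)) \<Omega> (u i)) \<and>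
    (\<forall>i. g i \<in> borel_measurable borel) \<and> (\<forall>i x. 0 \<le> g i x) \<and> (\<forall>i. wug (u i) (\<lambda>x. ennreal (g i x))) \<and>
    (\<forall>i. energy (\<lambda>x. ennreal (g i x)) \<le> ennreal (cc + (1/2)^i)) \<and>
    (\<forall>i. energy (\<lambda>x. ennreal \<bar>g (Suc i) x - g i x\<bar>) \<le> ennreal (\<zeta> i))"
proof -
  define c where "c k = enn2real (bounded_cap M p (E k) \<Omega>)" for k
  have c: "bounded_cap M p (E k) \<Omega> = ennreal (c k)" for k
    using cc(1)[of k] by (simp add: c_def less_top[symmetric] top_unique) (metis ennreal_enn2real_if ennreal_less_top le_less_trans less_irrefl)
  have c0: "0 \<le> c k" for k
    by (simp add: c_def)
  have c_cc: "c k \<le> cc" for k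
    using cc(1)[of k] cc(2) by (simp add: c)
  have "\<exists>u g. admissible (E k) \<Omega> u \<and> wug u g \<and> energy g < ennreal (c k + (1/2)^k)" for k
    using c0[of k] by (intro bounded_cap_approx proper \<Omega>) (simp add: c ennreal_lessI)
  then obtain U G0 where UG0: "\<And>k. admissible (E k) \<Omega> (U k)" "\<And>k. wug (U k) (G0 k)"
    "\<And>k. energy (G0 k) < ennreal (c k + (1/2)^k)"
    by metis
  have "\<exists>f. f \<in> borel_measurable borel \<and> (\<forall>x. 0 \<le> f x) \<and> wug (U k) (\<lambda>x. ennreal (f x)) \<and>
    energy (\<lambda>x. ennreal (f x)) = energy (G0 k)" for k
    using UG0(3)[of k] by (intro wug_real_version UG0) (auto elim: less_trans)
  then obtain G where G: "\<And>k. G k \<in> borel_measurable borel" "\<And>k x. 0 \<le> G k x"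
    "\<And>k. wug (U k) (\<lambda>x. ennreal (G k x))" "\<And>k. energy (\<lambda>x. ennreal (G k x)) = energy (G0 k)"
    by metis
  have G_le: "energy (\<lambda>x. ennreal (G k x)) \<le> ennreal (c k + (1/2)^k)" for k
    using UG0(3)[of k] G(4)[of k] by simp
  have mean: "ennreal (c k) \<le> energy (\<lambda>x. ennreal ((G k x + G m x) / 2))" if "k \<le> m" for k m
  proof -
    have "admissible (E k) \<Omega> (\<lambda>x. (U k x + U m x) / 2)"
      using E that by (intro admissible_mean[OF UG0(1) UG0(1)]) (auto simp: incseq_def)
    from bounded_cap_le_energy[OF proper this wug_mean[OF G(3) G(3)]]
    have "ennreal (c k) \<le> energy (\<lambda>x. ennreal (1/2) * (ennreal (G k x) + ennreal (G m x)))"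
      by (simp add: c)
    also have "(\<lambda>x. ennreal (1/2) * (ennreal (G k x) + ennreal (G m x))) = (\<lambda>x. ennreal ((G k x + G m x) / 2))"
      by (simp only: ennreal_mean G(2))
    finally show ?thesis .
  qed
  have incc: "incseq c"
  proof (rule incseq_SucI)
    show "c k \<le> c (Suc k)" for k
      using bounded_cap_mono[of "E k" "E (Suc k)" M p \<Omega>] E c0 by (simp add: c incseq_Suc_iff)
  qed
  obtain L where L: "c \<longlonglongrightarrow> L" "\<And>k. c k \<le> L"
    using incseq_convergent[OF incc, of cc] c_cc by auto
  have cauchy: "\<exists>N. \<forall>k\<ge>N. \<forall>m\<ge>k. energy (\<lambda>x. ennreal \<bar>G m x - G k x\<bar>) \<le> ennreal z" if "0 < z" for z
  proof -
    \<comment> \<open>Half of \<open>z\<close> pays for the term with \<open>\<eta>\<close>, since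
      the average of the energy bounds is at most \<open>cc + 1\<close>; the term with
      \<open>K\<close> falls below the other half for large indices, because \<open>c k\<close>
      tends to \<open>L\<close>.\<close>
    define \<eta> where "\<eta> = z / (2 * (cc + 1))"
    have \<eta>: "0 < \<eta>" "\<eta> * (cc + 1) = z / 2"
      using that cc(2) by (simp_all add: \<eta>_def field_simps)
    obtain K where K: "0 \<le> K" and diff: "\<forall>g h a b c. g \<in> borel_measurable borel \<and> h \<in> borel_measurable borel \<and> (\<forall>x. 0 \<le> g x \<and> 0 \<le> h x) \<and>
      0 \<le> a \<and> 0 \<le> b \<and> 0 \<le> c \<and> energy (\<lambda>x. ennreal (g x)) \<le> ennreal a \<and> energy (\<lambda>x. ennreal (h x)) \<le> ennreal b \<and>
      ennreal c \<le> energy (\<lambda>x. ennreal ((g x + h x) / 2)) \<longrightarrow>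
      energy (\<lambda>x. ennreal \<bar>g x - h x\<bar>) \<le> ennreal (\<eta> * ((a + b) / 2) + K * ((a + b) / 2 - c))"
      using energy_diff_le[OF \<eta>(1)] by blast
    have "(\<lambda>k. K * ((L - c k) + (1/2)^k)) \<longlonglongrightarrow> K * ((L - L) + 0)"
      by (intro tendsto_intros L LIMSEQ_power_zero) simp
    then have "\<forall>\<^sub>F k in sequentially. K * ((L - c k) + (1/2)^k) < z / 2"
      by (rule order_tendstoD) (use that in simp)
    then obtain N where N: "\<And>k. N \<le> k \<Longrightarrow> K * ((L - c k) + (1/2)^k) < z / 2"
      by (auto simp: eventually_sequentially)
    have "energy (\<lambda>x. ennreal \<bar>G m x - G k x\<bar>) \<le> ennreal z" if km: "N \<le> k" "k \<le> m" for k m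
    proof -
      let ?a = "c m + (1/2)^m" and ?b = "c k + (1/2)^k"
      have pw: "(1/2::real)^m \<le> (1/2)^k" "(1/2::real)^k \<le> 1"
        using km by (auto intro: power_decreasing power_le_one)
      have "energy (\<lambda>x. ennreal \<bar>G m x - G k x\<bar>) \<le> ennreal (\<eta> * ((?a + ?b) / 2) + K * ((?a + ?b) / 2 - c k))"
        using diff[rule_format, of "G m" "G k" ?a ?b "c k"] G(1,2) G_le c0 mean[OF km(2)]
        by (simp add: add.commute)
      also have "\<dots> \<le> ennreal z"
      proof (rule ennreal_leI)
        have "(a + x + (b + y)) / 2 \<le> C + 1" if "x \<le> y" "y \<le> 1" "b \<le> C" "a \<le> C" for a b x y C :: real
          using that by (simp add: field_simps)
        from this[OF pw c_cc c_cc] have "(?a + ?b) / 2 \<le> cc + 1" .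
        then have "\<eta> * ((?a + ?b) / 2) \<le> \<eta> * (cc + 1)"
          using \<eta>(1) by (intro mult_left_mono) simp_all
        moreover have "(a + x + (b + y)) / 2 - b \<le> (L - b) + y" if "x \<le> y" "a \<le> L" "b \<le> L" for a b x y :: real
          using that by (simp add: field_simps)
        from this[OF pw(1) L(2) L(2)] have "(?a + ?b) / 2 - c k \<le> (L - c k) + (1/2)^k" .
        then have "K * ((?a + ?b) / 2 - c k) \<le> K * ((L - c k) + (1/2)^k)"
          using K by (intro mult_left_mono)
        ultimately show "\<eta> * ((?a + ?b) / 2) + K * ((?a + ?b) / 2 - c k) \<le> z"
          using N[OF km(1)] \<eta>(2) by linarith
      qed
      finally show ?thesis .
    qed
    then show ?thesis by blast
  qed
  then have "\<exists>N. \<forall>k\<ge>N. \<forall>m\<ge>k. energy (\<lambda>x. ennreal \<bar>G m x - G k x\<bar>) \<le> ennreal (\<zeta> i)" for i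
    using \<zeta> by blast
  then obtain N where N: "\<And>i k m. N i \<le> k \<Longrightarrow> k \<le> m \<Longrightarrow> energy (\<lambda>x. ennreal \<bar>G m x - G k x\<bar>) \<le> ennreal (\<zeta> i)"
    by metis
  \<comment> \<open>The partial sums dominate each \<open>N i\<close>, and the summand
    \<open>i\<close> makes \<open>r\<close> strictly increasing.\<close>
  define r where "r i = (\<Sum>j\<le>i. N j) + i" for i
  have r: "strict_mono r"
    by (rule strict_monoI_Suc) (simp add: r_def)
  have rN: "N i \<le> r i" for i
    unfolding r_def using member_le_sum[of i "{..i}" N] by simp
  have "energy (\<lambda>x. ennreal (G (r i) x)) \<le> ennreal (cc + (1/2)^i)" for i
  proof -
    have "(1/2::real)^(r i) \<le> (1/2)^i"
      using seq_suble[OF r, of i] by (intro power_decreasing) auto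
    then show ?thesis
      using c_cc[of "r i"] by (intro order_trans[OF G_le] ennreal_leI add_mono)
  qed
  moreover have "energy (\<lambda>x. ennreal \<bar>G (r (Suc i)) x - G (r i) x\<bar>) \<le> ennreal (\<zeta> i)" for i
    using r by (intro N rN) (simp add: strict_mono_less_eq)
  ultimately show ?thesis
    using r UG0(1) G by (intro exI[of _ r] exI[of _ "\<lambda>i. U (r i)"] exI[of _ "\<lambda>i. G (r i)"]) simp
qed

end

section \<open>From nearly minimal pairs to a bounded increasing union\<close>

lemma tendsto_SUP_atMost_shift:
  fixes f :: "nat \<Rightarrow> real"
  assumes "bdd_above (range f)"
  shows "(\<lambda>m. SUP i\<in>{j..j + m}. f i) \<longlonglongrightarrow> (SUP i\<in>{j..}. f i)"
proof (rule order_tendstoI)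
  have bdd: "bdd_above (f ` I)" for I
    using assms by (rule bdd_above_mono) auto
  have le: "(SUP i\<in>{j..j + m}. f i) \<le> (SUP i\<in>{j..}. f i)" for m
    by (rule cSUP_subset_mono) (auto simp: bdd)
  show "\<forall>\<^sub>F m in sequentially. a < (SUP i\<in>{j..j + m}. f i)" if a: "a < (SUP i\<in>{j..}. f i)" for a
  proof -
    obtain i where i: "j \<le> i" "a < f i"
      using a less_cSUP_iff[of "{j..}" f a] bdd by auto
    have "a < (SUP i\<in>{j..j + m}. f i)" if "i \<le> m" for m
      using i that cSUP_upper[of i "{j..j + m}" f] bdd by force
    then show ?thesis
      unfolding eventually_sequentially by blast
  qed
  show "\<forall>\<^sub>F m in sequentially. (SUP i\<in>{j..j + m}. f i) < a" if "(SUP i\<in>{j..}. f i) < a" for a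
    using that le by (intro always_eventually allI) (rule le_less_trans)
qed

context metric_measure
begin

text \<open>The weights make \<open>\<Sum>i. d i\<close> at most the supremum of \<open>2 ^ Suc i * d i\<close>, whose energy is bounded by a
  sum of energies.\<close>

lemma energy_suminf_le:
  assumes [measurable]: "\<And>i. d i \<in> borel_measurable borel"
    and d: "\<And>i::nat. energy (d i) \<le> ennreal ((2 ^ Suc i) powr (- p) * b i)"
    and b: "\<And>i. 0 \<le> b i" "summable b"
  shows "energy (\<lambda>x. \<Sum>i. d i x) \<le> ennreal (\<Sum>i. b i)"
proof -
  define Y where "Y x = (SUP i. ennreal (2 ^ Suc i) * d i x)" for x
  have meas: "(\<lambda>x. epow (ennreal (2 ^ Suc i) * d i x) p) \<in> borel_measurable M" for i
    by (rule measurable_energy) measurable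
  have "(\<Sum>i. d i x) \<le> Y x" for x
  proof -
    have "d i x \<le> ennreal ((1/2) ^ Suc i) * Y x" for i
    proof -
      have "d i x = ennreal ((1/2) ^ Suc i) * (ennreal (2 ^ Suc i) * d i x)"
        by (simp add: mult.assoc[symmetric] ennreal_mult[symmetric] power_mult_distrib[symmetric] del: power_Suc)
      also have "\<dots> \<le> ennreal ((1/2) ^ Suc i) * Y x"
        unfolding Y_def by (intro mult_left_mono SUP_upper) auto
      finally show ?thesis .
    qed
    then have "(\<Sum>i. d i x) \<le> (\<Sum>i. ennreal ((1/2) ^ Suc i) * Y x)"
      by (intro suminf_le) auto
    also have "\<dots> = (\<Sum>i. ennreal ((1/2) ^ Suc i)) * Y x"
      by (rule ennreal_suminf_multc)
    also have "(\<Sum>i. ennreal ((1/2) ^ Suc i)) = ennreal (\<Sum>i. (1/2) ^ Suc i)"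
      using power_half_series by (intro suminf_ennreal2) (auto dest: sums_summable)
    also have "(\<Sum>i. (1/2::real) ^ Suc i) = 1"
      using power_half_series by (rule sums_unique[symmetric])
    finally show ?thesis by simp
  qed
  then have "energy (\<lambda>x. \<Sum>i. d i x) \<le> energy Y"
    by (rule energy_mono)
  also have "\<dots> \<le> (\<integral>\<^sup>+ x. (\<Sum>i. epow (ennreal (2 ^ Suc i) * d i x) p) \<partial>M)"
    unfolding Y_def
  proof (intro nn_integral_mono epow_cSUP_le)
    show "epow (ennreal (2 ^ Suc i) * d i x) p \<le> (\<Sum>i. epow (ennreal (2 ^ Suc i) * d i x) p)" for i x
      using sum_le_suminf[of "\<lambda>i. epow (ennreal (2 ^ Suc i) * d i x) p" "{i}"] by simp
  qed simp
  also have "\<dots> = (\<Sum>i. energy (\<lambda>x. ennreal (2 ^ Suc i) * d i x))"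
    by (rule nn_integral_suminf) (rule meas)
  also have "\<dots> \<le> (\<Sum>i. ennreal (b i))"
  proof (rule suminf_le)
    fix i
    have "energy (\<lambda>x. ennreal (2 ^ Suc i) * d i x) = ennreal ((2 ^ Suc i) powr p) * energy (d i)"
      using measurable_energy[of "d i"]
      by (simp add: epow_mult epow_ennreal nn_integral_cmult del: power_Suc)
    also have "\<dots> \<le> ennreal ((2 ^ Suc i) powr p) * ennreal ((2 ^ Suc i) powr (- p) * b i)"
      by (intro mult_left_mono d) simp
    also have "\<dots> = ennreal (((2 ^ Suc i) powr p * (2 ^ Suc i) powr (- p)) * b i)"
      using b by (simp add: ennreal_mult[symmetric] mult.assoc del: power_Suc)
    also have "(2 ^ Suc i) powr p * (2 ^ Suc i) powr (- p) = (1 :: real)"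
      by (simp add: powr_minus del: power_Suc)
    finally show "energy (\<lambda>x. ennreal (2 ^ Suc i) * d i x) \<le> ennreal (b i)"
      by simp
  qed auto
  also have "\<dots> = ennreal (\<Sum>i. b i)"
    using b by (intro suminf_ennreal2) auto
  finally show ?thesis .
qed

lemma energy_add_le:
  assumes "0 < \<theta>" "g \<in> borel_measurable borel" "h \<in> borel_measurable borel"
  shows "energy (\<lambda>x. g x + h x) \<le> ennreal ((1 + \<theta>) powr p) * energy g + ennreal ((1 + 1 / \<theta>) powr p) * energy h"
proof -
  have [measurable]: "(\<lambda>x. epow (g x) p) \<in> borel_measurable M" "(\<lambda>x. epow (h x) p) \<in> borel_measurable M"
    using assms by (auto intro: measurable_energy)
  have "energy (\<lambda>x. g x + h x) \<le>
      (\<integral>\<^sup>+ x. ennreal ((1 + \<theta>) powr p) * epow (g x) p + ennreal ((1 + 1 / \<theta>) powr p) * epow (h x) p \<partial>M)"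
    by (intro nn_integral_mono epow_add_le assms p_pos)
  also have "\<dots> = ennreal ((1 + \<theta>) powr p) * energy g + ennreal ((1 + 1 / \<theta>) powr p) * energy h"
    by (simp add: nn_integral_add nn_integral_cmult)
  finally show ?thesis .
qed

text \<open>The factor with \<open>\<theta>\<close> is the price of separating \<open>H\<close> from
  the gluing error. With \<open>\<theta>\<close> fixed, that error is a constant times an integral
  that vanishes as the finite maxima approach the supremum.\<close>

lemma bounded_cap_SUP_le:
  assumes proper: "proper_space TYPE('a)" and A: "\<And>i::nat. admissible (A i) \<Omega> (u i)"
    and wug: "\<And>i. wug (u i) H" "energy H < \<infinity>" and bdd: "bounded E"
    and E: "\<And>x. x \<in> E \<Longrightarrow> \<exists>i\<ge>j. x \<in> A i" and "0 < \<theta>"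
  shows "bounded_cap M p E \<Omega> \<le> ennreal ((1 + \<theta>) powr p) * energy H"
proof -
  fix x0 :: 'a
  obtain R where R: "E \<subseteq> ball x0 R"
    using bdd bounded_subset_ballD by blast
  define v where "v x = (SUP i\<in>{j..}. u i x)" for x
  define w where "w m x = (SUP i\<in>{j..j + m}. u i x)" for m x
  note u = admissibleD[OF A]
  have bdd_u: "bdd_above ((\<lambda>i. u i x) ` I)" for x I
    using u(4) by (intro bdd_aboveI[of _ 1]) auto
  have [measurable]: "u i \<in> borel_measurable M" for i
    by (rule u)
  have [measurable]: "v \<in> borel_measurable M" "w m \<in> borel_measurable M" for m
    unfolding v_def w_def by (auto intro!: borel_measurable_cSUP bdd_u)
  have w0: "0 \<le> w m x" and w_le: "w m x \<le> v x" and v1: "v x \<le> 1" for m x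
  proof -
    show "0 \<le> w m x"
      unfolding w_def by (rule cSUP_upper2[OF bdd_u, of j]) (auto simp: u)
    show "w m x \<le> v x"
      unfolding w_def v_def by (rule cSUP_subset_mono) (auto simp: bdd_u)
    show "v x \<le> 1"
      unfolding v_def by (rule cSUP_least) (auto simp: u)
  qed
  have v_out: "v x = 0" if "x \<notin> \<Omega>" for x
    unfolding v_def using u(6)[OF that] by simp
  have v_E: "v x = 1" if x: "x \<in> E" for x
  proof -
    obtain i where "i \<ge> j" "x \<in> A i"
      using E[OF x] by blast
    then have "1 \<le> v x"
      unfolding v_def using u(5) by (intro cSUP_upper2[OF bdd_u, of i]) auto
    then show ?thesis
      using v1[of x] by simp
  qed
  have w_lim: "(\<lambda>m. w m x) \<longlonglongrightarrow> v x" for x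
    unfolding w_def v_def using bdd_u[of x UNIV] by (intro tendsto_SUP_atMost_shift) simp
  have wug_v: "wug v H"
    using wug_SUP[of "{j..}" u "\<lambda>_. H" 1] wug u(4) by (simp add: v_def[abs_def])
  have wug_w: "wug (w m) H" for m
    using wug_SUP[of "{j..j + m}" u "\<lambda>_. H" 1] wug u(4) by (simp add: w_def[abs_def])
  define B where "B = ball x0 (R + 2)"
  have [measurable]: "B \<in> sets borel" "B \<in> sets M"
    by (simp_all add: B_def borel_sets_M)
  have B_fin: "emeasure M B < \<infinity>"
  proof (cases "0 < R + 2")
    case True
    then show ?thesis
      using mms unfolding metric_measure_space_def B_def by blast
  next
    case False
    then show ?thesis by (simp add: B_def ball_empty)
  qed
  define e where "e m = (\<integral>\<^sup>+ x\<in>B. epow (ennreal (v x - w m x)) p \<partial>M)" for m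
  have cap_le: "bounded_cap M p E \<Omega> \<le> ennreal ((1 + \<theta>) powr p) * energy H + ennreal ((1 + 1 / \<theta>) powr p) * e m" for m
  proof -
    have "(\<lambda>x. ennreal (v x - w m x)) \<in> borel_measurable M"
      by measurable
    \<comment> \<open>\<open>v - w m\<close> is only known to be measurable for the completed
      measure, so a Borel majorant takes its place in the gradient.\<close>
    then obtain D where D: "D \<in> borel_measurable borel" "AE x in M. D x = ennreal (v x - w m x)"
      "\<And>x. ennreal (v x - w m x) \<le> D x"
      by (rule borel_version) blast
    note [measurable] = D(1)
    define f where "f x = w m x + cutoff x0 R x * (v x - w m x)" for x
    have wug_f: "wug f (\<lambda>x. H x + D x * indicator B x)"
      unfolding f_def B_def by (rule wug_cutoff[OF wug_v wug_w wug(2) D(1,3) w_le])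
    have f_bounds: "w m x \<le> f x" "f x \<le> v x" for x
    proof -
      have "0 \<le> cutoff x0 R x * (v x - w m x)"
        using cutoff_bounds[of x0 R x] w_le[of m x] by simp
      moreover have "cutoff x0 R x * (v x - w m x) \<le> 1 * (v x - w m x)"
        using cutoff_bounds[of x0 R x] w_le[of m x] by (intro mult_right_mono) auto
      ultimately show "w m x \<le> f x" "f x \<le> v x"
        by (simp_all add: f_def)
    qed
    have "admissible E \<Omega> f"
    proof (rule admissible_dominated)
      have "cutoff x0 R \<in> borel_measurable borel"
        unfolding cutoff_def[abs_def] by (intro borel_measurable_continuous_onI continuous_intros)
      then have [measurable]: "cutoff x0 R \<in> borel_measurable M"
        by (rule borel_measurable_M)
      show "f \<in> borel_measurable M"
        unfolding f_def[abs_def] by measurable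
      show "indicator E x \<le> f x" for x
      proof (cases "x \<in> E")
        case True
        then show ?thesis
          using v_E[OF True] cutoff_eq_1[of x x0 R] R by (auto simp: f_def)
      qed (use order_trans[OF w0 f_bounds(1)] in simp)
      show "f x \<le> indicator \<Omega> x" for x
        using f_bounds(2)[of x] v1[of x] v_out[of x] by (cases "x \<in> \<Omega>") auto
      \<comment> \<open>Inside \<open>B\<close> the bound \<open>f x \<le> 1\<close> is enough since
        \<open>B\<close> has finite measure; outside, \<open>f\<close> is the finite maximum
        \<open>w m\<close>, whose value is that of one of the \<open>u i\<close>.\<close>
      show "epow (ennreal (f x)) p \<le> (\<Sum>i\<in>{j..j + m}. epow (ennreal (u i x)) p) + indicator B x" for x
      proof (cases "x \<in> B")
        case True
        have "epow (ennreal (f x)) p \<le> epow 1 p"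
          using f_bounds(2)[of x] v1[of x] by (intro epow_mono) auto
        then show ?thesis
          using True by (simp add: add_increasing)
      next
        case False
        then have "f x = w m x"
          using cutoff_eq_0[of R x0 x] by (simp add: f_def B_def)
        moreover have "w m x \<in> (\<lambda>i. u i x) ` {j..j + m}"
          unfolding w_def by (subst cSup_eq_Max) (auto intro!: Max_in)
        ultimately obtain i where i: "i \<in> {j..j + m}" "f x = u i x"
          by auto
        then have "epow (ennreal (f x)) p \<le> (\<Sum>i\<in>{j..j + m}. epow (ennreal (u i x)) p)"
          using member_le_sum[of i "{j..j + m}" "\<lambda>i. epow (ennreal (u i x)) p"] by simp
        then show ?thesis
          by (simp add: add_increasing2)
      qed
      have "(\<integral>\<^sup>+ x. (\<Sum>i\<in>{j..j + m}. epow (ennreal (u i x)) p) + indicator B x \<partial>M)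
          = (\<Sum>i\<in>{j..j + m}. energy (\<lambda>x. ennreal (u i x))) + emeasure M B"
        by (subst nn_integral_add) (auto simp: nn_integral_sum)
      also have "\<dots> < \<infinity>"
        using u(2) B_fin by (simp add: less_top)
      finally show "(\<integral>\<^sup>+ x. (\<Sum>i\<in>{j..j + m}. epow (ennreal (u i x)) p) + indicator B x \<partial>M) < \<infinity>" .
    qed
    from bounded_cap_le_energy[OF proper this wug_f]
    have "bounded_cap M p E \<Omega> \<le> energy (\<lambda>x. H x + D x * indicator B x)" .
    also have "\<dots> \<le> ennreal ((1 + \<theta>) powr p) * energy H + ennreal ((1 + 1 / \<theta>) powr p) * energy (\<lambda>x. D x * indicator B x)"
      using wug_measurable[OF wug_v] by (intro energy_add_le \<open>0 < \<theta>\<close>) auto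
    also have "energy (\<lambda>x. D x * indicator B x) = e m"
      unfolding e_def using D(2) by (intro nn_integral_cong_AE) (auto simp: epow_mult_indicator)
    finally show ?thesis .
  qed
  \<comment> \<open>\<open>v - w m\<close> lies between 0 and 1, so the indicator of
    \<open>B\<close> is an integrable majorant.\<close>
  have "e \<longlonglongrightarrow> (\<integral>\<^sup>+ x. 0 \<partial>M)"
    unfolding e_def
  proof (rule nn_integral_dominated_convergence[where w = "indicator B"])
    show "(\<lambda>x. epow (ennreal (v x - w m x)) p * indicator B x) \<in> borel_measurable M" for m
      by measurable
    show "(\<integral>\<^sup>+ x. indicator B x \<partial>M) < \<infinity>"
      using B_fin by simp
    show "AE x in M. epow (ennreal (v x - w m x)) p * indicator B x \<le> indicator B x" for m
    proof (intro AE_I2)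
      fix x
      have "epow (ennreal (v x - w m x)) p \<le> epow 1 p"
        using w0[of m x] v1[of x] by (intro epow_mono) auto
      then show "epow (ennreal (v x - w m x)) p * indicator B x \<le> indicator B x"
        by (simp add: indicator_def)
    qed
    show "AE x in M. (\<lambda>m. epow (ennreal (v x - w m x)) p * indicator B x) \<longlonglongrightarrow> 0"
    proof (intro AE_I2)
      fix x
      have "(\<lambda>m. (v x - w m x) powr p) \<longlonglongrightarrow> (v x - v x) powr p"
        using w_le[of _ x] by (intro tendsto_powr2 tendsto_intros w_lim) (auto intro!: always_eventually)
      then have "(\<lambda>m. ennreal ((v x - w m x) powr p)) \<longlonglongrightarrow> ennreal 0"
        by (intro tendsto_ennrealI) simp
      then have "(\<lambda>m. epow (ennreal (v x - w m x)) p) \<longlonglongrightarrow> 0"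
        using w_le[of _ x] by (simp add: epow_ennreal)
      then show "(\<lambda>m. epow (ennreal (v x - w m x)) p * indicator B x) \<longlonglongrightarrow> 0"
        by (cases "x \<in> B") simp_all
    qed
  qed auto
  then have "(\<lambda>m. ennreal ((1 + \<theta>) powr p) * energy H + ennreal ((1 + 1 / \<theta>) powr p) * e m)
      \<longlonglongrightarrow> ennreal ((1 + \<theta>) powr p) * energy H + ennreal ((1 + 1 / \<theta>) powr p) * 0"
    by (intro tendsto_add tendsto_const ennreal_tendsto_cmult) (simp_all add: less_top)
  then show ?thesis
    using cap_le by (intro LIMSEQ_le_const[where X = "\<lambda>m. ennreal ((1 + \<theta>) powr p) * energy H + ennreal ((1 + 1 / \<theta>) powr p) * e m"]) simp_all
qed

text \<open>The bound \<open>cc\<close> is arbitrary instead of being the limit of the capacities,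
  so that for sets cut off by a ball it can be taken from the whole, possibly unbounded
  sets.\<close>

lemma bounded_cap_union_le:
  fixes E :: "nat \<Rightarrow> 'a set"
  assumes proper: "proper_space TYPE('a)" and \<Omega>: "open \<Omega>" and E: "incseq E" and bdd: "bounded (\<Union>i. E i)"
    and cc: "\<And>k. bounded_cap M p (E k) \<Omega> \<le> ennreal cc" "0 \<le> cc"
  shows "bounded_cap M p (\<Union>i. E i) \<Omega> \<le> ennreal cc"
proof -
  let ?E = "\<Union>i. E i"
  \<comment> \<open>The first factor offsets the weights in \<open>energy_suminf_le\<close>; the
    second leaves a geometric series whose tail from \<open>j\<close> on is
    \<open>2 * (1/2)^j\<close>.\<close>
  define \<zeta> where "\<zeta> i = (2 ^ Suc i) powr (- p) * (1/2) ^ i" for i :: nat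
  have \<zeta>_pos: "0 < \<zeta> i" for i
    by (simp add: \<zeta>_def)
  obtain r u g where r: "strict_mono r" and *: "\<forall>i. admissible (E (r i)) \<Omega> (u i)"
    "\<forall>i. g i \<in> borel_measurable borel" "\<forall>i x. 0 \<le> g i x" "\<forall>i. wug (u i) (\<lambda>x. ennreal (g i x))"
    "\<forall>i. energy (\<lambda>x. ennreal (g i x)) \<le> ennreal (cc + (1/2)^i)"
    "\<forall>i. energy (\<lambda>x. ennreal \<bar>g (Suc i) x - g i x\<bar>) \<le> ennreal (\<zeta> i)"
    using near_minimizers[of \<Omega> E cc \<zeta>, OF proper \<Omega> E cc \<zeta>_pos] by (elim exE conjE)
  note u = *(1)[rule_format] and g [measurable] = *(2)[rule_format] and g0 = *(3)[rule_format]
    and ug = *(4)[rule_format] and g_le = *(5)[rule_format] and diff = *(6)[rule_format]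
  have main: "bounded_cap M p ?E \<Omega> \<le> ennreal ((1 + \<theta>) powr p * ((1 + \<theta>) powr p * (cc + (1/2)^j) + (1 + 1 / \<theta>) powr p * (2 * (1/2)^j)))"
    if \<theta>: "0 < \<theta>" for \<theta> j
  proof -
    define d where "d i x = ennreal \<bar>g (Suc (j + i)) x - g (j + i) x\<bar>" for i x
    have [measurable]: "d i \<in> borel_measurable borel" for i
      unfolding d_def by measurable
    define S where "S x = (\<Sum>i. d i x)" for x
    have [measurable]: "S \<in> borel_measurable borel"
      unfolding S_def by measurable
    \<comment> \<open>By telescoping, \<open>g j\<close> plus all later absolute increments
      dominates every later gradient at every point.\<close>
    define H where "H x = ennreal (g j x) + S x" for x
    have H_meas [measurable]: "H \<in> borel_measurable borel"
      unfolding H_def by measurable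
    have g_H: "ennreal (g (j + n) x) \<le> H x" for n x
    proof -
      have "ennreal (g (j + n) x) \<le> ennreal (g j x) + (\<Sum>i<n. d i x)"
      proof (induction n)
        case (Suc n)
        have "ennreal (g (j + Suc n) x) \<le> ennreal (g (j + n) x + \<bar>g (Suc (j + n)) x - g (j + n) x\<bar>)"
          by (intro ennreal_leI) simp
        also have "\<dots> = ennreal (g (j + n) x) + d n x"
          using g0 by (simp add: d_def)
        also have "\<dots> \<le> ennreal (g j x) + (\<Sum>i<n. d i x) + d n x"
          by (intro add_right_mono Suc)
        finally show ?case by (simp add: add.assoc)
      qed simp
      also have "\<dots> \<le> H x"
        unfolding H_def S_def by (intro add_left_mono sum_le_suminf) auto
      finally show ?thesis .
    qed
    have S_le: "energy S \<le> ennreal (2 * (1/2)^j)"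
    proof -
      have sums: "(\<lambda>i. (1/2)^j * (1/2)^i) sums ((1/2)^j * (1 / (1 - 1/2 :: real)))"
        by (intro sums_mult geometric_sums) simp
      have "energy S \<le> ennreal (\<Sum>i. (1/2)^j * (1/2)^i)"
        unfolding S_def
      proof (rule energy_suminf_le)
        fix i
        have "(2 ^ Suc (j + i)) powr (- p) \<le> (2 ^ Suc i :: real) powr (- p)"
          using p_gt_1 by (intro powr_mono2') (auto intro: power_increasing)
        then have "\<zeta> (j + i) \<le> (2 ^ Suc i) powr (- p) * ((1/2)^j * (1/2)^i)"
          unfolding \<zeta>_def power_add by (rule mult_right_mono) simp
        then show "energy (d i) \<le> ennreal ((2 ^ Suc i) powr (- p) * ((1/2)^j * (1/2)^i))"
          unfolding d_def using diff[of "j + i"] by (meson ennreal_leI order_trans)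
      qed (use sums in \<open>auto dest: sums_summable\<close>)
      also have "(\<Sum>i. (1/2)^j * (1/2)^i) = 2 * (1/2::real)^j"
        using sums_unique[OF sums] by simp
      finally show ?thesis .
    qed
    have H_le: "energy H \<le> ennreal ((1 + \<theta>) powr p * (cc + (1/2)^j) + (1 + 1 / \<theta>) powr p * (2 * (1/2)^j))"
    proof -
      have "energy H \<le> ennreal ((1 + \<theta>) powr p) * energy (\<lambda>x. ennreal (g j x)) + ennreal ((1 + 1 / \<theta>) powr p) * energy S"
        unfolding H_def by (intro energy_add_le \<theta>) measurable
      also have "\<dots> \<le> ennreal ((1 + \<theta>) powr p) * ennreal (cc + (1/2)^j) + ennreal ((1 + 1 / \<theta>) powr p) * ennreal (2 * (1/2)^j)"
        by (intro add_mono mult_left_mono g_le S_le) auto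
      also have "\<dots> = ennreal ((1 + \<theta>) powr p * (cc + (1/2)^j) + (1 + 1 / \<theta>) powr p * (2 * (1/2)^j))"
        using cc(2) by (subst ennreal_plus) (auto simp: ennreal_mult[symmetric] simp del: ennreal_plus)
      finally show ?thesis .
    qed
    have "bounded_cap M p ?E \<Omega> \<le> ennreal ((1 + \<theta>) powr p) * energy H"
    \<comment> \<open>The sequence has been reindexed to start at \<open>j\<close>, so the tail
      index of the lemma is 0.\<close>
    proof (rule bounded_cap_SUP_le[OF proper, of "\<lambda>i. E (r (j + i))" \<Omega> "\<lambda>i. u (j + i)" H ?E 0 \<theta>])
      show "wug (u (j + i)) H" for i
        by (rule wug_mono[OF ug H_meas g_H])
      show "energy H < \<infinity>"
        using H_le by (rule le_less_trans) simp
      fix x assume "x \<in> ?E"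
      then obtain k where "x \<in> E k" by blast
      moreover have "E k \<subseteq> E (r (j + k))"
        using incseqD[OF E, of k "r (j + k)"] seq_suble[OF r, of "j + k"] by simp
      ultimately show "\<exists>i\<ge>0. x \<in> E (r (j + i))"
        by (intro exI[of _ k]) auto
    qed (use u bdd \<theta> in auto)
    also have "\<dots> \<le> ennreal ((1 + \<theta>) powr p) * ennreal ((1 + \<theta>) powr p * (cc + (1/2)^j) + (1 + 1 / \<theta>) powr p * (2 * (1/2)^j))"
      by (intro mult_left_mono H_le) simp
    also have "\<dots> = ennreal ((1 + \<theta>) powr p * ((1 + \<theta>) powr p * (cc + (1/2)^j) + (1 + 1 / \<theta>) powr p * (2 * (1/2)^j)))"
      using cc(2) by (intro ennreal_mult[symmetric]) auto
    finally show ?thesis .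
  qed
  obtain b where b: "bounded_cap M p ?E \<Omega> = ennreal b" "0 \<le> b"
    using main[of 1 0] by (cases "bounded_cap M p ?E \<Omega>") (auto simp: top_unique)
  have b_le: "b \<le> (1 + \<theta>) powr p * ((1 + \<theta>) powr p * (cc + (1/2)^j) + (1 + 1 / \<theta>) powr p * (2 * (1/2)^j))"
    if "0 < \<theta>" for \<theta> j
    using main[OF that, of j] b cc(2) by (simp add: ennreal_le_iff)
  \<comment> \<open>The limit in \<open>j\<close> comes first, with \<open>\<theta>\<close> fixed,
    because the coefficient \<open>(1 + 1 / \<theta>) powr p\<close> of the error blows up as
    \<open>\<theta>\<close> tends to 0.\<close>
  have b_le': "b \<le> (1 + \<theta>) powr p * ((1 + \<theta>) powr p * cc)" if "0 < \<theta>" for \<theta>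
  proof (rule LIMSEQ_le_const)
    have "(\<lambda>j. (1 + \<theta>) powr p * ((1 + \<theta>) powr p * (cc + (1/2)^j) + (1 + 1 / \<theta>) powr p * (2 * (1/2)^j)))
        \<longlonglongrightarrow> (1 + \<theta>) powr p * ((1 + \<theta>) powr p * (cc + 0) + (1 + 1 / \<theta>) powr p * (2 * 0))"
      by (intro tendsto_mult tendsto_add tendsto_const LIMSEQ_power_zero) simp_all
    then show "(\<lambda>j. (1 + \<theta>) powr p * ((1 + \<theta>) powr p * (cc + (1/2)^j) + (1 + 1 / \<theta>) powr p * (2 * (1/2)^j)))
        \<longlonglongrightarrow> (1 + \<theta>) powr p * ((1 + \<theta>) powr p * cc)"
      by simp
  qed (use b_le[OF that] in blast)
  have "b \<le> cc"
  proof (rule LIMSEQ_le_const)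
    have "(\<lambda>n. (1 + 1 / real (Suc n)) powr p * ((1 + 1 / real (Suc n)) powr p * cc)) \<longlonglongrightarrow> (1 + 0) powr p * ((1 + 0) powr p * cc)"
      by (intro tendsto_mult tendsto_powr tendsto_add tendsto_const LIMSEQ_Suc lim_1_over_n) simp_all
    then show "(\<lambda>n. (1 + 1 / real (Suc n)) powr p * ((1 + 1 / real (Suc n)) powr p * cc)) \<longlonglongrightarrow> cc"
      by simp
    show "\<exists>N. \<forall>n\<ge>N. b \<le> (1 + 1 / real (Suc n)) powr p * ((1 + 1 / real (Suc n)) powr p * cc)"
      by (intro exI allI impI b_le') simp
  qed
  then show ?thesis
    by (simp add: b ennreal_leI)
qed

end

section \<open>Countable unions\<close>

text \<open>Every ball about \<open>x\<close> lies in some ball about \<open>y\<close>. With the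
  roles exchanged as well, the supremum does not depend on the centre.\<close>

lemma SUP_bounded_cap_ball_le:
  "(SUP j. bounded_cap M p (E \<inter> ball x (real j)) \<Omega>) \<le> (SUP j. bounded_cap M p (E \<inter> ball y (real j)) \<Omega>)"
proof (rule SUP_least)
  fix j :: nat
  obtain k :: nat where k: "dist y x + real j \<le> real k"
    using real_arch_simple by blast
  have "ball x (real j) \<subseteq> ball y (real k)"
  proof
    fix z assume "z \<in> ball x (real j)"
    then show "z \<in> ball y (real k)"
      using k dist_triangle[of y z x] by auto
  qed
  then have "bounded_cap M p (E \<inter> ball x (real j)) \<Omega> \<le> bounded_cap M p (E \<inter> ball y (real k)) \<Omega>"
    by (intro bounded_cap_mono) auto
  then show "bounded_cap M p (E \<inter> ball x (real j)) \<Omega> \<le> (SUP j. bounded_cap M p (E \<inter> ball y (real j)) \<Omega>)"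
    by (rule SUP_upper2[OF UNIV_I])
qed

lemma incseq_bounded_cap_ball: "incseq (\<lambda>j. bounded_cap M p (E \<inter> ball x (real j)) \<Omega>)"
proof (rule incseq_SucI)
  show "bounded_cap M p (E \<inter> ball x (real j)) \<Omega> \<le> bounded_cap M p (E \<inter> ball x (real (Suc j))) \<Omega>" for j
    using subset_ball[of "real j" "real (Suc j)" x] by (intro bounded_cap_mono) auto
qed

lemma SUP_bounded_cap_ball_bounded:
  assumes "bounded E"
  shows "(SUP j. bounded_cap M p (E \<inter> ball x (real j)) \<Omega>) = bounded_cap M p E \<Omega>"
proof (rule antisym)
  show "(SUP j. bounded_cap M p (E \<inter> ball x (real j)) \<Omega>) \<le> bounded_cap M p E \<Omega>"
    by (intro SUP_least bounded_cap_mono) auto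
  obtain R where "E \<subseteq> ball x R"
    using assms bounded_subset_ballD by blast
  moreover obtain k :: nat where "R \<le> real k"
    using real_arch_simple by blast
  ultimately have "E \<inter> ball x (real k) = E"
    using subset_ball[of R "real k" x] by auto
  then show "bounded_cap M p E \<Omega> \<le> (SUP j. bounded_cap M p (E \<inter> ball x (real j)) \<Omega>)"
    by (intro SUP_upper2[of k]) auto
qed

context metric_measure
begin

lemma bounded_cap_empty: "proper_space TYPE('a) \<Longrightarrow> bounded_cap M p {} \<Omega> = 0"
proof -
  assume proper: "proper_space TYPE('a)"
  have "admissible {} \<Omega> (\<lambda>_. 0)"
    by (auto simp: admissible_def)
  from bounded_cap_le_energy[OF proper this wug_const]
  show ?thesis by simp
qed

text \<open>One formula covers all branches of the definition, with a freely chosen base point, so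
  bounded and unbounded sets are treated alike from here on.\<close>

lemma cap_eq_SUP:
  assumes proper: "proper_space TYPE('a)"
  shows "cap M p E \<Omega> = (SUP j. bounded_cap M p (E \<inter> ball x (real j)) \<Omega>)"
proof (cases "bounded E")
  case True
  then have "cap M p E \<Omega> = bounded_cap M p E \<Omega>"
    \<comment> \<open>The convention for two empty sets agrees with \<open>bounded_cap\<close>,
      which is 0 on the empty set.\<close>
    using bounded_cap_empty[OF proper, of \<Omega>] by (auto simp: cap_def)
  then show ?thesis
    by (simp add: SUP_bounded_cap_ball_bounded[OF True])
next
  case False
  let ?S = "SUP j. bounded_cap M p (E \<inter> ball x (real j)) \<Omega>"
  have lim: "(\<lambda>j. bounded_cap M p (E \<inter> ball y (real j)) \<Omega>) \<longlonglongrightarrow> ?S" for y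
  proof -
    have "(SUP j. bounded_cap M p (E \<inter> ball y (real j)) \<Omega>) = ?S"
      by (intro antisym SUP_bounded_cap_ball_le)
    then show ?thesis
      using LIMSEQ_SUP[OF incseq_bounded_cap_ball[of M p E y \<Omega>]] by simp
  qed
  have "(THE c. \<forall>y. (\<lambda>j. bounded_cap M p (E \<inter> ball y (real j)) \<Omega>) \<longlonglongrightarrow> c) = ?S"
  proof (rule the_equality)
    show "c = ?S" if "\<forall>y. (\<lambda>j. bounded_cap M p (E \<inter> ball y (real j)) \<Omega>) \<longlonglongrightarrow> c" for c
      using that lim LIMSEQ_unique by blast
  qed (use lim in blast)
  then show ?thesis
    using False by (auto simp: cap_def)
qed

section \<open>Continuity from below and subadditivity\<close>

lemma cap_mono:
  assumes "proper_space TYPE('a)" "A \<subseteq> B"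
  shows "cap M p A \<Omega> \<le> cap M p B \<Omega>"
proof -
  fix x :: 'a
  show ?thesis
    unfolding cap_eq_SUP[OF assms(1), of _ _ x]
    using assms(2) by (intro SUP_mono' bounded_cap_mono) auto
qed

text \<open>The suprema over the index and over the balls are interchanged: inside a fixed ball the
  union is bounded and \<open>bounded_cap_union_le\<close> applies.\<close>

lemma cap_Union_incseq:
  fixes E :: "nat \<Rightarrow> 'a set"
  assumes proper: "proper_space TYPE('a)" and \<Omega>: "open \<Omega>" and E: "incseq E"
  shows "cap M p (\<Union>i. E i) \<Omega> = (SUP i. cap M p (E i) \<Omega>)"
proof (rule antisym)
  fix x :: 'a
  have "bounded_cap M p ((\<Union>i. E i) \<inter> ball x (real j)) \<Omega> \<le> (SUP i. cap M p (E i) \<Omega>)" (is "_ \<le> ?S") for j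
  proof (cases ?S)
    case (real s)
    have "bounded_cap M p (\<Union>i. E i \<inter> ball x (real j)) \<Omega> \<le> ennreal s"
    proof (rule bounded_cap_union_le[OF proper \<Omega>])
      show "incseq (\<lambda>i. E i \<inter> ball x (real j))"
        using E by (auto simp: incseq_def)
      show "bounded (\<Union>i. E i \<inter> ball x (real j))"
        by (rule bounded_subset[OF bounded_ball[of x "real j"]]) auto
      fix i
      have "bounded_cap M p (E i \<inter> ball x (real j)) \<Omega> \<le> cap M p (E i) \<Omega>"
        unfolding cap_eq_SUP[OF proper, of _ _ x] by (rule SUP_upper) simp
      also have "\<dots> \<le> ?S"
        by (rule SUP_upper) simp
      finally show "bounded_cap M p (E i \<inter> ball x (real j)) \<Omega> \<le> ennreal s"
        by (simp add: real)
    qed (fact real)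
    then show ?thesis
      by (simp add: real Int_commute)
  next
    case top
    then show ?thesis by (simp only: top_greatest)
  qed
  then show "cap M p (\<Union>i. E i) \<Omega> \<le> (SUP i. cap M p (E i) \<Omega>)"
    by (subst cap_eq_SUP[OF proper, of _ _ x]) (rule SUP_least)
  show "(SUP i. cap M p (E i) \<Omega>) \<le> cap M p (\<Union>i. E i) \<Omega>"
    by (intro SUP_least cap_mono proper) auto
qed

text \<open>The maximum of the gradients belongs to the maximum of the competitors, and the p-th
  power of a maximum is at most the sum of the p-th powers, so no constant appears.\<close>

lemma bounded_cap_Un_le:
  assumes proper: "proper_space TYPE('a)" and \<Omega>: "open \<Omega>"
  shows "bounded_cap M p (A \<union> B) \<Omega> \<le> bounded_cap M p A \<Omega> + bounded_cap M p B \<Omega>"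
proof (cases "bounded_cap M p A \<Omega> < \<infinity> \<and> bounded_cap M p B \<Omega> < \<infinity>")
  case True
  show ?thesis
  proof (rule ennreal_le_epsilon)
    fix e :: real assume "0 < e"
    then have e: "0 < e / 2" by simp
    have "bounded_cap M p A \<Omega> < bounded_cap M p A \<Omega> + ennreal (e / 2)"
      "bounded_cap M p B \<Omega> < bounded_cap M p B \<Omega> + ennreal (e / 2)"
      using True e by (simp_all add: less_top[symmetric] ennreal_less_zero_iff)
    then obtain u g v h where u: "admissible A \<Omega> u" "wug u g" "energy g < bounded_cap M p A \<Omega> + ennreal (e / 2)"
      and v: "admissible B \<Omega> v" "wug v h" "energy h < bounded_cap M p B \<Omega> + ennreal (e / 2)"
      using bounded_cap_approx[OF proper \<Omega>] by metis
    \<comment> \<open>The maximum is written as a supremum over \<open>{0, 1}\<close> to make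
      \<open>wug_SUP\<close> applicable.\<close>
    define U where "U i = (if i = 0 then u else v)" for i :: nat
    define G where "G i = (if i = 0 then g else h)" for i :: nat
    have max_eq: "(\<lambda>x. SUP i\<in>{0, 1}. U i x) = (\<lambda>x. max (u x) (v x))" "(\<lambda>x. SUP i\<in>{0, 1}. G i x) = (\<lambda>x. max (g x) (h x))"
      by (auto simp: U_def G_def sup_max cSup_insert)
    have wug_max: "wug (\<lambda>x. max (u x) (v x)) (\<lambda>x. max (g x) (h x))"
      unfolding max_eq[symmetric] using u(2) v(2) admissibleD(4)[OF u(1)] admissibleD(4)[OF v(1)]
      by (intro wug_SUP[where c = 1]) (auto simp: U_def G_def)
    have "admissible (A \<union> B) \<Omega> (\<lambda>x. max (u x) (v x))"
    proof (rule admissible_dominated)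
      show "(\<lambda>x. max (u x) (v x)) \<in> borel_measurable M"
        using admissibleD(1)[OF u(1)] admissibleD(1)[OF v(1)] by measurable
      show "indicator (A \<union> B) x \<le> max (u x) (v x)" for x
        using admissibleD(3,5)[OF u(1), of x] admissibleD(3,5)[OF v(1), of x]
        by (cases "x \<in> A"; cases "x \<in> B") auto
      show "max (u x) (v x) \<le> indicator \<Omega> x" for x
        using admissibleD(4,6)[OF u(1), of x] admissibleD(4,6)[OF v(1), of x]
        by (cases "x \<in> \<Omega>") auto
      show "epow (ennreal (max (u x) (v x))) p \<le> epow (ennreal (u x)) p + epow (ennreal (v x)) p" for x
        by (auto simp: max_def)
      show "(\<integral>\<^sup>+ x. epow (ennreal (u x)) p + epow (ennreal (v x)) p \<partial>M) < \<infinity>"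
        using admissible_measurable_energy[OF u(1)] admissible_measurable_energy[OF v(1)]
          admissibleD(2)[OF u(1)] admissibleD(2)[OF v(1)]
        by (simp add: nn_integral_add)
    qed
    from bounded_cap_le_energy[OF proper this wug_max]
    have "bounded_cap M p (A \<union> B) \<Omega> \<le> energy (\<lambda>x. max (g x) (h x))" .
    also have "\<dots> \<le> (\<integral>\<^sup>+ x. epow (g x) p + epow (h x) p \<partial>M)"
      by (intro nn_integral_mono epow_max p_pos)
    also have "\<dots> = energy g + energy h"
      by (intro nn_integral_add measurable_energy wug_measurable[OF u(2)] wug_measurable[OF v(2)])
    also have "\<dots> \<le> (bounded_cap M p A \<Omega> + ennreal (e / 2)) + (bounded_cap M p B \<Omega> + ennreal (e / 2))"
      using u(3) v(3) by (intro add_mono less_imp_le)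
    also have "\<dots> = bounded_cap M p A \<Omega> + bounded_cap M p B \<Omega> + (ennreal (e / 2) + ennreal (e / 2))"
      by (simp add: ac_simps)
    also have "ennreal (e / 2) + ennreal (e / 2) = ennreal e"
      using e by (subst ennreal_plus[symmetric]) auto
    finally show "bounded_cap M p (A \<union> B) \<Omega> \<le> bounded_cap M p A \<Omega> + bounded_cap M p B \<Omega> + ennreal e" .
  qed
qed (auto simp: less_top[symmetric])

lemma cap_Un_le:
  assumes proper: "proper_space TYPE('a)" and \<Omega>: "open \<Omega>"
  shows "cap M p (A \<union> B) \<Omega> \<le> cap M p A \<Omega> + cap M p B \<Omega>"
proof -
  fix x :: 'a
  have "bounded_cap M p ((A \<union> B) \<inter> ball x (real j)) \<Omega> \<le> cap M p A \<Omega> + cap M p B \<Omega>" for j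
  proof -
    have "bounded_cap M p ((A \<union> B) \<inter> ball x (real j)) \<Omega>
        \<le> bounded_cap M p (A \<inter> ball x (real j)) \<Omega> + bounded_cap M p (B \<inter> ball x (real j)) \<Omega>"
      unfolding Int_Un_distrib2 by (rule bounded_cap_Un_le[OF proper \<Omega>])
    also have "\<dots> \<le> cap M p A \<Omega> + cap M p B \<Omega>"
      unfolding cap_eq_SUP[OF proper, of _ _ x] by (intro add_mono SUP_upper) auto
    finally show ?thesis .
  qed
  then show ?thesis
    by (subst cap_eq_SUP[OF proper, of _ _ x]) (rule SUP_least)
qed

lemma cap_UN_lessThan_le:
  fixes E :: "nat \<Rightarrow> 'a set"
  assumes proper: "proper_space TYPE('a)" and \<Omega>: "open \<Omega>"
  shows "cap M p (\<Union>i<n. E i) \<Omega> \<le> (\<Sum>i<n. cap M p (E i) \<Omega>)"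
proof (induction n)
  case 0
  fix x :: 'a
  show ?case
    by (simp add: cap_eq_SUP[OF proper, of _ _ x] bounded_cap_empty[OF proper])
next
  case (Suc n)
  have "cap M p (\<Union>i<Suc n. E i) \<Omega> \<le> cap M p (E n) \<Omega> + cap M p (\<Union>i<n. E i) \<Omega>"
    unfolding lessThan_Suc UN_insert by (rule cap_Un_le[OF proper \<Omega>])
  also have "\<dots> \<le> cap M p (E n) \<Omega> + (\<Sum>i<n. cap M p (E i) \<Omega>)"
    by (intro add_left_mono Suc)
  finally show ?case by (simp add: add.commute)
qed

text \<open>Continuity from below, applied to the partial unions, carries the finite inequality over
  to the countable union.\<close>

lemma cap_UN_le_suminf:
  fixes E :: "nat \<Rightarrow> 'a set"
  assumes proper: "proper_space TYPE('a)" and \<Omega>: "open \<Omega>"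
  shows "cap M p (\<Union>i. E i) \<Omega> \<le> (\<Sum>i. cap M p (E i) \<Omega>)"
proof -
  have "(\<Union>i. E i) = (\<Union>n. \<Union>i<n. E i)"
    by blast
  moreover have "incseq (\<lambda>n. \<Union>i<n. E i)"
    by (auto simp: incseq_def intro: less_le_trans)
  ultimately have "cap M p (\<Union>i. E i) \<Omega> = (SUP n. cap M p (\<Union>i<n. E i) \<Omega>)"
    using cap_Union_incseq[OF proper \<Omega>, of "\<lambda>n. \<Union>i<n. E i"] by simp
  also have "\<dots> \<le> (\<Sum>i. cap M p (E i) \<Omega>)"
    by (intro SUP_least order_trans[OF cap_UN_lessThan_le[OF proper \<Omega>]] sum_le_suminf) auto
  finally show ?thesis .
qed

end

theorem theorem1p6:
  fixes M :: "'a::metric_space measure" and p :: real and \<Omega> :: "'a set"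
  assumes "metric_measure_space M"
    and "1 < p"
    and "proper_space TYPE('a)"
    and "connected (UNIV :: 'a set)"
    and "locally_doubling M"
    and "local_poincare M p"
    and "open \<Omega>"
  shows "(\<forall>E :: nat \<Rightarrow> 'a set. (\<forall>i. E i \<subseteq> E (Suc i)) \<and> (\<forall>i. E i \<subseteq> \<Omega>) \<longrightarrow>
            (\<lambda>i. cap M p (E i) \<Omega>) \<longlonglongrightarrow> cap M p (\<Union>i. E i) \<Omega>)
       \<and> (\<forall>E :: nat \<Rightarrow> 'a set. (\<forall>i. E i \<subseteq> \<Omega>) \<longrightarrow>
            cap M p (\<Union>i. E i) \<Omega> \<le> (\<Sum>i. cap M p (E i) \<Omega>))"
proof -
  interpret metric_measure M p
    using assms by unfold_locales
  have "(\<lambda>i. cap M p (E i) \<Omega>) \<longlonglongrightarrow> cap M p (\<Union>i. E i) \<Omega>" if "\<forall>i. E i \<subseteq> E (Suc i)" for E :: "nat \<Rightarrow> 'a set"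
  proof -
    have E: "incseq E"
      using that by (simp add: incseq_Suc_iff)
    then have "incseq (\<lambda>i. cap M p (E i) \<Omega>)"
      using cap_mono[OF assms(3)] by (simp add: incseq_Suc_iff)
    from LIMSEQ_SUP[OF this] show ?thesis
      by (simp add: cap_Union_incseq[OF assms(3,7) E])
  qed
  then show ?thesis
    using cap_UN_le_suminf[OF assms(3,7)] by blast
qed

end
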